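(* Let $\mathcal{R}$ be a dense subring of $\mathbb{R}$, let $A$ be a primitive matrix over $\mathcal{R}$, and let $B$ be a square matrix over $\mathcal{R}$ which is shift equivalent over $\mathcal{R}$ to $A$. Then $B$ is strong shift equivalent over $\mathcal{R}$ to a primitive matrix (i.e. there is a primitive matrix $C$ with entries in $\mathcal{R}$ such that $B$ and $C$ are strong shift equivalent over $\mathcal{R}$).
   Context: Rings (and subrings) contain $1$. "Dense" means dense in $\mathbb{R}$ in the usual topology. A primitive matrix is a square real matrix which is entrywise nonnegative and some positive power of which has all entries strictly positive. Square matrices $A,B$ over $\mathcal{R}$ (not necessarily of the same size) are shift equivalent over $\mathcal{R}$ if there exist a positive integer $\ell$ and matrices $U,V$ over $\mathcal{R}$ (rectangular, of the appropriate sizes) such that $A^{\ell}=UV$, $B^{\ell}=VU$, $AU=UB$, $BV=VA$. Square matrices $A,B$ over $\mathcal{R}$ (not necessarily of the same size) are elementary strong shift equivalent over $\mathcal{R}$ if there exist matrices $U,V$ over $\mathcal{R}$ with $A=UV$ and $B=VU$. They are strong shift equivalent over $\mathcal{R}$ if there are a positive integer $\ell$ and square matrices $A=A_0,A_1,\dots,A_\ell=B$ over $\mathcal{R}$ such that $A_{i-1}$ and $A_i$ are elementary strong shift equivalent over $\mathcal{R}$ for $1\le i\le \ell$. *)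

theory Defs
  imports
    "HOL-Analysis.Elementary_Topology"
    "HOL-Algebra.Subrings"
    "HOL-Algebra.Algebraic_Closure_Type"
    "Jordan_Normal_Form.Matrix"
begin

abbreviation real_ring :: "real ring" where
  "real_ring \<equiv> ring_of_type_algebra"

lemma subring_real_ring_iff:
  "subring R real_ring \<longleftrightarrow>
     1 \<in> R \<and> (\<forall>x\<in>R. \<forall>y\<in>R. x - y \<in> R) \<and> (\<forall>x\<in>R. \<forall>y\<in>R. x * y \<in> R)"
proof -
  interpret ring real_ring
    by (rule ring_from_type_algebra)
  have neg: "\<ominus>\<^bsub>real_ring\<^esub> x = - x" for x
    by (rule minus_equality) (auto simp: ring_of_type_algebra_def)
  have ops: "carrier real_ring = UNIV" "\<one>\<^bsub>real_ring\<^esub> = 1"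
    "x \<otimes>\<^bsub>real_ring\<^esub> y = x * y" "x \<oplus>\<^bsub>real_ring\<^esub> y = x + y" for x y
    by (simp_all add: ring_of_type_algebra_def)
  show ?thesis
  proof
    assume "subring R real_ring"
    note E = subringE(3,5-7)[OF this, unfolded ops neg]
    from E(1) have 1: "1 \<in> R" .
    have neg': "- x \<in> R" if "x \<in> R" for x using E(2)[OF that] .
    have mult': "x * y \<in> R" if "x \<in> R" "y \<in> R" for x y using E(3)[OF that] .
    have add': "x + y \<in> R" if "x \<in> R" "y \<in> R" for x y using E(4)[OF that] .
    have "x - y \<in> R" if "x \<in> R" "y \<in> R" for x y
      using add'[OF that(1) neg'[OF that(2)]] by simp
    with 1 mult' show "1 \<in> R \<and> (\<forall>x\<in>R. \<forall>y\<in>R. x - y \<in> R) \<and> (\<forall>x\<in>R. \<forall>y\<in>R. x * y \<in> R)"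
      by blast
  next
    assume *: "1 \<in> R \<and> (\<forall>x\<in>R. \<forall>y\<in>R. x - y \<in> R) \<and> (\<forall>x\<in>R. \<forall>y\<in>R. x * y \<in> R)"
    then have "1 - 1 \<in> R" by blast
    then have zero: "0 \<in> R" by simp
    have neg': "- x \<in> R" if "x \<in> R" for x
    proof -
      from * zero that have "0 - x \<in> R" by blast
      then show ?thesis by simp
    qed
    have add': "x + y \<in> R" if "x \<in> R" "y \<in> R" for x y
    proof -
      from * neg' that have "x - (- y) \<in> R" by blast
      then show ?thesis by simp
    qed
    show "subring R real_ring"
      by (rule subringI) (use * neg' add' in \<open>auto simp: ops neg\<close>)
  qed
qed

definition mats_over :: "'a set \<Rightarrow> nat \<Rightarrow> nat \<Rightarrow> 'a mat set" where
  "mats_over R n m = {M \<in> carrier_mat n m. elements_mat M \<subseteq> R}"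

(* Matrices here may have size 0, and the empty matrix would satisfy the positivity conditions
   vacuously.  It is excluded: it is shift equivalent to every nilpotent matrix, and a nilpotent
   matrix need not be strong shift equivalent to zero. *)
definition primitive_mat :: "real mat \<Rightarrow> bool" where
  "primitive_mat A \<longleftrightarrow>
     square_mat A \<and> dim_row A > 0 \<and>
     (\<forall>x \<in> elements_mat A. 0 \<le> x) \<and>
     (\<exists>k>0. \<forall>x \<in> elements_mat (A ^\<^sub>m k). 0 < x)"

definition shift_equivalent :: "'a::comm_ring_1 set \<Rightarrow> 'a mat \<Rightarrow> 'a mat \<Rightarrow> bool" where
  "shift_equivalent R A B \<longleftrightarrow>
     (\<exists>n m. A \<in> mats_over R n n \<and> B \<in> mats_over R m m \<and>
       (\<exists>l>0. \<exists>U \<in> mats_over R n m. \<exists>V \<in> mats_over R m n.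
          A ^\<^sub>m l = U * V \<and> B ^\<^sub>m l = V * U \<and> A * U = U * B \<and> B * V = V * A))"

definition elementary_sse :: "'a::comm_ring_1 set \<Rightarrow> 'a mat \<Rightarrow> 'a mat \<Rightarrow> bool" where
  "elementary_sse R A B \<longleftrightarrow>
     (\<exists>n m. A \<in> mats_over R n n \<and> B \<in> mats_over R m m \<and>
       (\<exists>U \<in> mats_over R n m. \<exists>V \<in> mats_over R m n. A = U * V \<and> B = V * U))"

(* Intermediate matrices of size 0 do not enlarge this relation on nonempty matrices: the only
   matrices elementary equivalent to the empty one are zero matrices, and any two of these are
   elementary equivalent to each other. *)
definition strong_shift_equivalent :: "'a::comm_ring_1 set \<Rightarrow> 'a mat \<Rightarrow> 'a mat \<Rightarrow> bool" where
  "strong_shift_equivalent R A B \<longleftrightarrow>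
     (\<exists>l>0. \<exists>As :: nat \<Rightarrow> 'a mat. As 0 = A \<and> As l = B \<and>
       (\<forall>i\<in>{1..l}. elementary_sse R (As (i - 1)) (As i)))"

end

theory Submission
  imports Defs "Jordan_Normal_Form.Schur_Decomposition" "HOL-Analysis.Elementary_Metric_Spaces"
begin

text \<open>
  A shift equivalence between \<open>B\<close> and \<open>A\<close> yields an explicit zero extension of \<open>B\<close> in which \<open>A\<close>
  is the restriction to an invariant direct summand with nilpotent quotient, so \<open>B\<close> is strong
  shift equivalent to \<open>A \<oplus> Q\<close> with \<open>Q\<close> nilpotent. Over the reals \<open>Q\<close> is similar to matrices as small as we please;
  since the ring is dense, \<open>Q\<close> is elementary equivalent over it to matrices with entries tending to
  zero.

  If \<open>A\<close> has trace zero, an arbitrary small perturbation cannot be absorbed by \<open>A\<close>. Therefore one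
  passes to polynomial matrices \<open>I - t C\<^sub>1 - t\<^sup>2 C\<^sub>2 - \<dots>\<close>, where row operations with constant
  term \<open>I\<close> are strong shift equivalences of companion matrices. Because \<open>det (I - t Q) = 1\<close>, such
  operations remove all terms of \<open>I - t Q\<close> of degree below any given \<open>L\<close>, and they keep the
  remaining coefficients small. On the other hand row operations turn \<open>I - t A\<close> into a polynomial
  matrix whose \<open>t ^ j\<close>-coefficients dominate multiples of \<open>A ^ j\<close> for all \<open>j\<close> up to any given bound,
  and \<open>A ^ j > 0\<close> for \<open>j \<ge> L\<close>. A conjugation by constants mixes the two blocks and makes every
  coefficient nonnegative, and positive in the degrees between \<open>L\<close> and the bound.
\<close>

section \<open>Strong shift equivalence over a subring\<close>

text \<open>A perturbation of the coefficient of t^j can be absorbed only where \<open>A ^ j\<close>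
  has no zero entry; so the nilpotent block may be felt only in degrees from L on. The operations
  available for clearing its lower degrees are \<open>I + t^i Y\<close> with
  \<open>Y = F * W\<close> and \<open>W * F = 0\<close>. Such a Y has trace zero, so they can push
  the diagonal of a coefficient into one corner entry but cannot remove it; that the corner is zero
  has to come from the determinant, which these operations preserve.

  Smallness is expressed by sequences with index \<nu>. The order of choices matters: raising the
  order increases degrees, and the positivity margin of the A-block depends on the degree d up to
  which it is arranged. Hence the degree bound must be uniform in \<nu>; it fixes d, then the limit
  coefficients, and \<nu> is chosen last. Degrees below L and above d carry no perturbation at all,
  so weak inequalities survive there.

  In the top degree d + 1 only one of the two copies of A has positive entries. One row v of that
  copy is enough for primitivity, because all states can be reached through it. Cycles of the
  consecutive lengths L and L + 1 exclude periodicity.\<close>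

lemma mats_overI:
  assumes "M \<in> carrier_mat n m" and "\<And>i j. i < n \<Longrightarrow> j < m \<Longrightarrow> M $$ (i, j) \<in> R"
  shows "M \<in> mats_over R n m"
  using assms unfolding mats_over_def elements_mat_def by auto

lemma mats_over_carrier: "M \<in> mats_over R n m \<Longrightarrow> M \<in> carrier_mat n m"
  unfolding mats_over_def by auto

lemma mats_over_index: "M \<in> mats_over R n m \<Longrightarrow> i < n \<Longrightarrow> j < m \<Longrightarrow> M $$ (i, j) \<in> R"
  unfolding mats_over_def by (auto dest: elements_matI)

text \<open>Splitting off the nilpotent part and the calculus of companion matrices are pure
  algebra; order and topology enter only in the later extensions of this locale.\<close>

locale unital_subring =
  fixes R :: "'a :: comm_ring_1 set"
  assumes one_closed [simp]: "1 \<in> R"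
    and diff_closed: "x \<in> R \<Longrightarrow> y \<in> R \<Longrightarrow> x - y \<in> R"
    and mult_closed: "x \<in> R \<Longrightarrow> y \<in> R \<Longrightarrow> x * y \<in> R"
begin

lemma zero_closed [simp]: "0 \<in> R"
  using diff_closed[of 1 1] by simp

lemma uminus_closed: "x \<in> R \<Longrightarrow> - x \<in> R"
  using diff_closed[of 0 x] by simp

lemma add_closed: "x \<in> R \<Longrightarrow> y \<in> R \<Longrightarrow> x + y \<in> R"
  using diff_closed[of x "- y"] uminus_closed by simp

lemma sum_closed: "(\<And>i. i \<in> I \<Longrightarrow> f i \<in> R) \<Longrightarrow> sum f I \<in> R"
  by (induction I rule: infinite_finite_induct) (auto intro: add_closed)

lemma zero_mats_over [simp]: "0\<^sub>m n m \<in> mats_over R n m"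
  by (rule mats_overI) auto

lemma one_mats_over [simp]: "1\<^sub>m n \<in> mats_over R n n"
  by (rule mats_overI) auto

lemma add_mats_over [simp, intro]:
  "A \<in> mats_over R n m \<Longrightarrow> B \<in> mats_over R n m \<Longrightarrow> A + B \<in> mats_over R n m"
  by (rule mats_overI)
    (auto intro: add_closed mats_over_index dest: mats_over_carrier simp: mats_over_carrier[THEN carrier_matD(1)] mats_over_carrier[THEN carrier_matD(2)])

lemma minus_mats_over [simp, intro]:
  "A \<in> mats_over R n m \<Longrightarrow> B \<in> mats_over R n m \<Longrightarrow> A - B \<in> mats_over R n m"
  by (rule mats_overI)
    (auto intro: diff_closed mats_over_index dest: mats_over_carrier simp: mats_over_carrier[THEN carrier_matD(1)] mats_over_carrier[THEN carrier_matD(2)])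

lemma uminus_mats_over [simp, intro]: "A \<in> mats_over R n m \<Longrightarrow> - A \<in> mats_over R n m"
  by (rule mats_overI)
    (auto intro: uminus_closed mats_over_index dest: mats_over_carrier simp: mats_over_carrier[THEN carrier_matD(1)] mats_over_carrier[THEN carrier_matD(2)])

lemma smult_mats_over [simp, intro]:
  "r \<in> R \<Longrightarrow> A \<in> mats_over R n m \<Longrightarrow> r \<cdot>\<^sub>m A \<in> mats_over R n m"
  by (rule mats_overI)
    (auto intro: mult_closed mats_over_index dest: mats_over_carrier simp: mats_over_carrier[THEN carrier_matD(1)] mats_over_carrier[THEN carrier_matD(2)])

lemma mult_mats_over [simp, intro]:
  assumes "A \<in> mats_over R n m" "B \<in> mats_over R m k"
  shows "A * B \<in> mats_over R n k"
proof (rule mats_overI)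
  have [simp]: "A \<in> carrier_mat n m" "B \<in> carrier_mat m k"
    using assms by (auto dest: mats_over_carrier)
  show "A * B \<in> carrier_mat n k" by (rule mult_carrier_mat[of A n m B k]) auto
  fix i j assume "i < n" "j < k"
  moreover have "dim_row A = n" "dim_col A = m" "dim_row B = m" "dim_col B = k"
    using assms[THEN mats_over_carrier] by blast+
  ultimately show "(A * B) $$ (i, j) \<in> R"
    using assms by (auto simp: scalar_prod_def intro!: sum_closed mult_closed mats_over_index)
qed

lemma four_block_mats_over [simp, intro]:
  assumes "A \<in> mats_over R n1 m1" "B \<in> mats_over R n1 m2" "C \<in> mats_over R n2 m1"
    "D \<in> mats_over R n2 m2"
  shows "four_block_mat A B C D \<in> mats_over R (n1 + n2) (m1 + m2)"
proof (rule mats_overI)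
  note c = assms[THEN mats_over_carrier]
  show "four_block_mat A B C D \<in> carrier_mat (n1 + n2) (m1 + m2)" using c by auto
  fix i j assume "i < n1 + n2" "j < m1 + m2"
  moreover have "dim_row A = n1" "dim_col A = m1" "dim_row D = n2" "dim_col D = m2" using c by auto
  ultimately show "four_block_mat A B C D $$ (i, j) \<in> R"
    using assms by (auto intro: mats_over_index)
qed

lemma pow_mats_over [simp, intro]:
  assumes "A \<in> mats_over R n n" shows "A ^\<^sub>m k \<in> mats_over R n n"
proof (induction k)
  case 0
  have "dim_row A = n" using assms by (auto dest: mats_over_carrier)
  then show ?case by simp
qed (use assms in auto)

abbreviation esse where "esse \<equiv> elementary_sse R"

text \<open>The transitive closure without reflexivity matches chains of length at least one;
  reflexivity then holds just for matrices over \<open>R\<close>.\<close>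

definition sse where "sse = (elementary_sse R)\<^sup>+\<^sup>+"

lemma esseI:
  assumes "U \<in> mats_over R n m" "V \<in> mats_over R m n" "A = U * V" "B = V * U"
  shows "esse A B"
  using assms unfolding elementary_sse_def by blast

lemma esse_sym: "esse A B \<Longrightarrow> esse B A"
  unfolding elementary_sse_def by blast

lemma esse_imp_sse: "esse A B \<Longrightarrow> sse A B"
  unfolding sse_def by auto

lemma sse_trans [trans]: "sse A B \<Longrightarrow> sse B C \<Longrightarrow> sse A C"
  unfolding sse_def by (rule tranclp_trans)

lemma sse_sym: "sse A B \<Longrightarrow> sse B A"
  unfolding sse_def 
  by (induction rule: tranclp_induct) (auto intro: esse_sym tranclp_into_tranclp2)

lemma sse_refl: "A \<in> mats_over R n n \<Longrightarrow> sse A A"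
  by (rule esse_imp_sse, rule esseI[of A n n "1\<^sub>m n"]) (auto dest!: mats_over_carrier)

lemma sse_iff_strong_shift_equivalent: "sse A B \<longleftrightarrow> strong_shift_equivalent R A B"
proof -
  have "(\<forall>i\<in>{1..l}. elementary_sse R (f (i - 1)) (f i)) \<longleftrightarrow> (\<forall>i<l. elementary_sse R (f i) (f (Suc i)))"
    for f :: "nat \<Rightarrow> 'a mat" and l
    by (auto simp: Ball_def Suc_le_eq gr0_conv_Suc)
  then show ?thesis
    unfolding sse_def strong_shift_equivalent_def tranclp_power relpowp_fun_conv by metis
qed

text \<open>Both matrices are products of \<open>S * A\<close> and \<open>S'\<close>, in the two
  orders.\<close>

lemma sse_similar:
  assumes "S \<in> mats_over R n n" "S' \<in> mats_over R n n" "S' * S = 1\<^sub>m n" "A \<in> mats_over R n n"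
  shows "sse A (S * A * S')"
proof -
  note c = assms(1,2,4)[THEN mats_over_carrier]
  have "S' * (S * A) = A"
    using c assms(3) by (simp flip: assoc_mult_mat[of S' n n S n A n])
  then show ?thesis
    by (intro esse_imp_sse esse_sym[OF esseI[of "S * A" n n S']]) (use assms in auto)
qed

text \<open>Serves twice: for the zero extensions that prepare the splitting, and for dropping a
  vanishing top coefficient from a companion matrix.\<close>

lemma sse_zero_column:
  assumes T: "T \<in> mats_over R n n" and E: "E \<in> mats_over R m n"
  shows "sse (four_block_mat T (0\<^sub>m n m) E (0\<^sub>m m m)) T"
proof (rule esse_imp_sse, rule esseI)
  note c = T[THEN mats_over_carrier] E[THEN mats_over_carrier]
  \<comment> \<open>Blocks of width or height 0 encode a column or a row of two blocks, so that
    \<open>mult_four_block_mat\<close> covers all block products, here and below.\<close>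
  let ?U = "four_block_mat T (0\<^sub>m n 0) E (0\<^sub>m m 0)" and ?V = "four_block_mat (1\<^sub>m n) (0\<^sub>m n m) (0\<^sub>m 0 n) (0\<^sub>m 0 m)"
  show "?U \<in> mats_over R (n + m) (n + 0)" "?V \<in> mats_over R (n + 0) (n + m)"
    using T E by (intro four_block_mats_over; simp)+
  show "four_block_mat T (0\<^sub>m n m) E (0\<^sub>m m m) = ?U * ?V"
    using c by (subst mult_four_block_mat[of _ n n _ 0 _ m _ _ n _ m]) auto
  have "?V * ?U = four_block_mat T (0\<^sub>m n 0) (0\<^sub>m 0 n) (0\<^sub>m 0 0)"
    using c by (subst mult_four_block_mat[of _ n n _ m _ 0 _ _ n _ 0]) auto
  also have "\<dots> = T" using c by (intro eq_matI) auto
  finally show "T = ?V * ?U" by simp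
qed

lemma esse_direct_sum_left:
  assumes Z: "Z \<in> mats_over R k k" and "T \<in> mats_over R n n" "Y \<in> mats_over R m m" "esse T Y"
  shows "esse (four_block_mat Z (0\<^sub>m k n) (0\<^sub>m n k) T) (four_block_mat Z (0\<^sub>m k m) (0\<^sub>m m k) Y)"
proof -
  from assms(4) obtain n' m' U V where UV: "T \<in> mats_over R n' n'" "Y \<in> mats_over R m' m'"
    "U \<in> mats_over R n' m'" "V \<in> mats_over R m' n'" "T = U * V" "Y = V * U"
    unfolding elementary_sse_def by blast
  have [simp]: "n' = n" "m' = m" using UV(1,2) assms(2,3) by (auto dest!: mats_over_carrier)
  note c = UV(3,4)[THEN mats_over_carrier] Z[THEN mats_over_carrier]
  show ?thesis
  proof (rule esseI)
    let ?U = "four_block_mat Z (0\<^sub>m k m) (0\<^sub>m n k) U" and ?V = "four_block_mat (1\<^sub>m k) (0\<^sub>m k n) (0\<^sub>m m k) V"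
    show "?U \<in> mats_over R (k + n) (k + m)" "?V \<in> mats_over R (k + m) (k + n)"
      using Z UV by auto
    show "four_block_mat Z (0\<^sub>m k n) (0\<^sub>m n k) T = ?U * ?V"
      using c UV by (subst mult_four_block_mat[of _ k k _ m _ n _ _ k _ n]) auto
    show "four_block_mat Z (0\<^sub>m k m) (0\<^sub>m m k) Y = ?V * ?U"
      using c UV by (subst mult_four_block_mat[of _ k k _ n _ m _ _ k _ m]) auto
  qed
qed

lemma esse_direct_sum_right:
  assumes Z: "Z \<in> mats_over R k k" and "T \<in> mats_over R n n" "Y \<in> mats_over R m m" "esse T Y"
  shows "esse (four_block_mat T (0\<^sub>m n k) (0\<^sub>m k n) Z) (four_block_mat Y (0\<^sub>m m k) (0\<^sub>m k m) Z)"
proof -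
  from assms(4) obtain n' m' U V where UV: "T \<in> mats_over R n' n'" "Y \<in> mats_over R m' m'"
    "U \<in> mats_over R n' m'" "V \<in> mats_over R m' n'" "T = U * V" "Y = V * U"
    unfolding elementary_sse_def by blast
  have [simp]: "n' = n" "m' = m" using UV(1,2) assms(2,3) by (auto dest!: mats_over_carrier)
  note c = UV(3,4)[THEN mats_over_carrier] Z[THEN mats_over_carrier]
  show ?thesis
  proof (rule esseI)
    let ?U = "four_block_mat U (0\<^sub>m n k) (0\<^sub>m k m) Z" and ?V = "four_block_mat V (0\<^sub>m m k) (0\<^sub>m k n) (1\<^sub>m k)"
    show "?U \<in> mats_over R (n + k) (m + k)" "?V \<in> mats_over R (m + k) (n + k)"
      using Z UV by auto
    show "four_block_mat T (0\<^sub>m n k) (0\<^sub>m k n) Z = ?U * ?V"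
      using c UV by (subst mult_four_block_mat[of _ n m _ k _ k _ _ n _ k]) auto
    show "four_block_mat Y (0\<^sub>m m k) (0\<^sub>m k m) Z = ?V * ?U"
      using c UV by (subst mult_four_block_mat[of _ m n _ k _ k _ _ m _ k]) auto
  qed
qed

end

section \<open>Splitting off a nilpotent summand\<close>

lemma pow_mat_Suc_left:
  assumes "A \<in> carrier_mat n n"
  shows "A ^\<^sub>m Suc k = A * A ^\<^sub>m k"
proof (induction k)
  case (Suc k)
  have "A ^\<^sub>m Suc (Suc k) = (A * A ^\<^sub>m k) * A" using Suc by simp
  also have "\<dots> = A * (A ^\<^sub>m k * A)" using assms by (intro assoc_mult_mat) auto
  finally show ?case by simp
qed (use assms in auto)

lemma intertwine_pow_mat:
  assumes B: "B \<in> carrier_mat m m" and A: "A \<in> carrier_mat n n" and V: "V \<in> carrier_mat m n"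
    and BV: "B * V = V * A"
  shows "B ^\<^sub>m k * V = V * A ^\<^sub>m k"
proof (induction k)
  case (Suc k)
  have "B ^\<^sub>m Suc k * V = B ^\<^sub>m k * (B * V)"
    using A B V by (simp add: assoc_mult_mat[of _ m m _ m _ n])
  also have "\<dots> = (B ^\<^sub>m k * V) * A"
    unfolding BV using A B V by (intro assoc_mult_mat[symmetric]) auto
  also have "\<dots> = V * (A ^\<^sub>m k * A)"
    unfolding Suc using A B V by (intro assoc_mult_mat) auto
  finally show ?case by simp
qed (use A B V in auto)

context unital_subring
begin

text \<open>Removing \<open>Y\<close> by a similarity would require solving
  \<open>A * X - X * Q = Y\<close> over \<open>R\<close>. Instead one elementary equivalence
  replaces \<open>Y\<close> by \<open>Y * Q\<close>, and N of them annihilate it.\<close>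

lemma sse_triangular_nilpotent:
  assumes A: "A \<in> mats_over R n n" and Y: "Y \<in> mats_over R n m" and Q: "Q \<in> mats_over R m m"
    and nil: "Q ^\<^sub>m N = 0\<^sub>m m m"
  shows "sse (four_block_mat A Y (0\<^sub>m m n) Q) (four_block_mat A (0\<^sub>m n m) (0\<^sub>m m n) Q)"
proof -
  note c = A[THEN mats_over_carrier] Y[THEN mats_over_carrier] Q[THEN mats_over_carrier]
  have step: "esse (four_block_mat A Y (0\<^sub>m m n) Q) (four_block_mat A (Y * Q) (0\<^sub>m m n) Q)"
    if Y: "Y \<in> mats_over R n m" for Y
  proof (rule esse_sym, rule esseI)
    note c = c Y[THEN mats_over_carrier]
    let ?U = "four_block_mat A Y (0\<^sub>m m n) (1\<^sub>m m)" and ?V = "four_block_mat (1\<^sub>m n) (0\<^sub>m n m) (0\<^sub>m m n) Q"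
    show "?U \<in> mats_over R (n + m) (n + m)" "?V \<in> mats_over R (n + m) (n + m)"
      using A Q Y by auto
    show "four_block_mat A (Y * Q) (0\<^sub>m m n) Q = ?U * ?V"
      using c by (subst mult_four_block_mat[of _ n n _ m _ m _ _ n _ m]) auto
    show "four_block_mat A Y (0\<^sub>m m n) Q = ?V * ?U"
      using c by (subst mult_four_block_mat[of _ n n _ m _ m _ _ n _ m]) auto
  qed
  have "sse (four_block_mat A Y (0\<^sub>m m n) Q) (four_block_mat A (Y * Q ^\<^sub>m k) (0\<^sub>m m n) Q)" for k
  proof (induction k)
    case 0
    show ?case using A Y Q c by (auto intro!: sse_refl[of _ "n + m"])
  next
    case (Suc k)
    note Suc
    also have "sse (four_block_mat A (Y * Q ^\<^sub>m k) (0\<^sub>m m n) Q) (four_block_mat A (Y * Q ^\<^sub>m k * Q) (0\<^sub>m m n) Q)"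
      using Y Q by (intro esse_imp_sse step) auto
    also have "Y * Q ^\<^sub>m k * Q = Y * Q ^\<^sub>m Suc k"
      using c by (simp add: assoc_mult_mat[of Y n m _ m Q m])
    finally show ?case .
  qed
  from this[of N] show ?thesis using nil c by simp
qed

text \<open>\<open>V * U\<close> is idempotent with an image on which \<open>B\<close> acts as
  \<open>A\<close>. The complementary summand, the image of \<open>e\<close>, need not be a free
  module, so no basis of it is chosen: \<open>Q = e * B * e\<close> acts on all of the m-dimensional
  space.\<close>

lemma sse_split_intertwiner:
  assumes A: "A \<in> mats_over R n n" and B: "B \<in> mats_over R m m"
    and V: "V \<in> mats_over R m n" and U: "U \<in> mats_over R n m" and P: "P \<in> mats_over R n m"
    and BV: "B * V = V * A" and UV: "U * V = 1\<^sub>m n" and BN: "B ^\<^sub>m N = V * P"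
  shows "\<exists>k Q. Q \<in> mats_over R k k \<and> Q ^\<^sub>m Suc N = 0\<^sub>m k k \<and>
    sse B (four_block_mat A (0\<^sub>m n k) (0\<^sub>m k n) Q)"
proof -
  note c = assms(1-5)[THEN mats_over_carrier]
  define e where "e = 1\<^sub>m m - V * U"
  have e: "e \<in> mats_over R m m" unfolding e_def using V U by auto
  note c = c e[THEN mats_over_carrier]
  have VUV: "V * U * V = V" using c UV by (simp add: assoc_mult_mat[of V m n U m V n])
  have eV: "e * V = 0\<^sub>m m n"
    unfolding e_def using c VUV by (subst minus_mult_distrib_mat[of _ m m _ _ n]) auto
  have ee: "e * e = e"
  proof -
    have "e * e = e * 1\<^sub>m m - e * (V * U)"
      using c by (subst (2) e_def, intro mult_minus_distrib_mat) auto
    also have "e * (V * U) = 0\<^sub>m m m"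
      using c eV by (simp add: assoc_mult_mat[of e m m V n U m, symmetric])
    also have "e * 1\<^sub>m m - 0\<^sub>m m m = e" using c by (intro eq_matI) auto
    finally show ?thesis .
  qed
  define Q where "Q = e * B * e"
  have Q: "Q \<in> mats_over R m m" unfolding Q_def using e B by auto
  note c = c Q[THEN mats_over_carrier]
  \<comment> \<open>\<open>?L * ?M\<close> is \<open>(V * U + e) * B = B\<close>. In the reversed
    product the lower left block \<open>e * B * V\<close> vanishes, because \<open>B\<close>
    preserves the image of \<open>V\<close> and \<open>e\<close> kills it.\<close>
  let ?L = "four_block_mat V e (0\<^sub>m 0 n) (0\<^sub>m 0 m)"
  let ?M = "four_block_mat (U * B) (0\<^sub>m n 0) (e * B) (0\<^sub>m m 0)"
  have L: "?L \<in> mats_over R m (n + m)"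
    using four_block_mats_over[of V m n e m "0\<^sub>m 0 n" 0 "0\<^sub>m 0 m"] V e by simp
  have M: "?M \<in> mats_over R (n + m) m"
    using four_block_mats_over[of "U * B" n m "0\<^sub>m n 0" 0 "e * B" m "0\<^sub>m m 0"] U e B by simp
  have "?L * ?M = four_block_mat (V * (U * B) + e * B) (0\<^sub>m m 0) (0\<^sub>m 0 m) (0\<^sub>m 0 0)"
    using c by (subst mult_four_block_mat[of _ m n _ m _ 0 _ _ m _ 0]) (auto simp: ee assoc_mult_mat[of e m m e m B m, symmetric])
  also have "\<dots> = V * (U * B) + e * B" using c by (intro eq_matI) auto
  also have "V * (U * B) + e * B = (V * U + e) * B"
    using c by (subst add_mult_distrib_mat[of _ m m _ _ m]) (auto simp: assoc_mult_mat[of V m n U m B m])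
  also have "V * U + e = 1\<^sub>m m" unfolding e_def using c by (intro eq_matI) auto
  finally have LM: "B = ?L * ?M" using c by simp
  have UBV: "U * B * V = A"
  proof -
    have "U * B * V = U * (V * A)" using c BV by (simp add: assoc_mult_mat[of U n m B m V n])
    also have "\<dots> = (U * V) * A" using c by (intro assoc_mult_mat[symmetric]) auto
    finally show ?thesis using UV c by simp
  qed
  have eBV: "e * B * V = 0\<^sub>m m n"
  proof -
    have "e * B * V = e * (V * A)" using c BV by (simp add: assoc_mult_mat[of e m m B m V n])
    also have "\<dots> = (e * V) * A" using c by (intro assoc_mult_mat[symmetric]) auto
    finally show ?thesis using eV c by simp
  qed
  have "?M * ?L = four_block_mat A (U * B * e) (0\<^sub>m m n) Q"
    using c UBV eBV unfolding Q_def
    by (subst mult_four_block_mat[of _ n m _ 0 _ m _ _ n _ m]) auto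
  then have *: "esse B (four_block_mat A (U * B * e) (0\<^sub>m m n) Q)"
    by (intro esseI[OF L M LM]) simp
  \<comment> \<open>Modulo the image of \<open>V\<close>, \<open>Q\<close> is the map induced by
    \<open>B\<close>. For \<open>k = N\<close> the right side is \<open>e * V * P = 0\<close>; one
    further factor of \<open>Q\<close> supplies the \<open>e\<close> in front, hence the exponent
    \<open>Suc N\<close>.\<close>
  have eQ: "e * Q ^\<^sub>m k = e * B ^\<^sub>m k" for k
  proof (induction k)
    case (Suc k)
    have "e * Q ^\<^sub>m Suc k = e * Q ^\<^sub>m k * Q"
      using c by (simp add: assoc_mult_mat[of e m m _ m Q m])
    also have "\<dots> = e * B ^\<^sub>m k * (B - V * U * B) "
    proof -
      have "e * B * (V * U) = 0\<^sub>m m m"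
        using eBV c by (simp add: assoc_mult_mat[of "e * B" m m V n U m, symmetric])
      then have "Q = e * B" unfolding Q_def e_def[symmetric]
        using c by (subst (2) e_def, subst mult_minus_distrib_mat[of _ m m _ m]) auto
      also have "\<dots> = B - V * U * B" unfolding e_def using c by (subst minus_mult_distrib_mat[of _ m m _ _ m]) auto
      finally show ?thesis using Suc by simp
    qed
    also have "\<dots> = e * B ^\<^sub>m k * B - e * B ^\<^sub>m k * (V * U * B)"
      using c by (subst mult_minus_distrib_mat[of _ m m _ m]) auto
    also have "e * B ^\<^sub>m k * (V * U * B) = 0\<^sub>m m m"
    proof -
      have "e * B ^\<^sub>m k * (V * U * B) = (e * B ^\<^sub>m k * V) * (U * B)"
        using c by (simp add: assoc_mult_mat[of "e * B ^\<^sub>m k" m m V n "U * B" m] assoc_mult_mat[of V m n U m B m])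
      also have "e * B ^\<^sub>m k * V = e * (V * A ^\<^sub>m k)"
        unfolding intertwine_pow_mat[OF c(2,1,3) BV, symmetric] using c by (intro assoc_mult_mat) auto
      also have "\<dots> = (e * V) * A ^\<^sub>m k" using c by (intro assoc_mult_mat[symmetric]) auto
      finally show ?thesis unfolding eV using c by simp
    qed
    also have "e * B ^\<^sub>m k * B - 0\<^sub>m m m = e * B ^\<^sub>m k * B" using c by (intro eq_matI) auto
    finally show ?case using c by (simp add: assoc_mult_mat[of e m m _ m B m])
  qed (use c in simp)
  have "Q ^\<^sub>m Suc N = (e * B) * (e * Q ^\<^sub>m N)"
    unfolding pow_mat_Suc_left[OF c(7)] using c
    by (subst Q_def) (intro assoc_mult_mat, auto)
  also have "e * Q ^\<^sub>m N = (e * V) * P"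
    unfolding eQ BN using c by (intro assoc_mult_mat[symmetric]) auto
  finally have "Q ^\<^sub>m Suc N = 0\<^sub>m m m" unfolding eV using c by simp
  then show ?thesis
    using * sse_triangular_nilpotent[OF A _ Q, of "U * B * e" "Suc N"] U B e Q
    by (meson esse_imp_sse sse_trans mult_mats_over)
qed

text \<open>Only \<open>P\<close> has to intertwine; \<open>U\<close> is a left inverse of \<open>V\<close> up to
  \<open>A ^ l\<close>, and each zero extension by \<open>U\<close> lowers \<open>l\<close> by one.\<close>

lemma sse_direct_sum_nilpotent:
  assumes A: "A \<in> mats_over R n n" and "B \<in> mats_over R m m"
    and "V \<in> mats_over R m n" and "U \<in> mats_over R n m" and "P \<in> mats_over R n m"
    and "B * V = V * A" and "P * B = A * P" and "U * V = A ^\<^sub>m l" and "B ^\<^sub>m N = V * P"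
  shows "\<exists>k Q N. Q \<in> mats_over R k k \<and> Q ^\<^sub>m N = 0\<^sub>m k k \<and>
    sse B (four_block_mat A (0\<^sub>m n k) (0\<^sub>m k n) Q)"
  using assms(2-)
proof (induction l arbitrary: m B V U P N)
  case 0
  then have "U * V = 1\<^sub>m n" using A[THEN mats_over_carrier] by simp
  from sse_split_intertwiner[OF A 0(1-5) this 0(8)] show ?case by blast
next
  case (Suc l)
  note c = A[THEN mats_over_carrier] Suc.prems(1-4)[THEN mats_over_carrier]
  \<comment> \<open>For \<open>?V\<close> to intertwine, its new rows X must satisfy
    \<open>U * V = X * A\<close>; as \<open>U * V = A ^ (l + 1)\<close>, \<open>X = A ^ l\<close>
    works and \<open>?U\<close> simply reads it off. The lower half of the power of
    \<open>?B\<close> is \<open>U * B ^ N = A ^ l * (A * P)\<close>, which forces the factor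
    \<open>A\<close> in \<open>?P\<close> and the step from N to N + 1.\<close>
  let ?B = "four_block_mat B (0\<^sub>m m n) U (0\<^sub>m n n)"
  let ?V = "four_block_mat V (0\<^sub>m m 0) (A ^\<^sub>m l) (0\<^sub>m n 0)"
  let ?U = "four_block_mat (0\<^sub>m n m) (1\<^sub>m n) (0\<^sub>m 0 m) (0\<^sub>m 0 n)"
  let ?P = "four_block_mat (A * P) (0\<^sub>m n n) (0\<^sub>m 0 m) (0\<^sub>m 0 n)"
  have four: "four_block_mat F (0\<^sub>m i 0) (0\<^sub>m 0 j) (0\<^sub>m 0 0) = F" if "F \<in> carrier_mat i j" for F :: "'a mat" and i j
    using that by (intro eq_matI) auto
  have B: "?B \<in> mats_over R (m + n) (m + n)" using Suc.prems by auto
  have V: "?V \<in> mats_over R (m + n) n"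
    using four_block_mats_over[of V m n "0\<^sub>m m 0" 0 "A ^\<^sub>m l" n "0\<^sub>m n 0"] A Suc.prems by auto
  have U: "?U \<in> mats_over R n (m + n)"
    using four_block_mats_over[of "0\<^sub>m n m" n m "1\<^sub>m n" n "0\<^sub>m 0 m" 0 "0\<^sub>m 0 n"] by simp
  have P: "?P \<in> mats_over R n (m + n)"
    using four_block_mats_over[of "A * P" n m "0\<^sub>m n n" n "0\<^sub>m 0 m" 0 "0\<^sub>m 0 n"] A Suc.prems by simp
  have "?B * ?V = four_block_mat (V * A) (0\<^sub>m m 0) (A ^\<^sub>m Suc l) (0\<^sub>m n 0)"
    using c Suc.prems(5,7) by (subst mult_four_block_mat[of _ m m _ n _ n _ _ n _ 0]) auto
  also have "\<dots> = ?V * four_block_mat A (0\<^sub>m n 0) (0\<^sub>m 0 n) (0\<^sub>m 0 0)"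
    using c by (subst mult_four_block_mat[of _ m n _ 0 _ n _ _ n _ 0]) auto
  also have "four_block_mat A (0\<^sub>m n 0) (0\<^sub>m 0 n) (0\<^sub>m 0 0) = A" using four c by blast
  finally have BV: "?B * ?V = ?V * A" .
  have "?P * ?B = four_block_mat (A * P * B) (0\<^sub>m n n) (0\<^sub>m 0 m) (0\<^sub>m 0 n)"
    using c by (subst mult_four_block_mat[of _ n m _ n _ 0 _ _ m _ n]) auto
  also have "A * P * B = A * (A * P)" using c Suc.prems(6) by (simp add: assoc_mult_mat[of A n n P m B m])
  also have "four_block_mat \<dots> (0\<^sub>m n n) (0\<^sub>m 0 m) (0\<^sub>m 0 n) =
      four_block_mat A (0\<^sub>m n 0) (0\<^sub>m 0 n) (0\<^sub>m 0 0) * ?P"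
    using c by (subst mult_four_block_mat[of _ n n _ 0 _ 0 _ _ m _ n]) auto
  also have "four_block_mat A (0\<^sub>m n 0) (0\<^sub>m 0 n) (0\<^sub>m 0 0) = A" using four c by blast
  finally have PB: "?P * ?B = A * ?P" .
  have "?U * ?V = four_block_mat (A ^\<^sub>m l) (0\<^sub>m n 0) (0\<^sub>m 0 n) (0\<^sub>m 0 0)"
    using c by (subst mult_four_block_mat[of _ n m _ n _ 0 _ _ n _ 0]) auto
  also have "\<dots> = A ^\<^sub>m l" using four c by auto
  finally have UV: "?U * ?V = A ^\<^sub>m l" .
  have pow: "?B ^\<^sub>m Suc k = four_block_mat (B ^\<^sub>m Suc k) (0\<^sub>m m n) (U * B ^\<^sub>m k) (0\<^sub>m n n)" for k
  proof (induction k)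
    case (Suc k)
    have "?B ^\<^sub>m Suc (Suc k) = four_block_mat (B ^\<^sub>m Suc k) (0\<^sub>m m n) (U * B ^\<^sub>m k) (0\<^sub>m n n) * ?B"
      using Suc by simp
    also have "\<dots> = four_block_mat (B ^\<^sub>m Suc k * B) (0\<^sub>m m n) (U * B ^\<^sub>m k * B) (0\<^sub>m n n)"
      using c by (subst mult_four_block_mat[of _ m m _ n _ n _ _ m _ n]) auto
    finally show ?case using c by (simp add: assoc_mult_mat[of U n m _ m B m])
  qed (use c in simp)
  have "B ^\<^sub>m Suc N = V * (A * P)"
    using c Suc.prems(6,8) by (simp add: assoc_mult_mat[of V m n P m B m])
  moreover have "U * B ^\<^sub>m N = A ^\<^sub>m l * (A * P)"
    using c Suc.prems(7,8) by (simp add: assoc_mult_mat[of U n m V n P m, symmetric] assoc_mult_mat[of "A ^\<^sub>m l" n n A n P m])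
  ultimately have "?B ^\<^sub>m Suc N = ?V * ?P"
    unfolding pow using c by (subst mult_four_block_mat[of _ m n _ 0 _ n _ _ m _ n]) auto
  from Suc.IH[OF B V U P BV PB UV this] obtain k Q N' where
    "Q \<in> mats_over R k k" "Q ^\<^sub>m N' = 0\<^sub>m k k" "sse ?B (four_block_mat A (0\<^sub>m n k) (0\<^sub>m k n) Q)"
    by blast
  moreover have "sse B ?B" using Suc.prems by (intro sse_sym[OF sse_zero_column]) auto
  ultimately show ?case by (blast intro: sse_trans)
qed

end

section \<open>Polynomial matrices and their companion matrices\<close>

definition coeff_mat :: "nat \<Rightarrow> 'a :: zero poly mat \<Rightarrow> 'a mat" where
  "coeff_mat d M = map_mat (\<lambda>p. coeff p d) M"

definition const_mat :: "'a :: zero mat \<Rightarrow> 'a poly mat" where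
  "const_mat S = map_mat (\<lambda>r. [:r:]) S"

text \<open>For \<open>I - \<Sum>j t ^ j C\<^sub>j\<close> the first block row is \<open>C\<^sub>1, \<dots>, C\<^sub>D\<close>. Up to strong shift
  equivalence the result does not depend on \<open>D\<close> once \<open>D\<close> is at least the degree.\<close>

definition companion :: "nat \<Rightarrow> nat \<Rightarrow> 'a :: comm_ring_1 poly mat \<Rightarrow> 'a mat" where
  "companion N D M = mat (N * D) (N * D) (\<lambda>(p, q).
     if p < N then - coeff_mat (q div N + 1) M $$ (p, q mod N)
     else if p = q + N then 1 else 0)"

lemma coeff_mat_carrier [simp]: "coeff_mat d M \<in> carrier_mat n m \<longleftrightarrow> M \<in> carrier_mat n m"
  unfolding coeff_mat_def by auto

lemma const_mat_carrier [simp]: "const_mat S \<in> carrier_mat n m \<longleftrightarrow> S \<in> carrier_mat n m"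
  unfolding const_mat_def by auto

lemma coeff_mat_dim [simp]: "dim_row (coeff_mat d M) = dim_row M" "dim_col (coeff_mat d M) = dim_col M"
  unfolding coeff_mat_def by auto

lemma const_mat_dim [simp]: "dim_row (const_mat M) = dim_row M" "dim_col (const_mat M) = dim_col M"
  unfolding const_mat_def by auto

lemma coeff_mat_index: "i < dim_row M \<Longrightarrow> j < dim_col M \<Longrightarrow> coeff_mat d M $$ (i, j) = coeff (M $$ (i, j)) d"
  unfolding coeff_mat_def by auto

lemma coeff_mat_eqI:
  assumes "M \<in> carrier_mat n m" "M' \<in> carrier_mat n m" "\<And>d. coeff_mat d M = coeff_mat d M'"
  shows "M = M'"
proof (rule eq_matI)
  fix i j assume "i < dim_row M'" "j < dim_col M'"
  then show "M $$ (i, j) = M' $$ (i, j)"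
    using assms by (intro poly_eqI) (metis carrier_matD coeff_mat_index)
qed (use assms in auto)

lemma companion_carrier [simp]: "companion N D M \<in> carrier_mat (N * D) (N * D)"
  unfolding companion_def by auto

lemma coeff_mat_const_mult:
  fixes M :: "'a :: comm_ring_1 poly mat"
  assumes "S \<in> carrier_mat n m" "M \<in> carrier_mat m k"
  shows "coeff_mat d (const_mat S * M) = S * coeff_mat d M"
  using assms by (intro eq_matI)
    (auto simp: coeff_mat_def const_mat_def scalar_prod_def coeff_sum)

lemma coeff_mat_mult_const:
  fixes M :: "'a :: comm_ring_1 poly mat"
  assumes "M \<in> carrier_mat n m" "S \<in> carrier_mat m k"
  shows "coeff_mat d (M * const_mat S) = coeff_mat d M * S"
  using assms by (intro eq_matI)
    (auto simp: coeff_mat_def const_mat_def scalar_prod_def coeff_sum mult.commute)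

lemma coeff_mat_add: "A \<in> carrier_mat n m \<Longrightarrow> B \<in> carrier_mat n m \<Longrightarrow>
    coeff_mat d (A + B) = coeff_mat d A + coeff_mat d B"
  unfolding coeff_mat_def by (intro eq_matI) auto

lemma coeff_mat_monom_smult:
  fixes M :: "'a :: comm_ring_1 poly mat"
  assumes "M \<in> carrier_mat n m"
  shows "coeff_mat d (monom 1 i \<cdot>\<^sub>m M) = (if i \<le> d then coeff_mat (d - i) M else 0\<^sub>m n m)"
  using assms by (intro eq_matI) (auto simp: coeff_mat_def coeff_monom_mult)

lemma coeff_mat_one: "coeff_mat d (1\<^sub>m n :: 'a :: comm_ring_1 poly mat) = (if d = 0 then 1\<^sub>m n else 0\<^sub>m n n)"
  by (intro eq_matI) (auto simp: coeff_mat_def)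

lemma coeff_mat_unipotent_mult:
  fixes M :: "'a :: comm_ring_1 poly mat"
  assumes M: "M \<in> carrier_mat n n" and Y: "Y \<in> carrier_mat n n"
  shows "coeff_mat d ((1\<^sub>m n + monom 1 i \<cdot>\<^sub>m const_mat Y) * M) =
    coeff_mat d M + (if i \<le> d then Y * coeff_mat (d - i) M else 0\<^sub>m n n)"
proof -
  have "(1\<^sub>m n + monom 1 i \<cdot>\<^sub>m const_mat Y) * M = M + monom 1 i \<cdot>\<^sub>m (const_mat Y * M)"
    using M Y by (subst add_mult_distrib_mat[of _ n n _ _ n]) auto
  then show ?thesis
    using M Y by (simp add: coeff_mat_add[of _ n n] coeff_mat_monom_smult[of _ n n]
        coeff_mat_const_mult[of _ n n _ n])
qed

lemma coeff_mat_eventually_zero: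
  assumes "M \<in> carrier_mat n m"
  shows "\<exists>D. \<forall>d>D. coeff_mat d M = 0\<^sub>m n m"
proof -
  let ?D = "Max (insert 0 ((\<lambda>(i, j). degree (M $$ (i, j))) ` ({..<n} \<times> {..<m})))"
  have "degree (M $$ (i, j)) \<le> ?D" if "i < n" "j < m" for i j
    using that by (intro Max_ge) (auto intro!: image_eqI[of _ _ "(i, j)"])
  then have "coeff_mat d M = 0\<^sub>m n m" if "d > ?D" for d
    using that assms by (intro eq_matI) (auto simp: coeff_mat_index intro!: coeff_eq_0 elim: le_less_trans)
  then show ?thesis by blast
qed

section \<open>Row operations on companion matrices\<close>

lemma sum_mod_block:
  fixes f :: "nat \<Rightarrow> 'a :: comm_monoid_add"
  assumes "N > 0" "j < D"
  shows "(\<Sum>x = 0..<N * D. if x div N = j then f x else 0) = (\<Sum>s = 0..<N. f (j * N + s))"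
proof -
  have "(\<Sum>s = 0..<N. f (j * N + s)) = (\<Sum>x\<in>(\<lambda>s. j * N + s) ` {0..<N}. f x)"
    by (subst sum.reindex) (auto simp: inj_on_def)
  also have "(\<lambda>s. j * N + s) ` {0..<N} = {x\<in>{0..<N * D}. x div N = j}"
  proof (intro equalityI subsetI)
    fix x assume "x \<in> (\<lambda>s. j * N + s) ` {0..<N}"
    then obtain s where s: "s < N" "x = j * N + s" unfolding image_iff by auto
    have "x < Suc j * N" using s by simp
    also have "\<dots> \<le> D * N" using assms by (intro mult_le_mono1) auto
    finally show "x \<in> {x\<in>{0..<N * D}. x div N = j}" using s assms by (auto simp: mult.commute)
  next
    fix x assume "x \<in> {x\<in>{0..<N * D}. x div N = j}"
    then show "x \<in> (\<lambda>s. j * N + s) ` {0..<N}"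
      using assms by (intro image_eqI[of _ _ "x mod N"]) (auto simp: div_mult_mod_eq)
  qed
  also have "(\<Sum>x\<in>{x\<in>{0..<N * D}. x div N = j}. f x) = (\<Sum>x = 0..<N * D. if x div N = j then f x else 0)"
    by (rule sum.inter_filter) simp
  finally show ?thesis by simp
qed

text \<open>Below its first N rows \<open>T\<close> is a block shift. While the leading blocks of
  \<open>V\<close> vanish, the arbitrary top rows of \<open>T\<close> are never met, so a power of
  \<open>T\<close> only shifts \<open>V\<close>.\<close>

lemma pow_mat_row_shift:
  fixes T V :: "'a :: comm_ring_1 mat"
  assumes T: "T \<in> carrier_mat K K" and V: "V \<in> carrier_mat r K"
    and shift: "\<And>p q. N \<le> p \<Longrightarrow> p < K \<Longrightarrow> q < K \<Longrightarrow> T $$ (p, q) = (if p = q + N then 1 else 0)"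
    and zero: "\<And>u p. u < r \<Longrightarrow> p < j * N \<Longrightarrow> p < K \<Longrightarrow> V $$ (u, p) = 0"
    and u: "u < r" and q: "q < K"
  shows "(V * T ^\<^sub>m j) $$ (u, q) = (if q + j * N < K then V $$ (u, q + j * N) else 0)"
  using zero q
proof (induction j arbitrary: q)
  case 0
  then show ?case using V u T by simp
next
  case (Suc j)
  define G where "G = V * T ^\<^sub>m j"
  have c: "G \<in> carrier_mat r K" unfolding G_def using T V by (intro mult_carrier_mat[of _ _ K]) auto
  have IH: "G $$ (u, p) = (if p + j * N < K then V $$ (u, p + j * N) else 0)" if "p < K" for p
    unfolding G_def
  proof (rule Suc.IH)
    show "V $$ (u, p) = 0" if "u < r" "p < j * N" "p < K" for u p
      using Suc.prems(1)[of u p] that by simp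
  qed (use that in simp)
  have G0: "G $$ (u, p) = 0" if "p < N" "p < K" for p
    using IH[of p] Suc.prems(1)[OF u, of "p + j * N"] that by (simp split: if_splits)
  have "V * T ^\<^sub>m Suc j = G * T"
    unfolding G_def using T V by (simp add: assoc_mult_mat[of V r K _ K T K])
  then have "(V * T ^\<^sub>m Suc j) $$ (u, q) = (\<Sum>p = 0..<K. G $$ (u, p) * T $$ (p, q))"
    using c T u Suc.prems(2) by (simp add: scalar_prod_def)
  also have "\<dots> = (\<Sum>p = 0..<K. if p = q + N then G $$ (u, p) else 0)"
  proof (intro sum.cong refl)
    fix p assume p: "p \<in> {0..<K}"
    show "G $$ (u, p) * T $$ (p, q) = (if p = q + N then G $$ (u, p) else 0)"
    proof (cases "N \<le> p")
      case True
      then show ?thesis using shift[of p q] p Suc.prems(2) by simp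
    next
      case False
      then show ?thesis using G0[of p] p by simp
    qed
  qed
  also have "\<dots> = (if q + N < K then G $$ (u, q + N) else 0)" by simp
  also have "\<dots> = (if q + Suc j * N < K then V $$ (u, q + Suc j * N) else 0)"
    using IH[of "q + N"] by (simp add: add.assoc)
  finally show ?case .
qed

text \<open>Constant term I is what \<open>companion\<close> presupposes: it records only the
  coefficients of positive degree.\<close>

definition poly_mats_over :: "'a :: comm_ring_1 set \<Rightarrow> nat \<Rightarrow> 'a poly mat set" where
  "poly_mats_over R N = {M \<in> carrier_mat N N. coeff_mat 0 M = 1\<^sub>m N \<and> (\<forall>d. coeff_mat d M \<in> mats_over R N N)}"

context unital_subring
begin

lemma companion_mats_over:
  assumes "M \<in> poly_mats_over R N"
  shows "companion N D M \<in> mats_over R (N * D) (N * D)"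
proof (rule mats_overI)
  fix p q assume pq: "p < N * D" "q < N * D"
  then have "N > 0" by (cases N) auto
  have "coeff_mat d M \<in> mats_over R N N" for d using assms unfolding poly_mats_over_def by auto
  from mats_over_index[OF this, of p "q mod N"] have "p < N \<Longrightarrow> coeff_mat d M $$ (p, q mod N) \<in> R" for d
    using \<open>N > 0\<close> by simp
  then show "companion N D M $$ (p, q) \<in> R"
    using pq unfolding companion_def by (auto intro: uminus_closed)
qed simp

text \<open>Factor \<open>T + F * W\<close> as the row \<open>[T, F]\<close> times the column of I
  and \<open>W\<close>. Since \<open>W * F = 0\<close>, the reversed product has the same form, on a
  space with r more states and with \<open>W\<close> replaced by \<open>W * T\<close>. So the
  feedback can be delayed by one step at a time, and after i delays \<open>W\<close> and
  \<open>W'\<close> have become equal.\<close>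

lemma sse_lag:
  assumes "T \<in> mats_over R K K" "F \<in> mats_over R K r" "W \<in> mats_over R r K" "W' \<in> mats_over R r K"
    and "W * T ^\<^sub>m i = W' * T ^\<^sub>m i"
    and "\<And>j. j < i \<Longrightarrow> W * T ^\<^sub>m j * F = 0\<^sub>m r r" "\<And>j. j < i \<Longrightarrow> W' * T ^\<^sub>m j * F = 0\<^sub>m r r"
  shows "sse (T + F * W) (T + F * W')"
  using assms
proof (induction i arbitrary: K T F W W')
  case 0
  note c = 0(1-4)[THEN mats_over_carrier]
  from 0(5) c have "W = W'" by simp
  moreover have "sse (T + F * W) (T + F * W)"
    using 0(1-3) by (intro sse_refl[of _ K]) auto
  ultimately show ?case by simp
next
  case (Suc i)
  note T = Suc.prems(1) and F = Suc.prems(2)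
  note c = T[THEN mats_over_carrier] F[THEN mats_over_carrier]
  let ?T = "four_block_mat T F (0\<^sub>m r K) (0\<^sub>m r r)"
  let ?F = "four_block_mat (0\<^sub>m K r) (0\<^sub>m K 0) (1\<^sub>m r) (0\<^sub>m r 0)"
  let ?W = "\<lambda>W. four_block_mat (W * T) (0\<^sub>m r r) (0\<^sub>m 0 K) (0\<^sub>m 0 r)"
  have T': "?T \<in> mats_over R (K + r) (K + r)" using T F by auto
  have F': "?F \<in> mats_over R (K + r) r"
    using four_block_mats_over[of "0\<^sub>m K r" K r "0\<^sub>m K 0" 0 "1\<^sub>m r" r "0\<^sub>m r 0"] by simp
  have W': "?W W \<in> mats_over R r (K + r)" if "W \<in> mats_over R r K" for W
    using four_block_mats_over[of "W * T" r K "0\<^sub>m r r" r "0\<^sub>m 0 K" 0 "0\<^sub>m 0 r"] T that by auto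
  have first: "esse (T + F * W) (?T + ?F * ?W W)"
    if W: "W \<in> mats_over R r K" and WF: "W * F = 0\<^sub>m r r" for W
  proof (rule esseI)
    note c = c W[THEN mats_over_carrier]
    let ?U = "four_block_mat T F (0\<^sub>m 0 K) (0\<^sub>m 0 r)" and ?V = "four_block_mat (1\<^sub>m K) (0\<^sub>m K 0) W (0\<^sub>m r 0)"
    show "?U \<in> mats_over R K (K + r)"
      using four_block_mats_over[of T K K F r "0\<^sub>m 0 K" 0 "0\<^sub>m 0 r"] T F by simp
    show "?V \<in> mats_over R (K + r) K"
      using four_block_mats_over[of "1\<^sub>m K" K K "0\<^sub>m K 0" 0 W r "0\<^sub>m r 0"] W by simp
    have "?U * ?V = four_block_mat (T + F * W) (0\<^sub>m K 0) (0\<^sub>m 0 K) (0\<^sub>m 0 0)"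
      using c by (subst mult_four_block_mat[of _ K K _ r _ 0 _ _ K _ 0]) auto
    also have "\<dots> = T + F * W" using c by (intro eq_matI) auto
    finally show "T + F * W = ?U * ?V" by simp
    have "?F * ?W W = four_block_mat (0\<^sub>m K K) (0\<^sub>m K r) (W * T) (0\<^sub>m r r)"
      using c by (subst mult_four_block_mat[of _ K r _ 0 _ r _ _ K _ r]) auto
    then have "?T + ?F * ?W W = four_block_mat T F (W * T) (0\<^sub>m r r)"
      using c by (simp, subst add_four_block_mat[of _ K K _ r _ r]) auto
    also have "\<dots> = ?V * ?U"
      using c WF by (subst mult_four_block_mat[of _ K K _ 0 _ r _ _ K _ r]) auto
    finally show "?T + ?F * ?W W = ?V * ?U" .
  qed
  \<comment> \<open>Index j of the enlarged system corresponds to index j + 1 of the original one;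
    this is how the orthogonality hypotheses for \<open>Suc i\<close> become those for i.\<close>
  have pow: "?W W * ?T ^\<^sub>m j = four_block_mat (W * T ^\<^sub>m Suc j) (0\<^sub>m r r) (0\<^sub>m 0 K) (0\<^sub>m 0 r)"
    if W: "W \<in> mats_over R r K" and WF: "\<And>j. j < Suc i \<Longrightarrow> W * T ^\<^sub>m j * F = 0\<^sub>m r r" and "j \<le> i" for W j
    using \<open>j \<le> i\<close>
  proof (induction j)
    note c = c W[THEN mats_over_carrier]
    case 0
    then show ?case using c W'[OF W, THEN mats_over_carrier] T'[THEN mats_over_carrier] by simp
  next
    note c = c W[THEN mats_over_carrier]
    case (Suc j)
    have "?W W * ?T ^\<^sub>m Suc j = (?W W * ?T ^\<^sub>m j) * ?T"
      using W'[OF W, THEN mats_over_carrier] T'[THEN mats_over_carrier]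
      by (simp add: assoc_mult_mat[of _ r "K + r" _ "K + r" _ "K + r"])
    also have "?W W * ?T ^\<^sub>m j = four_block_mat (W * T ^\<^sub>m Suc j) (0\<^sub>m r r) (0\<^sub>m 0 K) (0\<^sub>m 0 r)"
      using Suc by simp
    also have "\<dots> * ?T = four_block_mat (W * T ^\<^sub>m Suc j * T) (W * T ^\<^sub>m Suc j * F) (0\<^sub>m 0 K) (0\<^sub>m 0 r)"
      using c by (subst mult_four_block_mat[of _ r K _ r _ 0 _ _ K _ r]) auto
    also have "W * T ^\<^sub>m Suc j * F = 0\<^sub>m r r" using WF[of "Suc j"] Suc by simp
    also have "W * T ^\<^sub>m Suc j * T = W * T ^\<^sub>m Suc (Suc j)"
      using c assoc_mult_mat[of W r K "T ^\<^sub>m Suc j" K T K] pow_carrier_mat[of T K "Suc j"] by simp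
    finally show ?case .
  qed
  have cond: "?W W * ?T ^\<^sub>m j * ?F = 0\<^sub>m r r"
    if W: "W \<in> mats_over R r K" and WF: "\<And>j. j < Suc i \<Longrightarrow> W * T ^\<^sub>m j * F = 0\<^sub>m r r" and "j < i" for W j
  proof -
    note c = c W[THEN mats_over_carrier]
    have "?W W * ?T ^\<^sub>m j * ?F = four_block_mat (0\<^sub>m r r) (0\<^sub>m r 0) (0\<^sub>m 0 r) (0\<^sub>m 0 0)"
      unfolding pow[OF W WF less_imp_le[OF \<open>j < i\<close>], simplified]
      using c by (subst mult_four_block_mat[of _ r K _ r _ 0 _ _ r _ 0]) auto
    then show ?thesis by simp
  qed
  have z: "V * F = 0\<^sub>m r r" if "V \<in> mats_over R r K" "\<And>j. j < Suc i \<Longrightarrow> V * T ^\<^sub>m j * F = 0\<^sub>m r r" for V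
    using that(2)[of 0] that(1)[THEN mats_over_carrier] c by simp
  have "sse (?T + ?F * ?W W) (?T + ?F * ?W W')"
  proof (rule Suc.IH[OF T' F' W' W'])
    show "?W W * ?T ^\<^sub>m i = ?W W' * ?T ^\<^sub>m i"
      using pow[OF Suc.prems(3) Suc.prems(6) order.refl] pow[OF Suc.prems(4) Suc.prems(7) order.refl]
        Suc.prems(5) by simp
  qed (use Suc.prems cond in auto)
  then show ?case
    using first[OF Suc.prems(3) z] first[OF Suc.prems(4) z] Suc.prems
    by (meson esse_imp_sse esse_sym sse_trans)
qed

end

text \<open>The block diagonal matrix with D copies of \<open>S\<close>, that is, the Kronecker
  product of the identity of size D with \<open>S\<close>.\<close>

definition companion_lift :: "nat \<Rightarrow> nat \<Rightarrow> 'a :: comm_ring_1 mat \<Rightarrow> 'a mat" where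
  "companion_lift N D S = mat (N * D) (N * D) (\<lambda>(p, q). if p div N = q div N then S $$ (p mod N, q mod N) else 0)"

lemma companion_lift_mult_left:
  fixes S :: "'a :: comm_ring_1 mat"
  assumes S: "S \<in> carrier_mat N N" and T: "T \<in> carrier_mat (N * D) (N * D)"
    and p: "p < N * D" and q: "q < N * D"
  shows "(companion_lift N D S * T) $$ (p, q) = (\<Sum>s = 0..<N. S $$ (p mod N, s) * T $$ (p div N * N + s, q))"
proof -
  have N: "N > 0" using p by (cases N) auto
  have D: "p div N < D" using p N by (simp add: div_less_iff_less_mult mult.commute)
  have "(companion_lift N D S * T) $$ (p, q) =
      (\<Sum>x = 0..<N * D. (if p div N = x div N then S $$ (p mod N, x mod N) else 0) * T $$ (x, q))"
    using T p q by (simp add: companion_lift_def scalar_prod_def)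
  also have "\<dots> = (\<Sum>x = 0..<N * D. if x div N = p div N then S $$ (p mod N, x mod N) * T $$ (x, q) else 0)"
    by (intro sum.cong) auto
  also have "\<dots> = (\<Sum>s = 0..<N. S $$ (p mod N, (p div N * N + s) mod N) * T $$ (p div N * N + s, q))"
    by (rule sum_mod_block[OF N D])
  finally show ?thesis by simp
qed

lemma companion_lift_mult_right:
  fixes S :: "'a :: comm_ring_1 mat"
  assumes S: "S \<in> carrier_mat N N" and T: "T \<in> carrier_mat (N * D) (N * D)"
    and p: "p < N * D" and q: "q < N * D"
  shows "(T * companion_lift N D S) $$ (p, q) = (\<Sum>s = 0..<N. T $$ (p, q div N * N + s) * S $$ (s, q mod N))"
proof -
  have N: "N > 0" using p by (cases N) auto
  have D: "q div N < D" using q N by (simp add: div_less_iff_less_mult mult.commute)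
  have "(T * companion_lift N D S) $$ (p, q) =
      (\<Sum>x = 0..<N * D. T $$ (p, x) * (if x div N = q div N then S $$ (x mod N, q mod N) else 0))"
    using T p q by (simp add: companion_lift_def scalar_prod_def)
  also have "\<dots> = (\<Sum>x = 0..<N * D. if x div N = q div N then T $$ (p, x) * S $$ (x mod N, q mod N) else 0)"
    by (intro sum.cong) auto
  also have "\<dots> = (\<Sum>s = 0..<N. T $$ (p, q div N * N + s) * S $$ ((q div N * N + s) mod N, q mod N))"
    by (rule sum_mod_block[OF N D])
  finally show ?thesis by simp
qed

lemma companion_lift_carrier [simp]: "companion_lift N D S \<in> carrier_mat (N * D) (N * D)"
  unfolding companion_lift_def by simp

lemma companion_lift_inverse:
  fixes S :: "'a :: comm_ring_1 mat"
  assumes S: "S \<in> carrier_mat N N" "S' \<in> carrier_mat N N" "S * S' = 1\<^sub>m N"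
  shows "companion_lift N D S * companion_lift N D S' = 1\<^sub>m (N * D)"
proof (rule eq_matI)
  fix p q assume "p < dim_row (1\<^sub>m (N * D))" "q < dim_col (1\<^sub>m (N * D))"
  then have pq: "p < N * D" "q < N * D" by auto
  then have N: "N > 0" by (cases N) auto
  have D: "p div N < D" using pq N by (simp add: div_less_iff_less_mult mult.commute)
  have lt: "p div N * N + s < N * D" if "s < N" for s
  proof -
    have "p div N * N + s < Suc (p div N) * N" using that by simp
    also have "\<dots> \<le> D * N" using D by (intro mult_le_mono1) simp
    finally show ?thesis by (simp add: mult.commute)
  qed
  have "(companion_lift N D S * companion_lift N D S') $$ (p, q) =
    (\<Sum>s = 0..<N. S $$ (p mod N, s) * (if p div N = q div N then S' $$ (s, q mod N) else 0))"
    unfolding companion_lift_mult_left[OF S(1) companion_lift_carrier pq]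
    using lt pq by (intro sum.cong refl) (simp add: companion_lift_def)
  also have "\<dots> = (if p div N = q div N then (S * S') $$ (p mod N, q mod N) else 0)"
    using S(1,2) N by (simp add: scalar_prod_def)
  also have "\<dots> = (if p div N = q div N \<and> p mod N = q mod N then 1 else 0)"
    using N by (simp add: S(3))
  also have "p div N = q div N \<and> p mod N = q mod N \<longleftrightarrow> p = q"
    by (metis div_mult_mod_eq)
  finally show "(companion_lift N D S * companion_lift N D S') $$ (p, q) = 1\<^sub>m (N * D) $$ (p, q)"
    using pq by simp
qed (simp_all add: companion_lift_def)

context unital_subring
begin

text \<open>With a zero top coefficient the last block column is zero, since the shifted identity
  has no block there.\<close>

lemma sse_companion_Suc:
  assumes M: "M \<in> poly_mats_over R N" and deg: "coeff_mat (Suc D) M = 0\<^sub>m N N"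
  shows "sse (companion N (Suc D) M) (companion N D M)"
proof -
  let ?E = "mat N (N * D) (\<lambda>(p, q). companion N (Suc D) M $$ (N * D + p, q))"
  have c: "companion N (Suc D) M \<in> mats_over R (N * Suc D) (N * Suc D)" "companion N D M \<in> mats_over R (N * D) (N * D)"
    by (rule companion_mats_over[OF M])+
  have "companion N (Suc D) M = four_block_mat (companion N D M) (0\<^sub>m (N * D) N) ?E (0\<^sub>m N N)"
    (is "?L = ?R")
  proof (rule eq_matI)
    fix p q assume "p < dim_row ?R" "q < dim_col ?R"
    then have pq: "p < N * D + N" "q < N * D + N" by (auto simp: companion_def)
    then have N: "N > 0" by (cases N) auto
    show "?L $$ (p, q) = ?R $$ (p, q)"
    proof (cases "q < N * D")
      case True
      then show ?thesis using pq by (auto simp: companion_def)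
    next
      case False
      then have "D * N \<le> q" "q < Suc D * N" using pq by (simp_all add: mult.commute)
      then have "q div N = D" using N by (intro div_nat_eqI) (simp_all add: mult.commute)
      then have "p < N \<Longrightarrow> coeff_mat (q div N + 1) M $$ (p, q mod N) = 0" using deg N by simp
      moreover have "p \<noteq> q + N" using pq False by auto
      ultimately show ?thesis using pq False by (auto simp: companion_def)
    qed
  qed (auto simp: companion_def)
  moreover have "?E \<in> mats_over R N (N * D)"
    by (rule mats_overI) (auto intro!: mats_over_index[OF c(1)])
  ultimately show ?thesis using sse_zero_column[OF c(2)] by metis
qed

lemma sse_companion_degree:
  assumes M: "M \<in> poly_mats_over R N" and deg: "\<And>d. d > D \<Longrightarrow> coeff_mat d M = 0\<^sub>m N N" and "D \<le> D'"
  shows "sse (companion N D' M) (companion N D M)"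
  using \<open>D \<le> D'\<close>
proof (induction D' rule: dec_induct)
  case base
  show ?case using M by (intro sse_refl[of _ "N * D"] companion_mats_over)
next
  case (step n)
  then show ?case using sse_trans[OF sse_companion_Suc[OF M deg[of "Suc n"]]] by simp
qed

text \<open>The operation alters the first block row by \<open>F\<close> times a row of blocks, so
  the two companions differ by a feedback through \<open>F\<close>. The two feedback rows agree
  after i shifts, which is the situation of \<open>sse_lag\<close>.\<close>

lemma sse_companion_unipotent:
  assumes M: "M \<in> poly_mats_over R N" and F: "F \<in> mats_over R N r" and W: "W \<in> mats_over R r N"
    and WF: "W * F = 0\<^sub>m r r" and i: "i > 0"
    and deg: "\<And>d. d > D \<Longrightarrow> coeff_mat d M = 0\<^sub>m N N" and D': "D + i \<le> D'"
  shows "sse (companion N D' M) (companion N D' ((1\<^sub>m N + monom 1 i \<cdot>\<^sub>m const_mat (F * W)) * M))"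
proof (cases "N = 0")
  case True
  then show ?thesis by (auto simp: companion_def intro!: sse_refl[of _ 0] mats_overI)
next
  case False
  then have N: "N > 0" by simp
  let ?K = "N * D'"
  define M' where "M' = (1\<^sub>m N + monom 1 i \<cdot>\<^sub>m const_mat (F * W)) * M"
  have M_car: "M \<in> carrier_mat N N" using M unfolding poly_mats_over_def by auto
  note c = F[THEN mats_over_carrier] W[THEN mats_over_carrier] M_car
  have cM: "coeff_mat d M \<in> mats_over R N N" "coeff_mat d M \<in> carrier_mat N N" for d
    using M unfolding poly_mats_over_def by (auto dest: mats_over_carrier)
  have cM0: "coeff_mat 0 M = 1\<^sub>m N" using M unfolding poly_mats_over_def by auto
  have cM': "coeff_mat d M' = coeff_mat d M + (if i \<le> d then F * W * coeff_mat (d - i) M else 0\<^sub>m N N)" for d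
    unfolding M'_def using c by (intro coeff_mat_unipotent_mult) auto
  \<comment> \<open>In degree i the operation adds \<open>F * W\<close> times the constant term I.
    As \<open>companion\<close> negates coefficients, this amounts to subtracting
    \<open>F1 * W1\<close>, with \<open>W\<close> in block i - 1. The contributions of the
    coefficients of positive degree are collected in \<open>W2\<close>, which starts at block
    i.\<close>
  define F1 where "F1 = mat ?K r (\<lambda>(p, s). if p < N then F $$ (p, s) else 0)"
  define W1 where "W1 = mat r ?K (\<lambda>(u, q). if q div N = i - 1 then W $$ (u, q mod N) else 0)"
  define W2 where "W2 = mat r ?K (\<lambda>(u, q). if q div N \<ge> i then - (W * coeff_mat (q div N + 1 - i) M) $$ (u, q mod N) else 0)"
  define T0 where "T0 = companion N D' M - F1 * W1"
  have F1: "F1 \<in> mats_over R ?K r"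
    unfolding F1_def by (rule mats_overI) (auto intro: mats_over_index[OF F])
  have W1: "W1 \<in> mats_over R r ?K"
    unfolding W1_def using N by (intro mats_overI) (auto intro: mats_over_index[OF W])
  have W2: "W2 \<in> mats_over R r ?K"
  proof -
    have "W * coeff_mat d M \<in> mats_over R r N" for d using W cM by auto
    from mats_over_index[OF this] show ?thesis
      unfolding W2_def using N by (intro mats_overI) (auto intro!: uminus_closed simp del: index_mult_mat)
  qed
  have T0: "T0 \<in> mats_over R ?K ?K"
    unfolding T0_def using companion_mats_over[OF M, of D'] F1 W1 by auto
  note c1 = F1[THEN mats_over_carrier] W1[THEN mats_over_carrier] W2[THEN mats_over_carrier] T0[THEN mats_over_carrier]
  have FW: "(F1 * V) $$ (p, q) = (if p < N then (F * mat r ?K (($$) V)) $$ (p, q) else 0)"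
    if "V \<in> carrier_mat r ?K" "p < ?K" "q < ?K" for V p q
    using that c c1 by (auto simp: F1_def scalar_prod_def)
  have FV: "(F1 * V) $$ (p, q) = (\<Sum>s = 0..<r. F $$ (p, s) * V $$ (s, q))"
    if "V \<in> carrier_mat r ?K" "p < N" "p < ?K" "q < ?K" for V p q
    using that c c1 by (simp add: F1_def scalar_prod_def)
  have first: "companion N D' M = T0 + F1 * W1"
    unfolding T0_def using c1 by (intro eq_matI) (auto simp: companion_def)
  have second: "companion N D' M' = T0 + F1 * W2"
  proof (rule eq_matI)
    fix p q assume "p < dim_row (T0 + F1 * W2)" "q < dim_col (T0 + F1 * W2)"
    then have pq: "p < ?K" "q < ?K" using c1 by auto
    have qN: "q mod N < N" using N by simp
    have *: "(T0 + F1 * W2) $$ (p, q) = companion N D' M $$ (p, q) - (F1 * W1) $$ (p, q) + (F1 * W2) $$ (p, q)"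
      unfolding T0_def using pq c1 by simp
    show "companion N D' M' $$ (p, q) = (T0 + F1 * W2) $$ (p, q)"
    proof (cases "p < N")
      case False
      then have "(F1 * V) $$ (p, q) = 0" if "V \<in> carrier_mat r ?K" for V
        using FW[OF that pq] by simp
      then show ?thesis unfolding * using False pq c1 by (simp add: companion_def)
    next
      case True
      note e = FV[OF _ True pq]
      have f: "(F * W * coeff_mat d M) $$ (p, q mod N) = (\<Sum>s = 0..<r. F $$ (p, s) * (W * coeff_mat d M) $$ (s, q mod N))" for d
      proof -
        have "F * W * coeff_mat d M = F * (W * coeff_mat d M)"
          using c cM by (intro assoc_mult_mat) auto
        then show ?thesis using True c cM(2)[of d] qN by (simp add: scalar_prod_def)
      qed
      consider "q div N + 1 < i" | "q div N + 1 = i" | "q div N + 1 > i" by linarith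
      then show ?thesis
      proof cases
        case 1
        then have "q div N \<noteq> i - 1" "\<not> q div N \<ge> i" by auto
        then have "(F1 * W1) $$ (p, q) = 0" "(F1 * W2) $$ (p, q) = 0"
          unfolding e[OF c1(2)] e[OF c1(3)] using pq by (simp_all add: W1_def W2_def)
        then show ?thesis unfolding * using 1 True pq qN cM(2)[of "q div N + 1"] by (simp add: companion_def cM')
      next
        case 2
        then have d: "q div N = i - 1" "\<not> q div N \<ge> i" by auto
        then have "(F1 * W2) $$ (p, q) = 0" unfolding e[OF c1(3)] using pq by (simp add: W2_def)
        moreover have "(F1 * W1) $$ (p, q) = (F * W * coeff_mat 0 M) $$ (p, q mod N)"
          unfolding f e[OF c1(2)] using pq d c qN by (simp add: W1_def cM0)
        moreover have "F * W * coeff_mat 0 M \<in> carrier_mat N N" using c by auto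
        ultimately show ?thesis unfolding * using 2 True pq qN cM(2)[of "q div N + 1"]
          by (simp add: companion_def cM' d(1) del: index_mult_mat)
      next
        case 3
        then have d: "q div N \<noteq> i - 1" "q div N \<ge> i" using i by auto
        then have "(F1 * W1) $$ (p, q) = 0" unfolding e[OF c1(2)] using pq by (simp add: W1_def)
        moreover have "(F1 * W2) $$ (p, q) = - (F * W * coeff_mat (q div N + 1 - i) M) $$ (p, q mod N)"
          unfolding f e[OF c1(3)] using pq d c qN by (simp add: W2_def sum_negf del: index_mult_mat)
        moreover have "dim_row (F * W * coeff_mat (q div N + 1 - i) M) = N" "dim_col (F * W * coeff_mat (q div N + 1 - i) M) = N"
          using c by auto
        ultimately show ?thesis unfolding * using 3 d True pq qN cM(2)[of "q div N + 1"]
          by (simp add: companion_def cM' del: index_mult_mat)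
      qed
    qed
  qed (use c1 in \<open>auto simp: companion_def\<close>)
  have shift: "T0 $$ (p, q) = (if p = q + N then 1 else 0)" if "N \<le> p" "p < ?K" "q < ?K" for p q
    using that c1 FW[OF c1(2), of p q] by (simp add: T0_def companion_def)
  have iD: "i * N \<le> ?K" using D' by (simp add: mult.commute)
  have W1_pow: "(W1 * T0 ^\<^sub>m j) $$ (u, q) = (if q + j * N < ?K then W1 $$ (u, q + j * N) else 0)"
    if "j < i" "u < r" "q < ?K" for j u q
  proof (rule pow_mat_row_shift[OF c1(4,2) shift])
    fix u p assume "u < r" "p < j * N" "p < ?K"
    moreover have "p div N < j" using \<open>p < j * N\<close> by (simp add: less_mult_imp_div_less)
    ultimately show "W1 $$ (u, p) = 0" using \<open>j < i\<close> by (simp add: W1_def)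
  qed (use that in auto)
  have W2_pow: "(W2 * T0 ^\<^sub>m j) $$ (u, q) = (if q + j * N < ?K then W2 $$ (u, q + j * N) else 0)"
    if "j \<le> i" "u < r" "q < ?K" for j u q
  proof (rule pow_mat_row_shift[OF c1(4,3) shift])
    fix u p assume "u < r" "p < j * N" "p < ?K"
    moreover have "p div N < j" using \<open>p < j * N\<close> by (simp add: less_mult_imp_div_less)
    ultimately show "W2 $$ (u, p) = 0" using \<open>j \<le> i\<close> by (simp add: W2_def)
  qed (use that in auto)
  have VF: "(V * F1) $$ (u, s) = (\<Sum>p = 0..<N. V $$ (u, p) * F $$ (p, s))"
    if "V \<in> carrier_mat r ?K" "u < r" "s < r" "N \<le> ?K" for V u s
  proof -
    have "(V * F1) $$ (u, s) = (\<Sum>p = 0..<?K. V $$ (u, p) * (if p < N then F $$ (p, s) else 0))"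
      using that c1 by (simp add: scalar_prod_def F1_def)
    also have "\<dots> = (\<Sum>p = 0..<N. V $$ (u, p) * (if p < N then F $$ (p, s) else 0))"
      using that by (intro sum.mono_neutral_right) auto
    finally show ?thesis by simp
  qed
  have WF': "(\<Sum>p = 0..<N. W $$ (u, p) * F $$ (p, s)) = 0" if "u < r" "s < r" for u s
  proof -
    have "(W * F) $$ (u, s) = (\<Sum>p = 0..<N. W $$ (u, p) * F $$ (p, s))"
      using c that by (simp add: scalar_prod_def)
    then show ?thesis using WF that by simp
  qed
  have NK: "N \<le> ?K" using D' i N by (cases D') auto
  have ltK: "p < ?K" if "p < N" for p using that NK by (rule less_le_trans)
  have pc: "T0 ^\<^sub>m j \<in> carrier_mat ?K ?K" for j using c1 by simp
  have mc: "V * T0 ^\<^sub>m j \<in> carrier_mat r ?K" if "V \<in> carrier_mat r ?K" for V j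
    using that pc by (rule mult_carrier_mat)
  have div_add: "(p + j * N) div N = p div N + j" "(p + j * N) mod N = p mod N" for p j using N by auto
  have block_less: "p + j * N < ?K" if "p < N" "j < i" for p j
  proof -
    have "p + j * N < Suc j * N" using that by simp
    also have "\<dots> \<le> i * N" using that by (intro mult_le_mono1) simp
    finally show ?thesis using iD by (rule less_le_trans)
  qed
  have "sse (T0 + F1 * W1) (T0 + F1 * W2)"
  proof (rule sse_lag[OF T0 F1 W1 W2])
    fix j assume j: "j < i"
    show "W1 * T0 ^\<^sub>m j * F1 = 0\<^sub>m r r"
    proof (rule eq_matI)
      fix u s assume "u < dim_row (0\<^sub>m r r)" "s < dim_col (0\<^sub>m r r)"
      then have us: "u < r" "s < r" by auto
      have "(W1 * T0 ^\<^sub>m j * F1) $$ (u, s) = (\<Sum>p = 0..<N. (W1 * T0 ^\<^sub>m j) $$ (u, p) * F $$ (p, s))"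
        using mc[OF c1(2)] us NK by (intro VF)
      also have "\<dots> = (\<Sum>p = 0..<N. (if j = i - 1 then W $$ (u, p) * F $$ (p, s) else 0))"
      proof (intro sum.cong refl)
        fix p assume "p \<in> {0..<N}"
        then show "(W1 * T0 ^\<^sub>m j) $$ (u, p) * F $$ (p, s) = (if j = i - 1 then W $$ (u, p) * F $$ (p, s) else 0)"
          using W1_pow[OF j us(1), of p] us j NK block_less[of p j] by (simp add: W1_def div_add del: index_mult_mat)
      qed
      also have "\<dots> = 0" using WF'[OF us] by (cases "j = i - 1") simp_all
      finally show "(W1 * T0 ^\<^sub>m j * F1) $$ (u, s) = (0\<^sub>m r r) $$ (u, s)" using us by simp
    qed (use c1 in auto)
    show "W2 * T0 ^\<^sub>m j * F1 = 0\<^sub>m r r"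
    proof (rule eq_matI)
      fix u s assume "u < dim_row (0\<^sub>m r r)" "s < dim_col (0\<^sub>m r r)"
      then have us: "u < r" "s < r" by auto
      have "(W2 * T0 ^\<^sub>m j * F1) $$ (u, s) = (\<Sum>p = 0..<N. (W2 * T0 ^\<^sub>m j) $$ (u, p) * F $$ (p, s))"
        using mc[OF c1(3)] us NK by (intro VF)
      also have "\<dots> = (\<Sum>p = 0..<N. 0)"
      proof (intro sum.cong refl)
        fix p assume "p \<in> {0..<N}"
        then show "(W2 * T0 ^\<^sub>m j) $$ (u, p) * F $$ (p, s) = 0"
          using W2_pow[of j u p] us j NK block_less[of p j] by (simp add: W2_def div_add del: index_mult_mat)
      qed
      finally show "(W2 * T0 ^\<^sub>m j * F1) $$ (u, s) = (0\<^sub>m r r) $$ (u, s)" using us by simp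
    qed (use c1 in auto)
  next
    \<comment> \<open>After i - 1 shifts \<open>W1\<close> has \<open>W\<close> in block 0. The next
      factor \<open>T0\<close> meets the top rows and yields minus \<open>W\<close> times the
      coefficients of \<open>M\<close>; the term with \<open>F1 * W1\<close> drops out by
      \<open>W * F = 0\<close>. This is what i shifts make of \<open>W2\<close>.\<close>
    show "W1 * T0 ^\<^sub>m i = W2 * T0 ^\<^sub>m i"
    proof (rule eq_matI)
      fix u q assume "u < dim_row (W2 * T0 ^\<^sub>m i)" "q < dim_col (W2 * T0 ^\<^sub>m i)"
      then have u: "u < r" and q: "q < ?K" using mc[OF c1(3), of i] by auto
      have qN: "q mod N < N" using N by simp
      define G where "G = W1 * T0 ^\<^sub>m (i - 1)"
      have G: "G \<in> carrier_mat r ?K" unfolding G_def using mc[OF c1(2)] .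
      have Gi: "G $$ (u, p) = (if p < N then W $$ (u, p) else 0)" if "p < ?K" for p
      proof -
        have "p div N + (i - 1) = i - 1 \<longleftrightarrow> p < N" using N by (simp add: div_eq_0_iff)
        then show ?thesis
          unfolding G_def using W1_pow[of "i - 1" u p] i u that block_less[of p "i - 1"]
          by (simp add: W1_def div_add del: index_mult_mat)
      qed
      have "W1 * T0 ^\<^sub>m i = G * T0"
        unfolding G_def using i c1 assoc_mult_mat[OF c1(2) pc c1(4), of "i - 1"] pow_mat.simps(2)[of T0 "i - 1"] by simp
      then have "(W1 * T0 ^\<^sub>m i) $$ (u, q) = (\<Sum>p = 0..<?K. G $$ (u, p) * T0 $$ (p, q))"
        using G u q c1 by (simp add: scalar_prod_def)
      also have "\<dots> = (\<Sum>p = 0..<N. W $$ (u, p) * T0 $$ (p, q))"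
      proof (rule sum.mono_neutral_cong_right)
        show "{0..<N} \<subseteq> {0..<?K}" using ltK by (intro subsetI) simp
      qed (use Gi ltK in auto)
      also have "\<dots> = (\<Sum>p = 0..<N. - (W $$ (u, p) * coeff_mat (q div N + 1) M $$ (p, q mod N))
          - W $$ (u, p) * (F1 * W1) $$ (p, q))"
      proof (intro sum.cong refl)
        fix p assume "p \<in> {0..<N}"
        moreover have "p < ?K" using \<open>p \<in> {0..<N}\<close> ltK by simp
        ultimately show "W $$ (u, p) * T0 $$ (p, q) = - (W $$ (u, p) * coeff_mat (q div N + 1) M $$ (p, q mod N))
          - W $$ (u, p) * (F1 * W1) $$ (p, q)"
          using q c1 by (simp add: T0_def companion_def algebra_simps del: index_mult_mat(1))
      qed
      also have "\<dots> = - (\<Sum>p = 0..<N. W $$ (u, p) * coeff_mat (q div N + 1) M $$ (p, q mod N))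
          - (\<Sum>p = 0..<N. W $$ (u, p) * (F1 * W1) $$ (p, q))"
        by (simp add: sum_subtractf sum_negf del: index_mult_mat)
      also have "(\<Sum>p = 0..<N. W $$ (u, p) * (F1 * W1) $$ (p, q)) =
          (\<Sum>p = 0..<N. \<Sum>s = 0..<r. W $$ (u, p) * F $$ (p, s) * W1 $$ (s, q))"
        using q ltK by (intro sum.cong refl) (simp add: FV[OF c1(2)] sum_distrib_left mult.assoc del: index_mult_mat)
      also have "\<dots> = (\<Sum>s = 0..<r. (\<Sum>p = 0..<N. W $$ (u, p) * F $$ (p, s)) * W1 $$ (s, q))"
        by (subst sum.swap) (simp add: sum_distrib_right)
      also have "\<dots> = 0" using WF'[OF u] by simp
      also have "(\<Sum>p = 0..<N. W $$ (u, p) * coeff_mat (q div N + 1) M $$ (p, q mod N)) = (W * coeff_mat (q div N + 1) M) $$ (u, q mod N)"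
        using c cM(2)[of "q div N + 1"] u qN by (simp add: scalar_prod_def)
      finally have 1: "(W1 * T0 ^\<^sub>m i) $$ (u, q) = - (W * coeff_mat (q div N + 1) M) $$ (u, q mod N)" by simp
      have "(W2 * T0 ^\<^sub>m i) $$ (u, q) = - (W * coeff_mat (q div N + 1) M) $$ (u, q mod N)"
      proof (cases "q + i * N < ?K")
        case True
        then show ?thesis using W2_pow[of i u q] u q by (simp add: W2_def div_add del: index_mult_mat)
      next
        case False
        \<comment> \<open>A block of \<open>W2\<close> outside the matrix belongs to a degree above
          D, by \<open>D + i \<le> D'\<close>; so nothing is lost by truncation.\<close>
        have "D < q div N + 1"
        proof (rule ccontr)
          assume "\<not> D < q div N + 1"
          then have "q div N + i < D'" using D' by simp
          then have "(q + i * N) div N < D'" by (simp add: div_add)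
          then have "q + i * N < D' * N" using div_less_iff_less_mult[OF N, of "q + i * N" D'] by blast
          then show False using False by (simp add: mult.commute)
        qed
        then have "W * coeff_mat (q div N + 1) M = 0\<^sub>m r N" using deg c by simp
        then show ?thesis using False W2_pow[of i u q] u q qN by (simp del: index_mult_mat)
      qed
      then show "(W1 * T0 ^\<^sub>m i) $$ (u, q) = (W2 * T0 ^\<^sub>m i) $$ (u, q)" using 1 by simp
    qed (simp_all only: carrier_matD[OF mc[OF c1(2), of i]] carrier_matD[OF mc[OF c1(3), of i]])
  qed
  then show ?thesis using first second unfolding M'_def by simp
qed

lemma companion_lift_mats_over:
  assumes "S \<in> mats_over R N N"
  shows "companion_lift N D S \<in> mats_over R (N * D) (N * D)"
proof (rule mats_overI)
  fix p q assume pq: "p < N * D" "q < N * D"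
  then have "N > 0" by (cases N) auto
  then show "companion_lift N D S $$ (p, q) \<in> R"
    using pq by (auto simp: companion_lift_def intro: mats_over_index[OF assms])
qed simp

text \<open>Conjugation by the block diagonal lift acts on each coefficient of the top row by
  \<open>S\<close> and leaves the shifted identity blocks fixed.\<close>

lemma sse_companion_conj:
  assumes M: "M \<in> poly_mats_over R N" and S: "S \<in> mats_over R N N" and S': "S' \<in> mats_over R N N"
    and inv: "S * S' = 1\<^sub>m N" "S' * S = 1\<^sub>m N"
  shows "sse (companion N D M) (companion N D (const_mat S * M * const_mat S'))"
proof -
  let ?M = "const_mat S * M * const_mat S'" and ?L = "companion_lift N D"
  have M_car: "M \<in> carrier_mat N N" using M unfolding poly_mats_over_def by auto
  note c = S[THEN mats_over_carrier] S'[THEN mats_over_carrier] M_car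
  have cM: "coeff_mat d M \<in> carrier_mat N N" for d using c by simp
  have cM': "coeff_mat d ?M = S * coeff_mat d M * S'" for d
    using c by (simp add: coeff_mat_mult_const[of _ N N _ N] coeff_mat_const_mult[of _ N N _ N])
  have eq: "?L S * companion N D M = companion N D ?M * ?L S"
  proof (rule eq_matI)
    fix p q assume "p < dim_row (companion N D ?M * ?L S)" "q < dim_col (companion N D ?M * ?L S)"
    then have pq: "p < N * D" "q < N * D" by (auto simp: companion_def companion_lift_def)
    then have N: "N > 0" by (cases N) auto
    have D: "p div N < D" "q div N < D" using pq N by (simp_all add: div_less_iff_less_mult mult.commute)
    have lt: "j * N + s < N * D" if "s < N" "j < D" for s j
    proof -
      have "j * N + s < Suc j * N" using that by simp
      also have "\<dots> \<le> D * N" using that by (intro mult_le_mono1) simp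
      finally show ?thesis by (simp add: mult.commute)
    qed
    have mods: "p mod N < N" "q mod N < N" using N by auto
    note L = companion_lift_mult_left[OF c(1) companion_carrier pq] and R = companion_lift_mult_right[OF c(1) companion_carrier pq]
    show "(?L S * companion N D M) $$ (p, q) = (companion N D ?M * ?L S) $$ (p, q)"
    proof (cases "p < N")
      case True
      then have p: "p div N = 0" "p mod N = p" by auto
      have "S * coeff_mat d M * S' * S = S * coeff_mat d M" for d
      proof -
        have "S * coeff_mat d M * S' * S = S * coeff_mat d M * (S' * S)"
          using c cM[of d] by (intro assoc_mult_mat[of _ N N _ N _ N]) auto
        then show ?thesis using inv c cM[of d] by simp
      qed
      then have "(S * coeff_mat d M) $$ (p, q mod N) = (S * coeff_mat d M * S' * S) $$ (p, q mod N)" for d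
        by simp
      also have "\<And>d. (S * coeff_mat d M * S' * S) $$ (p, q mod N) =
          (\<Sum>s = 0..<N. (S * coeff_mat d M * S') $$ (p, s) * S $$ (s, q mod N))"
        using c True mods by (simp add: scalar_prod_def[of _ "col S _"] del: index_mult_mat(1) add: index_mult_mat(1)[of p _ _ S])
      finally have *: "(S * coeff_mat d M) $$ (p, q mod N) =
          (\<Sum>s = 0..<N. (S * coeff_mat d M * S') $$ (p, s) * S $$ (s, q mod N))" for d .
      have "(?L S * companion N D M) $$ (p, q) = (\<Sum>s = 0..<N. S $$ (p, s) * - coeff_mat (q div N + 1) M $$ (s, q mod N))"
        unfolding L p using lt[of _ 0] D pq by (intro sum.cong refl) (auto simp: companion_def)
      also have "\<dots> = - (S * coeff_mat (q div N + 1) M) $$ (p, q mod N)"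
        using True mods c cM[of "q div N + 1"] by (simp add: scalar_prod_def sum_negf)
      also have "\<dots> = (\<Sum>s = 0..<N. - (S * coeff_mat (q div N + 1) M * S') $$ (p, s) * S $$ (s, q mod N))"
        unfolding * by (simp add: sum_negf)
      also have "\<dots> = (companion N D ?M * ?L S) $$ (p, q)"
        unfolding R using lt[OF _ D(2)] D pq True by (intro sum.cong refl) (auto simp: companion_def cM')
      finally show ?thesis .
    next
      case False
      then have "p div N \<noteq> 0" using N by (simp add: div_eq_0_iff)
      then have ge: "\<not> p div N * N + s < N" for s by (cases "p div N") auto
      have iff1: "p div N * N + s = q + N \<longleftrightarrow> p div N = Suc (q div N) \<and> s = q mod N" if "s < N" for s
      proof
        assume "p div N * N + s = q + N"
        moreover have "(p div N * N + s) div N = p div N" "(p div N * N + s) mod N = s" using that N by auto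
        ultimately show "p div N = Suc (q div N) \<and> s = q mod N" using N by simp
      next
        assume "p div N = Suc (q div N) \<and> s = q mod N"
        then show "p div N * N + s = q + N" using div_mult_mod_eq[of q N] by (simp del: div_mult_mod_eq)
      qed
      have iff2: "p = q div N * N + s + N \<longleftrightarrow> p div N = Suc (q div N) \<and> s = p mod N" if "s < N" for s
      proof
        assume p: "p = q div N * N + s + N"
        define j where "j = Suc (q div N)"
        have "p = j * N + s" using p by (simp add: j_def)
        then show "p div N = Suc (q div N) \<and> s = p mod N" unfolding j_def[symmetric] using that N by simp
      next
        assume a: "p div N = Suc (q div N) \<and> s = p mod N"
        have "p = p div N * N + p mod N" by simp
        also have "\<dots> = q div N * N + s + N" using a by simp
        finally show "p = q div N * N + s + N" .
      qed
      have "(?L S * companion N D M) $$ (p, q) =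
          (\<Sum>s = 0..<N. if s = q mod N then (if p div N = Suc (q div N) then S $$ (p mod N, s) else 0) else 0)"
        unfolding L using lt[OF _ D(1)] pq ge iff1 by (intro sum.cong refl) (auto simp: companion_def)
      also have "\<dots> = (if p div N = Suc (q div N) then S $$ (p mod N, q mod N) else 0)"
        using mods by simp
      also have "\<dots> = (\<Sum>s = 0..<N. if s = p mod N then (if p div N = Suc (q div N) then S $$ (s, q mod N) else 0) else 0)"
        using mods by simp
      also have "\<dots> = (companion N D ?M * ?L S) $$ (p, q)"
        unfolding R using lt[OF _ D(2)] pq False iff2 by (intro sum.cong refl) (auto simp: companion_def)
      finally show ?thesis .
    qed
  qed (auto simp: companion_def companion_lift_def)
  have "companion N D ?M = companion N D ?M * (?L S * ?L S')"
    unfolding companion_lift_inverse[OF c(1,2) inv(1)] by (simp add: right_mult_one_mat[OF companion_carrier])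
  also have "\<dots> = (companion N D ?M * ?L S) * ?L S'"
    by (rule assoc_mult_mat[symmetric, OF companion_carrier companion_lift_carrier companion_lift_carrier])
  finally have "companion N D ?M = ?L S * companion N D M * ?L S'" using eq by simp
  then show ?thesis
    using sse_similar[OF companion_lift_mats_over[OF S] companion_lift_mats_over[OF S'] companion_lift_inverse[OF c(2,1) inv(2)] companion_mats_over[OF M], of D]
    by simp
qed

end

section \<open>Moves on polynomial matrices\<close>

lemma const_mat_mult:
  fixes A B :: "'a :: comm_ring_1 mat"
  assumes "A \<in> carrier_mat n m" "B \<in> carrier_mat m k"
  shows "const_mat (A * B) = const_mat A * const_mat B"
proof (rule eq_matI)
  fix i j assume "i < dim_row (const_mat A * const_mat B)" "j < dim_col (const_mat A * const_mat B)"
  then have ij: "i < n" "j < k" using assms by auto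
  have "[:sum f I:] = (\<Sum>x\<in>I. [:f x:])" for f :: "nat \<Rightarrow> 'a" and I
    by (intro poly_eqI) (simp add: coeff_sum coeff_pCons split: nat.split)
  with ij show "const_mat (A * B) $$ (i, j) = (const_mat A * const_mat B) $$ (i, j)"
    using assms by (simp add: const_mat_def scalar_prod_def mult.commute)
qed (use assms in auto)

lemma const_mat_one [simp]: "const_mat (1\<^sub>m n :: 'a :: comm_ring_1 mat) = 1\<^sub>m n"
  by (intro eq_matI) (auto simp: const_mat_def)

lemma const_mat_zero [simp]: "const_mat (0\<^sub>m n m :: 'a :: comm_ring_1 mat) = 0\<^sub>m n m"
  by (intro eq_matI) (auto simp: const_mat_def)

lemma const_mat_four_block:
  assumes "A \<in> carrier_mat n1 m1" "B \<in> carrier_mat n1 m2" "C \<in> carrier_mat n2 m1" "D \<in> carrier_mat n2 m2"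
  shows "const_mat (four_block_mat A B C D) = four_block_mat (const_mat A) (const_mat B) (const_mat C) (const_mat D)"
  unfolding const_mat_def using assms by (rule map_four_block_mat)

lemma coeff_mat_four_block:
  assumes "A \<in> carrier_mat n1 m1" "B \<in> carrier_mat n1 m2" "C \<in> carrier_mat n2 m1" "D \<in> carrier_mat n2 m2"
  shows "coeff_mat d (four_block_mat A B C D) = four_block_mat (coeff_mat d A) (coeff_mat d B) (coeff_mat d C) (coeff_mat d D)"
  unfolding coeff_mat_def using assms by (rule map_four_block_mat)

lemma coeff_mat_conj:
  fixes M :: "'a :: comm_ring_1 poly mat"
  assumes "M \<in> carrier_mat N N" "S \<in> carrier_mat N N" "S' \<in> carrier_mat N N"
  shows "coeff_mat d (const_mat S * M * const_mat S') = S * coeff_mat d M * S'"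
proof -
  have c: "const_mat S * M \<in> carrier_mat N N" using assms by (intro mult_carrier_mat[of _ N N]) auto
  show ?thesis
    unfolding coeff_mat_mult_const[OF c assms(3)] coeff_mat_const_mult[OF assms(2,1)] ..
qed

abbreviation direct_sum :: "'a :: zero mat \<Rightarrow> 'a mat \<Rightarrow> 'a mat" where
  "direct_sum A B \<equiv> four_block_mat A (0\<^sub>m (dim_row A) (dim_col B)) (0\<^sub>m (dim_row B) (dim_col A)) B"

context unital_subring
begin

text \<open>No companion size is recorded, because a unipotent move may raise the degree. The
  factored form \<open>F * W\<close> with \<open>W * F = 0\<close> makes the added matrix square to
  zero and is the input that \<open>sse_lag\<close> needs.\<close>

inductive reach :: "nat \<Rightarrow> 'a poly mat \<Rightarrow> 'a poly mat \<Rightarrow> bool" for N where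
  base: "reach N M M"
| unipotent: "\<lbrakk>reach N M M'; F \<in> mats_over R N r; W \<in> mats_over R r N; W * F = 0\<^sub>m r r; i > 0\<rbrakk>
    \<Longrightarrow> reach N M ((1\<^sub>m N + monom 1 i \<cdot>\<^sub>m const_mat (F * W)) * M')"
| similarity: "\<lbrakk>reach N M M'; S \<in> mats_over R N N; S' \<in> mats_over R N N; S * S' = 1\<^sub>m N; S' * S = 1\<^sub>m N\<rbrakk>
    \<Longrightarrow> reach N M (const_mat S * M' * const_mat S')"

lemma reach_trans: "reach N M' M'' \<Longrightarrow> reach N M M' \<Longrightarrow> reach N M M''"
  by (induction rule: reach.induct) (auto intro: reach.intros)

lemma poly_mats_over_unipotent:
  assumes M: "M \<in> poly_mats_over R N" and F: "F \<in> mats_over R N r" and W: "W \<in> mats_over R r N" and i: "i > 0"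
  shows "(1\<^sub>m N + monom 1 i \<cdot>\<^sub>m const_mat (F * W)) * M \<in> poly_mats_over R N"
proof -
  have FW: "F * W \<in> mats_over R N N" using F W by auto
  note c = FW[THEN mats_over_carrier]
  have cM: "M \<in> carrier_mat N N" "coeff_mat 0 M = 1\<^sub>m N" "\<And>d. coeff_mat d M \<in> mats_over R N N"
    using M unfolding poly_mats_over_def by auto
  show ?thesis
    unfolding poly_mats_over_def using i FW cM c 
    by (auto simp: coeff_mat_unipotent_mult[OF cM(1) c] intro!: mult_carrier_mat[of _ N N])
qed

lemma poly_mats_over_conj:
  assumes M: "M \<in> poly_mats_over R N" and S: "S \<in> mats_over R N N" "S' \<in> mats_over R N N" "S * S' = 1\<^sub>m N"
  shows "const_mat S * M * const_mat S' \<in> poly_mats_over R N"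
proof -
  note c = S(1,2)[THEN mats_over_carrier]
  have cM: "M \<in> carrier_mat N N" "coeff_mat 0 M = 1\<^sub>m N" "\<And>d. coeff_mat d M \<in> mats_over R N N"
    using M unfolding poly_mats_over_def by auto
  show ?thesis
    unfolding poly_mats_over_def using S cM c 
    by (auto simp: coeff_mat_conj simp del: assoc_mult_mat intro!: mult_carrier_mat[of _ N N])
qed

lemma reach_poly_mats_over: "reach N M M' \<Longrightarrow> M \<in> poly_mats_over R N \<Longrightarrow> M' \<in> poly_mats_over R N"
  by (induction rule: reach.induct) (auto intro: poly_mats_over_unipotent poly_mats_over_conj)

text \<open>A move by t^i needs i blocks beyond the degree, so a companion size works once it
  exceeds the requirement of every move in the derivation.\<close>

lemma reach_sse_ex:
  assumes "reach N M M'" "M \<in> poly_mats_over R N"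
  shows "\<exists>D. \<forall>D'\<ge>D. sse (companion N D' M) (companion N D' M')"
  using assms
proof (induction rule: reach.induct)
  case (base M)
  then show ?case by (meson companion_mats_over sse_refl)
next
  case (unipotent M M' F r W i)
  from unipotent.IH[OF unipotent.prems] obtain D where D: "\<And>D'. D' \<ge> D \<Longrightarrow> sse (companion N D' M) (companion N D' M')"
    by blast
  have M': "M' \<in> poly_mats_over R N" using reach_poly_mats_over unipotent by blast
  obtain D1 where "\<And>d. d > D1 \<Longrightarrow> coeff_mat d M' = 0\<^sub>m N N"
    using coeff_mat_eventually_zero[of M' N N] M' unfolding poly_mats_over_def by blast
  from sse_companion_unipotent[OF M' unipotent.hyps(2-5) this]
  show ?case using D by (intro exI[of _ "max D (D1 + i)"]) (auto intro: sse_trans)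
next
  case (similarity M M' S S')
  from similarity.IH[OF similarity.prems] obtain D where D: "\<And>D'. D' \<ge> D \<Longrightarrow> sse (companion N D' M) (companion N D' M')"
    by blast
  have M': "M' \<in> poly_mats_over R N" using reach_poly_mats_over similarity by blast
  from sse_companion_conj[OF M' similarity.hyps(2-5)]
  show ?case using D by (intro exI[of _ D]) (auto intro: sse_trans)
qed

text \<open>Both ends are padded with zero coefficients up to a common size that is large enough for
  all moves.\<close>

lemma reach_sse:
  assumes r: "reach N M M'" and M: "M \<in> poly_mats_over R N"
    and D: "\<And>d. d > D \<Longrightarrow> coeff_mat d M = 0\<^sub>m N N" and D': "\<And>d. d > D' \<Longrightarrow> coeff_mat d M' = 0\<^sub>m N N"
  shows "sse (companion N D M) (companion N D' M')"
proof -
  from reach_sse_ex[OF r M] obtain E where E: "\<And>D'. D' \<ge> E \<Longrightarrow> sse (companion N D' M) (companion N D' M')" by blast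
  let ?E = "max E (max D D')"
  have "sse (companion N D M) (companion N ?E M)" using M D by (intro sse_sym[OF sse_companion_degree]) auto
  also have "sse (companion N ?E M) (companion N ?E M')" by (rule E) simp
  also have "sse (companion N ?E M') (companion N D' M')"
    using reach_poly_mats_over[OF r M] D' by (intro sse_companion_degree) auto
  finally show ?thesis .
qed

lemma reach_carrier: "reach N M M' \<Longrightarrow> M \<in> carrier_mat N N \<Longrightarrow> M' \<in> carrier_mat N N"
  by (induction rule: reach.induct) (auto dest!: mats_over_carrier intro!: mult_carrier_mat[of _ N N])

lemma reach_direct_sum_left:
  assumes "reach N M M'" "M \<in> carrier_mat N N" "Z \<in> carrier_mat k k"
  shows "reach (N + k) (direct_sum M Z) (direct_sum M' Z)"
  using assms
proof (induction rule: reach.induct)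
  case (base M)
  show ?case by (rule reach.base)
next
  case (unipotent M M' F r W i)
  note c = unipotent.hyps(2,3)[THEN mats_over_carrier] unipotent.prems reach_carrier[OF unipotent.hyps(1) unipotent.prems(1)]
  let ?F = "four_block_mat F (0\<^sub>m N 0) (0\<^sub>m k r) (0\<^sub>m k 0)" and ?W = "four_block_mat W (0\<^sub>m r k) (0\<^sub>m 0 N) (0\<^sub>m 0 k)"
  have F: "?F \<in> mats_over R (N + k) r"
    using four_block_mats_over[of F N r "0\<^sub>m N 0" 0 "0\<^sub>m k r" k "0\<^sub>m k 0"] unipotent.hyps by simp
  have W: "?W \<in> mats_over R r (N + k)"
    using four_block_mats_over[of W r N "0\<^sub>m r k" k "0\<^sub>m 0 N" 0 "0\<^sub>m 0 k"] unipotent.hyps by simp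
  have "?W * ?F = four_block_mat (W * F) (0\<^sub>m r 0) (0\<^sub>m 0 r) (0\<^sub>m 0 0)"
    using c by (subst mult_four_block_mat[of _ r N _ k _ 0 _ _ r _ 0]) auto
  also have "\<dots> = 0\<^sub>m r r" using unipotent.hyps(4) by simp
  finally have WF: "?W * ?F = 0\<^sub>m r r" .
  have FW: "?F * ?W = four_block_mat (F * W) (0\<^sub>m N k) (0\<^sub>m k N) (0\<^sub>m k k)"
    using c by (subst mult_four_block_mat[of _ N r _ 0 _ k _ _ N _ k]) auto
  have cFW: "F * W \<in> carrier_mat N N" using c by auto
  have one: "1\<^sub>m (N + k) = four_block_mat (1\<^sub>m N) (0\<^sub>m N k) (0\<^sub>m k N) (1\<^sub>m k :: 'a poly mat)"
    by (rule four_block_one_mat[symmetric])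
  have "1\<^sub>m (N + k) + monom 1 i \<cdot>\<^sub>m const_mat (?F * ?W) =
      four_block_mat (1\<^sub>m N + monom 1 i \<cdot>\<^sub>m const_mat (F * W)) (0\<^sub>m N k) (0\<^sub>m k N) (1\<^sub>m k)"
    unfolding FW using cFW
    unfolding one by (simp del: four_block_one_mat four_block_zero_mat add: const_mat_four_block[of _ N N _ k _ k] smult_four_block_mat[of _ N N _ k _ k],
        subst add_four_block_mat[of _ N N _ k _ k]) auto
  then have "(1\<^sub>m (N + k) + monom 1 i \<cdot>\<^sub>m const_mat (?F * ?W)) * direct_sum M' Z =
     direct_sum ((1\<^sub>m N + monom 1 i \<cdot>\<^sub>m const_mat (F * W)) * M') Z"
    using cFW c by (simp, subst mult_four_block_mat[of _ N N _ k _ k _ _ N _ k]) auto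
  then show ?case using reach.unipotent[OF unipotent.IH[OF unipotent.prems] F W WF unipotent.hyps(5)] by simp
next
  case (similarity M M' S S')
  note c = similarity.hyps(2,3)[THEN mats_over_carrier] similarity.prems reach_carrier[OF similarity.hyps(1) similarity.prems(1)]
  let ?S = "four_block_mat S (0\<^sub>m N k) (0\<^sub>m k N) (1\<^sub>m k)" and ?S' = "four_block_mat S' (0\<^sub>m N k) (0\<^sub>m k N) (1\<^sub>m k)"
  have S: "?S \<in> mats_over R (N + k) (N + k)" "?S' \<in> mats_over R (N + k) (N + k)" using similarity.hyps by auto
  have inv: "?S * ?S' = 1\<^sub>m (N + k)" "?S' * ?S = 1\<^sub>m (N + k)"
    using c similarity.hyps(4,5) by (subst mult_four_block_mat[of _ N N _ k _ k _ _ N _ k]; simp)+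
  have "const_mat ?S * direct_sum M' Z * const_mat ?S' = direct_sum (const_mat S * M' * const_mat S') Z"
    using c by (simp add: const_mat_four_block[of _ N N _ k _ k], subst mult_four_block_mat[of _ N N _ k _ k _ _ N _ k], simp_all)
      (subst mult_four_block_mat[of _ N N _ k _ k _ _ N _ k], auto)
  then show ?case using reach.similarity[OF similarity.IH[OF similarity.prems] S inv] by simp
qed

lemma reach_direct_sum_right:
  assumes "reach N M M'" "M \<in> carrier_mat N N" "Z \<in> carrier_mat k k"
  shows "reach (k + N) (direct_sum Z M) (direct_sum Z M')"
  using assms
proof (induction rule: reach.induct)
  case (base M)
  show ?case by (rule reach.base)
next
  case (unipotent M M' F r W i)
  note c = unipotent.hyps(2,3)[THEN mats_over_carrier] unipotent.prems reach_carrier[OF unipotent.hyps(1) unipotent.prems(1)]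
  let ?F = "four_block_mat (0\<^sub>m k r) (0\<^sub>m k 0) F (0\<^sub>m N 0)" and ?W = "four_block_mat (0\<^sub>m r k) W (0\<^sub>m 0 k) (0\<^sub>m 0 N)"
  have F: "?F \<in> mats_over R (k + N) r"
    using four_block_mats_over[of "0\<^sub>m k r" k r "0\<^sub>m k 0" 0 F N "0\<^sub>m N 0"] unipotent.hyps by simp
  have W: "?W \<in> mats_over R r (k + N)"
    using four_block_mats_over[of "0\<^sub>m r k" r k W N "0\<^sub>m 0 k" 0 "0\<^sub>m 0 N"] unipotent.hyps by simp
  have "?W * ?F = four_block_mat (W * F) (0\<^sub>m r 0) (0\<^sub>m 0 r) (0\<^sub>m 0 0)"
    using c by (subst mult_four_block_mat[of _ r k _ N _ 0 _ _ r _ 0]) auto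
  also have "\<dots> = 0\<^sub>m r r" using unipotent.hyps(4) by simp
  finally have WF: "?W * ?F = 0\<^sub>m r r" .
  have FW: "?F * ?W = four_block_mat (0\<^sub>m k k) (0\<^sub>m k N) (0\<^sub>m N k) (F * W)"
    using c by (subst mult_four_block_mat[of _ k r _ 0 _ N _ _ k _ N]) auto
  have cFW: "F * W \<in> carrier_mat N N" using c by auto
  have one: "1\<^sub>m (k + N) = four_block_mat (1\<^sub>m k) (0\<^sub>m k N) (0\<^sub>m N k) (1\<^sub>m N :: 'a poly mat)"
    by (rule four_block_one_mat[symmetric])
  have "1\<^sub>m (k + N) + monom 1 i \<cdot>\<^sub>m const_mat (?F * ?W) =
      four_block_mat (1\<^sub>m k) (0\<^sub>m k N) (0\<^sub>m N k) (1\<^sub>m N + monom 1 i \<cdot>\<^sub>m const_mat (F * W))"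
    unfolding FW using cFW
    unfolding one by (simp del: four_block_one_mat four_block_zero_mat add: const_mat_four_block[of _ k k _ N _ N] smult_four_block_mat[of _ k k _ N _ N],
        subst add_four_block_mat[of _ k k _ N _ N]) auto
  then have "(1\<^sub>m (k + N) + monom 1 i \<cdot>\<^sub>m const_mat (?F * ?W)) * direct_sum Z M' =
     direct_sum Z ((1\<^sub>m N + monom 1 i \<cdot>\<^sub>m const_mat (F * W)) * M')"
    using cFW c by (simp, subst mult_four_block_mat[of _ k k _ N _ N _ _ k _ N]) auto
  then show ?case using reach.unipotent[OF unipotent.IH[OF unipotent.prems] F W WF unipotent.hyps(5)] by simp
next
  case (similarity M M' S S')
  note c = similarity.hyps(2,3)[THEN mats_over_carrier] similarity.prems reach_carrier[OF similarity.hyps(1) similarity.prems(1)]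
  let ?S = "four_block_mat (1\<^sub>m k) (0\<^sub>m k N) (0\<^sub>m N k) S" and ?S' = "four_block_mat (1\<^sub>m k) (0\<^sub>m k N) (0\<^sub>m N k) S'"
  have S: "?S \<in> mats_over R (k + N) (k + N)" "?S' \<in> mats_over R (k + N) (k + N)" using similarity.hyps by auto
  have inv: "?S * ?S' = 1\<^sub>m (k + N)" "?S' * ?S = 1\<^sub>m (k + N)"
    using c similarity.hyps(4,5) by (subst mult_four_block_mat[of _ k k _ N _ N _ _ k _ N]; simp)+
  have "const_mat ?S * direct_sum Z M' * const_mat ?S' = direct_sum Z (const_mat S * M' * const_mat S')"
    using c by (simp add: const_mat_four_block[of _ k k _ N _ N], subst mult_four_block_mat[of _ k k _ N _ N _ _ k _ N], simp_all)
      (subst mult_four_block_mat[of _ k k _ N _ N _ _ k _ N], auto)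
  then show ?case using reach.similarity[OF similarity.IH[OF similarity.prems] S inv] by simp
qed

end

section \<open>Raising the order of a small nilpotent perturbation\<close>

lemma mult_mat_index:
  assumes "A \<in> carrier_mat n m" "B \<in> carrier_mat m k" "i < n" "j < k"
  shows "(A * B) $$ (i, j) = (\<Sum>s = 0..<m. A $$ (i, s) * B $$ (s, j))"
  using assms by (simp add: scalar_prod_def)

text \<open>The determinant is a unit of a polynomial ring over a field, hence constant, and its
  value at 0 is the determinant of the constant term.\<close>

lemma det_eq_one_of_right_inverse:
  fixes A B :: "'a :: field poly mat"
  assumes A: "A \<in> carrier_mat N N" and B: "B \<in> carrier_mat N N" and AB: "A * B = 1\<^sub>m N"
    and A0: "coeff_mat 0 A = 1\<^sub>m N"
  shows "det A = 1"
proof -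
  have "det A * det B = 1" using det_mult[OF A B] AB by simp
  then have "is_unit (det A)" by (metis dvd_triv_left)
  then obtain c where c: "det A = [:c:]" unfolding is_unit_poly_iff by blast
  interpret comm_ring_hom "\<lambda>p :: 'a poly. coeff p 0"
    by unfold_locales (auto simp: coeff_mult)
  have "coeff (det A) 0 = det (coeff_mat 0 A)" unfolding coeff_mat_def by (simp add: hom_det)
  with A0 c show ?thesis by simp
qed

lemma dvd_diff_prod:
  fixes f g :: "'b \<Rightarrow> 'a :: comm_ring_1"
  assumes "\<And>x. x \<in> I \<Longrightarrow> m dvd f x - g x"
  shows "m dvd prod f I - prod g I"
  using assms
proof (induction I rule: infinite_finite_induct)
  case (insert x I)
  have "prod f (insert x I) - prod g (insert x I) = f x * (prod f I - prod g I) + (f x - g x) * prod g I"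
    using insert.hyps by (simp add: algebra_simps)
  then show ?case using insert by simp
qed auto

text \<open>The hypotheses say that \<open>M\<close> agrees with \<open>I + c t ^ i e\<^sub>0\<^sub>0\<close> up to order \<open>i\<close>, whose
  determinant is \<open>1 + c t ^ i\<close>.\<close>

lemma det_one_imp_corner_zero:
  fixes M :: "'a :: idom poly mat"
  assumes M: "M \<in> carrier_mat N N" and N: "N > 0" and i: "i > 0" and det: "det M = 1"
    and M0: "coeff_mat 0 M = 1\<^sub>m N" and Md: "\<And>d. 0 < d \<Longrightarrow> d < i \<Longrightarrow> coeff_mat d M = 0\<^sub>m N N"
    and Mi: "\<And>p q. p < N \<Longrightarrow> q < N \<Longrightarrow> (p, q) \<noteq> (0, 0) \<Longrightarrow> coeff_mat i M $$ (p, q) = 0"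
  shows "coeff_mat i M $$ (0, 0) = 0"
proof -
  define c where "c = coeff_mat i M $$ (0, 0)"
  define M1 :: "'a poly mat" where
    "M1 = mat N N (\<lambda>(p, q). if p = q then if p = 0 then 1 + monom c i else 1 else 0)"
  have dvd: "monom 1 (Suc i) dvd M $$ (p, q) - M1 $$ (p, q)" if "p < N" "q < N" for p q
  proof -
    have "coeff (M $$ (p, q)) d = coeff (M1 $$ (p, q)) d" if dlt: "d < Suc i" for d
    proof -
      have e: "coeff (M $$ (p, q)) d = coeff_mat d M $$ (p, q)" for d
        using M \<open>p < N\<close> \<open>q < N\<close> by (simp add: coeff_mat_index)
      consider "d = 0" | "0 < d" "d < i" | "d = i" using dlt by (meson less_SucE gr0I)
      then show ?thesis
      proof cases
        case 3
        then show ?thesis using Mi[of p q] \<open>p < N\<close> \<open>q < N\<close> i by (auto simp: e M1_def c_def)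
      qed (use \<open>p < N\<close> \<open>q < N\<close> i in \<open>auto simp: e M0 Md M1_def\<close>)
    qed
    then show ?thesis by (simp add: monom_1_dvd_iff')
  qed
  \<comment> \<open>In the Leibniz formula the entrywise congruence modulo t^(i+1) passes to every
    product.\<close>
  have "monom 1 (Suc i) dvd det M - det M1"
  proof -
    have "det M - det M1 = (\<Sum>p | p permutes {0..<N}. signof p * ((\<Prod>j = 0..<N. M $$ (j, p j)) - (\<Prod>j = 0..<N. M1 $$ (j, p j))))"
      using M by (simp add: det_def'[of _ N] M1_def sum_subtractf right_diff_distrib)
    moreover have "monom 1 (Suc i) dvd (\<Prod>j = 0..<N. M $$ (j, p j)) - (\<Prod>j = 0..<N. M1 $$ (j, p j))"
      if "p permutes {0..<N}" for p
      using permutes_in_image[OF that] by (intro dvd_diff_prod dvd) auto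
    ultimately show ?thesis by (auto intro: dvd_sum dvd_mult)
  qed
  moreover have "det M1 = 1 + monom c i"
  proof -
    have "det M1 = (\<Prod>j = 0..<N. M1 $$ (j, j))"
      by (subst det_upper_triangular[of _ N]) (auto simp: M1_def prod_list_diag_prod)
    also have "\<dots> = (\<Prod>j = 0..<N. if j = 0 then 1 + monom c i else 1)"
      by (intro prod.cong) (auto simp: M1_def)
    also have "\<dots> = 1 + monom c i" using N by (simp add: prod.delta)
    finally show ?thesis .
  qed
  ultimately have "monom 1 (Suc i) dvd (monom c i :: 'a poly)" using det by simp
  then show ?thesis by (auto simp: monom_1_dvd_iff' c_def[symmetric])
qed

definition linear_mat :: "'a :: comm_ring_1 mat \<Rightarrow> 'a poly mat" where
  "linear_mat Q = 1\<^sub>m (dim_row Q) + monom 1 1 \<cdot>\<^sub>m const_mat (- Q)"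

lemma linear_mat_carrier [simp]: "Q \<in> carrier_mat N N \<Longrightarrow> linear_mat Q \<in> carrier_mat N N"
  unfolding linear_mat_def by auto

lemma coeff_mat_linear_mat_mult:
  fixes M :: "'a :: comm_ring_1 poly mat"
  assumes "Q \<in> carrier_mat N N" "M \<in> carrier_mat N N"
  shows "coeff_mat d (linear_mat Q * M) = coeff_mat d M + (if 1 \<le> d then (- Q) * coeff_mat (d - 1) M else 0\<^sub>m N N)"
  using coeff_mat_unipotent_mult[of M N "- Q" d 1] assms by (auto simp: linear_mat_def)

lemma coeff_mat_linear_mat:
  assumes "Q \<in> carrier_mat N N"
  shows "coeff_mat d (linear_mat Q) = (if d = 0 then 1\<^sub>m N else if d = 1 then - Q else 0\<^sub>m N N)"
  using coeff_mat_linear_mat_mult[OF assms, of "1\<^sub>m N" d] assms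
  by (auto simp: coeff_mat_one right_mult_one_mat[of _ N N])

lemma companion_linear_mat:
  assumes "Q \<in> carrier_mat N N"
  shows "companion N 1 (linear_mat Q) = Q"
  using assms by (intro eq_matI) (auto simp: companion_def coeff_mat_linear_mat)

text \<open>The geometric series of \<open>t Q\<close> is a polynomial matrix and inverts
  \<open>I - t Q\<close>; \<open>B\<close> below is this series.\<close>

lemma det_linear_mat_nilpotent:
  fixes Q :: "'a :: field mat"
  assumes Q: "Q \<in> carrier_mat N N" and nil: "Q ^\<^sub>m k = 0\<^sub>m N N"
  shows "det (linear_mat Q) = 1"
proof -
  define B where "B = mat N N (\<lambda>(p, q). \<Sum>d\<le>k. monom ((Q ^\<^sub>m d) $$ (p, q)) d)"
  have B: "B \<in> carrier_mat N N" unfolding B_def by auto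
  have pc: "Q ^\<^sub>m d \<in> carrier_mat N N" for d using Q by simp
  have nil': "Q ^\<^sub>m Suc k = 0\<^sub>m N N" using nil Q by simp
  have cB: "coeff_mat d B = (if d \<le> k then Q ^\<^sub>m d else 0\<^sub>m N N)" for d
  proof (rule eq_matI)
    fix p q assume "p < dim_row (if d \<le> k then Q ^\<^sub>m d else 0\<^sub>m N N)" "q < dim_col (if d \<le> k then Q ^\<^sub>m d else 0\<^sub>m N N)"
    then have "p < N" "q < N" using carrier_matD[OF pc[of d]] by (auto split: if_splits)
    then show "coeff_mat d B $$ (p, q) = (if d \<le> k then Q ^\<^sub>m d else 0\<^sub>m N N) $$ (p, q)"
      by (simp add: B_def coeff_mat_def coeff_sum)
  qed (use carrier_matD[OF pc[of d]] in \<open>auto simp: B_def\<close>)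
  have "linear_mat Q * B = 1\<^sub>m N"
  proof (rule coeff_mat_eqI)
    fix d
    show "coeff_mat d (linear_mat Q * B) = coeff_mat d (1\<^sub>m N)"
    proof (cases d)
      case 0
      then show ?thesis using Q by (auto simp: coeff_mat_linear_mat_mult[OF Q B] cB coeff_mat_one)
    next
      case (Suc j)
      have "Q ^\<^sub>m Suc j + - (Q * Q ^\<^sub>m j) = 0\<^sub>m N N"
        unfolding pow_mat_Suc_left[OF Q] using Q by (intro eq_matI) auto
      moreover have "j \<le> k \<Longrightarrow> \<not> Suc j \<le> k \<Longrightarrow> Q * Q ^\<^sub>m j = 0\<^sub>m N N"
        using nil' pow_mat_Suc_left[OF Q, of j] by (metis le_antisym not_less_eq_eq)
      ultimately show ?thesis using Suc Q
        by (auto simp: coeff_mat_linear_mat_mult[OF Q B] cB coeff_mat_one simp del: pow_mat.simps)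
    qed
  next
    show "linear_mat Q * B \<in> carrier_mat N N" by (rule mult_carrier_mat[OF linear_mat_carrier[OF Q] B])
  qed simp
  then show ?thesis
    using det_eq_one_of_right_inverse[OF linear_mat_carrier[OF Q] B] Q by (simp add: coeff_mat_linear_mat)
qed

section \<open>Families of polynomial matrices tending to the identity\<close>

locale real_unital_subring = unital_subring R for R :: "real set"
begin

text \<open>\<open>Y = F * W\<close> squares to zero, so \<open>I - t^i Y\<close> is an
  inverse.\<close>

lemma det_unipotent:
  assumes F: "F \<in> mats_over R N r" and W: "W \<in> mats_over R r N" and WF: "W * F = 0\<^sub>m r r" and i: "i > 0"
  shows "det (1\<^sub>m N + monom 1 i \<cdot>\<^sub>m const_mat (F * W)) = 1"
proof -
  define Y where "Y = F * W"
  note c = F[THEN mats_over_carrier] W[THEN mats_over_carrier]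
  have Y: "Y \<in> carrier_mat N N" unfolding Y_def using c by auto
  have "Y * Y = F * (W * (F * W))"
    unfolding Y_def using c by (intro assoc_mult_mat) auto
  also have "W * (F * W) = (W * F) * W" using c by (intro assoc_mult_mat[symmetric]) auto
  finally have YY: "Y * Y = 0\<^sub>m N N" using WF c by simp
  let ?A = "\<lambda>Y. 1\<^sub>m N + monom 1 i \<cdot>\<^sub>m const_mat Y :: real poly mat"
  have cA: "coeff_mat d (?A V) = (if d = 0 then 1\<^sub>m N else if d = i then V else 0\<^sub>m N N)"
    if "V \<in> carrier_mat N N" for d V
    using coeff_mat_unipotent_mult[of "1\<^sub>m N" N V d i] that i
    by (auto simp: coeff_mat_one right_mult_one_mat[of _ N N])
  have "?A Y * ?A (- Y) = 1\<^sub>m N"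
  proof (rule coeff_mat_eqI)
    fix d
    have Y': "- Y \<in> carrier_mat N N" "?A (- Y) \<in> carrier_mat N N" using Y by auto
    have "- Y + Y = 0\<^sub>m N N" using Y by (intro eq_matI) auto
    then show "coeff_mat d (?A Y * ?A (- Y)) = coeff_mat d (1\<^sub>m N)"
      unfolding coeff_mat_unipotent_mult[OF Y'(2) Y] cA[OF Y'(1)]
      using Y YY i by (auto simp: coeff_mat_one)
  qed (use Y in \<open>auto intro!: mult_carrier_mat[of _ N N]\<close>)
  moreover have "coeff_mat 0 (?A Y) = 1\<^sub>m N" using cA[OF Y] by simp
  ultimately show ?thesis
    using det_eq_one_of_right_inverse[of "?A Y" N "?A (- Y)"] Y unfolding Y_def by simp
qed

lemma reach_det: "reach N M M' \<Longrightarrow> M \<in> carrier_mat N N \<Longrightarrow> det M' = det M"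
proof (induction rule: reach.induct)
  case (unipotent M M' F r W i)
  have "F * W \<in> carrier_mat N N" using unipotent.hyps(2,3) by (auto dest!: mats_over_carrier)
  then show ?case
    using unipotent reach_carrier[OF unipotent.hyps(1) unipotent.prems]
    by (subst det_mult[of _ N]) (auto simp: det_unipotent)
next
  case (similarity M M' S S')
  note c = similarity.hyps(2,3)[THEN mats_over_carrier] reach_carrier[OF similarity.hyps(1) similarity.prems]
  have "det (const_mat S * M' * const_mat S') = det (const_mat S) * det M' * det (const_mat S')"
    using c by (subst det_mult[of _ N]; (subst det_mult[of _ N])?) (auto intro!: mult_carrier_mat[of _ N N])
  also have "\<dots> = det (const_mat S * const_mat S') * det M'"
    using c by (subst det_mult[of _ N]) auto
  also have "const_mat S * const_mat S' = 1\<^sub>m N"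
    using c similarity.hyps(4) by (simp flip: const_mat_mult)
  finally show ?case using similarity by simp
qed auto

text \<open>The degree bound is uniform in \<nu>, so that finitely many coefficients carry the whole
  perturbation and a companion size can be fixed before \<nu>. The index i says that the
  perturbation starts in degree i; determinant 1 is the invariant that makes it possible to increase
  i.\<close>

definition vanishing_family :: "nat \<Rightarrow> nat \<Rightarrow> (nat \<Rightarrow> real poly mat) \<Rightarrow> bool" where
  "vanishing_family N i f \<longleftrightarrow>
     (\<forall>\<nu>. f \<nu> \<in> poly_mats_over R N \<and> det (f \<nu>) = 1) \<and>
     (\<exists>D. \<forall>\<nu>. \<forall>d>D. coeff_mat d (f \<nu>) = 0\<^sub>m N N) \<and>
     (\<forall>\<nu> d. 0 < d \<longrightarrow> d < i \<longrightarrow> coeff_mat d (f \<nu>) = 0\<^sub>m N N) \<and>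
     (\<forall>d>0. \<forall>p<N. \<forall>q<N. (\<lambda>\<nu>. coeff_mat d (f \<nu>) $$ (p, q)) \<longlonglongrightarrow> 0)"

text \<open>A rank one operation with fixed \<open>W\<close> and with \<open>F \<nu>\<close> tending
  to 0 keeps the limits, leaves degrees below i alone, and in degree i adds exactly
  \<open>F \<nu> * W\<close> since the constant term is I.\<close>

lemma vanishing_family_step:
  assumes f: "vanishing_family N i f" and F: "\<And>\<nu>. F \<nu> \<in> mats_over R N 1" and W: "W \<in> mats_over R 1 N"
    and WF: "\<And>\<nu>. W * F \<nu> = 0\<^sub>m 1 1" and lim: "\<And>p. p < N \<Longrightarrow> (\<lambda>\<nu>. F \<nu> $$ (p, 0)) \<longlonglongrightarrow> 0" and i: "i > 0"
  shows "\<exists>g. vanishing_family N i g \<and> (\<forall>\<nu>. reach N (f \<nu>) (g \<nu>)) \<and>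
    (\<forall>\<nu>. \<forall>p<N. \<forall>q<N. coeff_mat i (g \<nu>) $$ (p, q) = coeff_mat i (f \<nu>) $$ (p, q) + F \<nu> $$ (p, 0) * W $$ (0, q))"
proof -
  define g where "g = (\<lambda>\<nu>. (1\<^sub>m N + monom 1 i \<cdot>\<^sub>m const_mat (F \<nu> * W)) * f \<nu>)"
  have fP: "f \<nu> \<in> poly_mats_over R N" "det (f \<nu>) = 1" for \<nu> using f unfolding vanishing_family_def by auto
  have fc: "f \<nu> \<in> carrier_mat N N" "coeff_mat 0 (f \<nu>) = 1\<^sub>m N" for \<nu>
    using fP[of \<nu>] unfolding poly_mats_over_def by auto
  note c = F[THEN mats_over_carrier] W[THEN mats_over_carrier]
  have FWc: "F \<nu> * W \<in> carrier_mat N N" for \<nu> by (rule mult_carrier_mat[OF c])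
  have FWi: "(F \<nu> * W) $$ (p, q) = F \<nu> $$ (p, 0) * W $$ (0, q)" if "p < N" "q < N" for \<nu> p q
    using that c(1)[of \<nu>] c(2) by (auto simp: scalar_prod_def)
  have r: "reach N (f \<nu>) (g \<nu>)" for \<nu>
    unfolding g_def by (rule reach.unipotent[OF reach.base F W WF i])
  have cg: "coeff_mat d (g \<nu>) = coeff_mat d (f \<nu>) + (if i \<le> d then F \<nu> * W * coeff_mat (d - i) (f \<nu>) else 0\<^sub>m N N)" for d \<nu>
    unfolding g_def by (rule coeff_mat_unipotent_mult[OF fc(1) FWc])
  have flim: "(\<lambda>\<nu>. coeff_mat d (f \<nu>) $$ (p, q)) \<longlonglongrightarrow> (if d = 0 then 1\<^sub>m N $$ (p, q) else 0)"
    if "p < N" "q < N" for d p q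
    using f that fc(2) unfolding vanishing_family_def by (cases "d = 0") auto
  have "vanishing_family N i g"
    unfolding vanishing_family_def
  proof (intro conjI allI impI)
    fix \<nu> show "g \<nu> \<in> poly_mats_over R N" using reach_poly_mats_over[OF r fP(1)] .
    show "det (g \<nu>) = 1" using reach_det[OF r fc(1)] fP(2) by simp
  next
    obtain D where D: "\<And>\<nu> d. d > D \<Longrightarrow> coeff_mat d (f \<nu>) = 0\<^sub>m N N"
      using f unfolding vanishing_family_def by blast
    have "coeff_mat d (g \<nu>) = 0\<^sub>m N N" if "d > D + i" for \<nu> d
      using that FWc[of \<nu>] fc(1)[of \<nu>] D[of d \<nu>] D[of "d - i" \<nu>] by (simp add: cg right_mult_zero_mat[OF FWc])
    then show "\<exists>D. \<forall>\<nu>. \<forall>d>D. coeff_mat d (g \<nu>) = 0\<^sub>m N N" by blast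
  next
    fix \<nu> d :: nat assume "0 < d" "d < i"
    then show "coeff_mat d (g \<nu>) = 0\<^sub>m N N" using f unfolding vanishing_family_def by (simp add: cg)
  next
    fix d p q :: nat assume d: "0 < d" and pq: "p < N" "q < N"
    have "(F \<nu> * W * coeff_mat e (f \<nu>)) $$ (p, q) = (\<Sum>s = 0..<N. F \<nu> $$ (p, 0) * W $$ (0, s) * coeff_mat e (f \<nu>) $$ (s, q))" for \<nu> e
    proof -
      have "(F \<nu> * W * coeff_mat e (f \<nu>)) $$ (p, q) = (\<Sum>s = 0..<N. (F \<nu> * W) $$ (p, s) * coeff_mat e (f \<nu>) $$ (s, q))"
        using fc(1)[of \<nu>] pq by (intro mult_mat_index[OF FWc]) auto
      then show ?thesis using pq by (simp add: FWi del: index_mult_mat)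
    qed
    moreover have "(\<lambda>\<nu>. \<Sum>s = 0..<N. F \<nu> $$ (p, 0) * W $$ (0, s) * coeff_mat e (f \<nu>) $$ (s, q)) \<longlonglongrightarrow>
        (\<Sum>s = 0..<N. 0 * W $$ (0, s) * (if e = 0 then 1\<^sub>m N $$ (s, q) else 0))" for e
      using pq by (intro tendsto_sum tendsto_mult lim flim tendsto_const) auto
    ultimately have 2: "(\<lambda>\<nu>. (F \<nu> * W * coeff_mat e (f \<nu>)) $$ (p, q)) \<longlonglongrightarrow> 0" for e
      by simp
    have e: "coeff_mat d (g \<nu>) $$ (p, q) = coeff_mat d (f \<nu>) $$ (p, q) + (if i \<le> d then (F \<nu> * W * coeff_mat (d - i) (f \<nu>)) $$ (p, q) else 0)" for \<nu>
    proof -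
      have "F \<nu> * W * coeff_mat (d - i) (f \<nu>) \<in> carrier_mat N N" using fc(1)[of \<nu>] by (intro mult_carrier_mat[OF FWc]) auto
      then show ?thesis using pq fc(1)[of \<nu>] by (auto simp: cg simp del: assoc_mult_mat index_mult_mat)
    qed
    show "(\<lambda>\<nu>. coeff_mat d (g \<nu>) $$ (p, q)) \<longlonglongrightarrow> 0"
      unfolding e using flim[OF pq, of d] 2[of "d - i"] d by (cases "i \<le> d") (auto intro: tendsto_add_zero)
  qed
  moreover have "coeff_mat i (g \<nu>) $$ (p, q) = coeff_mat i (f \<nu>) $$ (p, q) + F \<nu> $$ (p, 0) * W $$ (0, q)"
    if "p < N" "q < N" for \<nu> p q
    using that FWc[of \<nu>] fc[of \<nu>] FWi[OF that] by (simp add: cg right_mult_one_mat[OF FWc] del: index_mult_mat)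
  ultimately show ?thesis using r by blast
qed

lemma unit_column_mats_over: "r \<in> R \<Longrightarrow> mat N 1 (\<lambda>(p, _). if p = a then r else 0) \<in> mats_over R N 1"
  by (rule mats_overI) auto

text \<open>A matrix unit off the diagonal squares to zero, so each entry is cleared by its own
  operation. In degree i this changes no other entry, so cleared entries stay cleared.\<close>

lemma vanishing_family_offdiag:
  assumes f: "vanishing_family N i f" and i: "i > 0"
    and "finite P" and "P \<subseteq> {(p, q). p < N \<and> q < N \<and> p \<noteq> q}"
  shows "\<exists>g. vanishing_family N i g \<and> (\<forall>\<nu>. reach N (f \<nu>) (g \<nu>)) \<and>
    (\<forall>\<nu>. \<forall>(p, q)\<in>P. coeff_mat i (g \<nu>) $$ (p, q) = 0) \<and>
    (\<forall>\<nu>. \<forall>p<N. coeff_mat i (g \<nu>) $$ (p, p) = coeff_mat i (f \<nu>) $$ (p, p))"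
  using assms(3,4)
proof (induction P rule: finite_induct)
  case empty
  show ?case using f by (intro exI[of _ f]) (auto intro: reach.base)
next
  case (insert ab P)
  obtain a b where ab: "ab = (a, b)" by (cases ab)
  then have a: "a < N" "b < N" "a \<noteq> b" using insert.prems by auto
  from insert obtain g where g: "vanishing_family N i g" "\<And>\<nu>. reach N (f \<nu>) (g \<nu>)"
    "\<And>\<nu> p q. (p, q) \<in> P \<Longrightarrow> coeff_mat i (g \<nu>) $$ (p, q) = 0"
    "\<And>\<nu> p. p < N \<Longrightarrow> coeff_mat i (g \<nu>) $$ (p, p) = coeff_mat i (f \<nu>) $$ (p, p)"
    by fastforce
  let ?F = "\<lambda>\<nu>. mat N 1 (\<lambda>(p, _). if p = a then - coeff_mat i (g \<nu>) $$ (a, b) else 0)"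
  let ?W = "mat 1 N (\<lambda>(_, q). if q = b then 1 else 0 :: real)"
  have gR: "coeff_mat i (g \<nu>) \<in> mats_over R N N" for \<nu>
    using g(1) unfolding vanishing_family_def poly_mats_over_def by auto
  have "\<exists>h. vanishing_family N i h \<and> (\<forall>\<nu>. reach N (g \<nu>) (h \<nu>)) \<and>
    (\<forall>\<nu>. \<forall>p<N. \<forall>q<N. coeff_mat i (h \<nu>) $$ (p, q) = coeff_mat i (g \<nu>) $$ (p, q) + ?F \<nu> $$ (p, 0) * ?W $$ (0, q))"
  proof (rule vanishing_family_step[OF g(1)])
    show "?F \<nu> \<in> mats_over R N 1" for \<nu>
      using mats_over_index[OF gR a(1,2)] by (intro unit_column_mats_over uminus_closed)
    show "?W \<in> mats_over R 1 N" by (rule mats_overI) auto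
    show "?W * ?F \<nu> = 0\<^sub>m 1 1" for \<nu> using a by (intro eq_matI) (auto simp: scalar_prod_def intro!: sum.neutral)
    have "(\<lambda>\<nu>. coeff_mat i (g \<nu>) $$ (a, b)) \<longlonglongrightarrow> 0" using g(1) i a unfolding vanishing_family_def by auto
    then show "(\<lambda>\<nu>. ?F \<nu> $$ (p, 0)) \<longlonglongrightarrow> 0" if "p < N" for p
      using that tendsto_minus[of _ 0] by (cases "p = a") auto
  qed (rule i)
  then obtain h where h: "vanishing_family N i h" "\<And>\<nu>. reach N (g \<nu>) (h \<nu>)"
    "\<And>\<nu> p q. p < N \<Longrightarrow> q < N \<Longrightarrow> coeff_mat i (h \<nu>) $$ (p, q) = coeff_mat i (g \<nu>) $$ (p, q) + ?F \<nu> $$ (p, 0) * ?W $$ (0, q)"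
    by blast
  have "coeff_mat i (h \<nu>) $$ (p, q) = 0" if "(p, q) \<in> insert ab P" for \<nu> p q
  proof -
    have pq: "p < N" "q < N" using that insert.prems by auto
    show ?thesis using that ab a g(3)[of p q \<nu>] by (auto simp: h(3)[OF pq] pq)
  qed
  moreover have "coeff_mat i (h \<nu>) $$ (p, p) = coeff_mat i (f \<nu>) $$ (p, p)" if "p < N" for \<nu> p
    using a that by (auto simp: h(3) g(4))
  ultimately show ?case using h(1) reach_trans[OF h(2) g(2)] ab by (intro exI[of _ h]) auto
qed

text \<open>A diagonal matrix unit is not nilpotent, so a diagonal entry c cannot be cleared alone.
  The nilpotent matrix \<open>c (e_0 - e_a) (e_0 + e_a)^T\<close> moves it to the corner (0, 0)
  instead. It also changes the entries (0, a) and (a, 0); for this reason the off-diagonal entries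
  are treated afterwards.\<close>

lemma vanishing_family_diag:
  assumes f: "vanishing_family N i f" and i: "i > 0" and k: "k \<le> N"
  shows "\<exists>g. vanishing_family N i g \<and> (\<forall>\<nu>. reach N (f \<nu>) (g \<nu>)) \<and>
    (\<forall>\<nu> p. 0 < p \<longrightarrow> p < k \<longrightarrow> coeff_mat i (g \<nu>) $$ (p, p) = 0)"
  using k
proof (induction k)
  case 0
  show ?case using f by (intro exI[of _ f]) (auto intro: reach.base)
next
  case (Suc a)
  then obtain g where g: "vanishing_family N i g" "\<And>\<nu>. reach N (f \<nu>) (g \<nu>)"
    "\<And>\<nu> p. 0 < p \<Longrightarrow> p < a \<Longrightarrow> coeff_mat i (g \<nu>) $$ (p, p) = 0"
    by auto
  show ?case
  proof (cases "a = 0")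
    case True
    then show ?thesis using g by auto
  next
    case False
    have a: "0 < a" "a < N" using Suc.prems False by auto
    let ?F = "\<lambda>\<nu>. mat N 1 (\<lambda>(p, _). if p = a then - coeff_mat i (g \<nu>) $$ (a, a)
      else if p = 0 then coeff_mat i (g \<nu>) $$ (a, a) else 0)"
    let ?W = "mat 1 N (\<lambda>(_, q). if q = a \<or> q = 0 then 1 else 0 :: real)"
    have gR: "coeff_mat i (g \<nu>) \<in> mats_over R N N" for \<nu>
      using g(1) unfolding vanishing_family_def poly_mats_over_def by auto
    have "\<exists>h. vanishing_family N i h \<and> (\<forall>\<nu>. reach N (g \<nu>) (h \<nu>)) \<and>
      (\<forall>\<nu>. \<forall>p<N. \<forall>q<N. coeff_mat i (h \<nu>) $$ (p, q) = coeff_mat i (g \<nu>) $$ (p, q) + ?F \<nu> $$ (p, 0) * ?W $$ (0, q))"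
    proof (rule vanishing_family_step[OF g(1)])
      show "?F \<nu> \<in> mats_over R N 1" for \<nu>
        using mats_over_index[OF gR a(2,2)] by (intro mats_overI) (auto intro: uminus_closed)
      show "?W \<in> mats_over R 1 N" by (rule mats_overI) auto
      show "?W * ?F \<nu> = 0\<^sub>m 1 1" for \<nu>
      proof -
        let ?c = "coeff_mat i (g \<nu>) $$ (a, a)"
        have "(\<Sum>q = 0..<N. (if q = a \<or> q = 0 then 1 else 0) * (if q = a then - ?c else if q = 0 then ?c else 0)) =
          (\<Sum>q = 0..<N. (if q = a then - ?c else 0) + (if q = 0 then ?c else 0))"
          using a by (intro sum.cong) auto
        also have "\<dots> = 0" using a by (simp add: sum.distrib)
        finally show ?thesis using a by (intro eq_matI) (auto simp: scalar_prod_def)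
      qed
      have "(\<lambda>\<nu>. coeff_mat i (g \<nu>) $$ (a, a)) \<longlonglongrightarrow> 0" using g(1) i a unfolding vanishing_family_def by auto
      then show "(\<lambda>\<nu>. ?F \<nu> $$ (p, 0)) \<longlonglongrightarrow> 0" if "p < N" for p
        using that tendsto_minus[of _ 0] by (cases "p = a"; cases "p = 0") auto
    qed (rule i)
    then obtain h where h: "vanishing_family N i h" "\<And>\<nu>. reach N (g \<nu>) (h \<nu>)"
      "\<And>\<nu> p q. p < N \<Longrightarrow> q < N \<Longrightarrow> coeff_mat i (h \<nu>) $$ (p, q) = coeff_mat i (g \<nu>) $$ (p, q) + ?F \<nu> $$ (p, 0) * ?W $$ (0, q)"
      by blast
    have "coeff_mat i (h \<nu>) $$ (p, p) = 0" if "0 < p" "p < Suc a" for \<nu> p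
    proof -
      have p: "p < N" using that a by auto
      show ?thesis using that a g(3)[of p \<nu>] by (cases "p = a") (auto simp: h(3)[OF p p] h(3)[OF a(2,2)] p a)
    qed
    then show ?thesis using h(1) reach_trans[OF h(2) g(2)] by (intro exI[of _ h]) auto
  qed
qed

text \<open>After the diagonal and the off-diagonal sweep just the corner of the coefficient of t^i
  can be nonzero, and determinant 1 excludes that.\<close>

lemma vanishing_family_Suc:
  assumes f: "vanishing_family N i f" and i: "i > 0" and N: "N > 0"
  shows "\<exists>g. vanishing_family N (Suc i) g \<and> (\<forall>\<nu>. reach N (f \<nu>) (g \<nu>))"
proof -
  obtain g where g: "vanishing_family N i g" "\<And>\<nu>. reach N (f \<nu>) (g \<nu>)"
    "\<And>\<nu> p. 0 < p \<Longrightarrow> p < N \<Longrightarrow> coeff_mat i (g \<nu>) $$ (p, p) = 0"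
    using vanishing_family_diag[OF f i order.refl] by blast
  let ?P = "{(p, q). p < N \<and> q < N \<and> p \<noteq> q}"
  have "finite ?P" by (rule finite_subset[of _ "{..<N} \<times> {..<N}"]) auto
  from vanishing_family_offdiag[OF g(1) i this order.refl]
  obtain h where h: "vanishing_family N i h" "\<And>\<nu>. reach N (g \<nu>) (h \<nu>)"
    "\<And>\<nu> p q. (p, q) \<in> ?P \<Longrightarrow> coeff_mat i (h \<nu>) $$ (p, q) = 0"
    "\<And>\<nu> p. p < N \<Longrightarrow> coeff_mat i (h \<nu>) $$ (p, p) = coeff_mat i (g \<nu>) $$ (p, p)"
    by fast
  have "coeff_mat i (h \<nu>) = 0\<^sub>m N N" for \<nu>
  proof -
    have hP: "h \<nu> \<in> carrier_mat N N" "coeff_mat 0 (h \<nu>) = 1\<^sub>m N" "det (h \<nu>) = 1"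
      "\<And>d. 0 < d \<Longrightarrow> d < i \<Longrightarrow> coeff_mat d (h \<nu>) = 0\<^sub>m N N"
      using h(1) unfolding vanishing_family_def poly_mats_over_def by auto
    have z: "coeff_mat i (h \<nu>) $$ (p, q) = 0" if "p < N" "q < N" "(p, q) \<noteq> (0, 0)" for p q
      using that h(3)[of p q \<nu>] h(4)[of p \<nu>] g(3)[of p \<nu>] by (cases "p = q") auto
    have "coeff_mat i (h \<nu>) $$ (0, 0) = 0"
      using hP z by (intro det_one_imp_corner_zero[OF hP(1) N i]) auto
    with z have "coeff_mat i (h \<nu>) $$ (p, q) = 0" if "p < N" "q < N" for p q
      using that by (cases "(p, q) = (0, 0)") auto
    with hP(1) show ?thesis by (intro eq_matI) auto
  qed
  then have "vanishing_family N (Suc i) h"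
    using h(1) unfolding vanishing_family_def by (auto simp: less_Suc_eq)
  then show ?thesis using reach_trans[OF h(2) g(2)] by blast
qed

lemma vanishing_family_raise:
  assumes f: "vanishing_family N 1 f" and N: "N > 0" and L: "L > 0"
  shows "\<exists>g. vanishing_family N L g \<and> (\<forall>\<nu>. reach N (f \<nu>) (g \<nu>))"
  using L
proof (induction L rule: nat_induct_non_zero)
  case 1
  show ?case using f by (auto intro: reach.base)
next
  case (Suc L)
  then obtain g where g: "vanishing_family N L g" "\<And>\<nu>. reach N (f \<nu>) (g \<nu>)" by blast
  from vanishing_family_Suc[OF g(1) Suc.hyps N]
  show ?case using g(2) by (blast intro: reach_trans)
qed

lemma vanishing_family_linear:
  assumes Q: "\<And>\<nu>. Q \<nu> \<in> mats_over R N N" and nil: "\<And>\<nu>. \<exists>k. Q \<nu> ^\<^sub>m k = 0\<^sub>m N N"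
    and lim: "\<And>p q. p < N \<Longrightarrow> q < N \<Longrightarrow> (\<lambda>\<nu>. Q \<nu> $$ (p, q)) \<longlonglongrightarrow> 0"
  shows "vanishing_family N 1 (\<lambda>\<nu>. linear_mat (Q \<nu>))"
proof -
  note c = Q[THEN mats_over_carrier]
  have "det (linear_mat (Q \<nu>)) = 1" for \<nu> using nil[of \<nu>] det_linear_mat_nilpotent[OF c] by blast
  moreover have "linear_mat (Q \<nu>) \<in> poly_mats_over R N" for \<nu>
    unfolding poly_mats_over_def using c[of \<nu>] Q by (auto simp: coeff_mat_linear_mat)
  moreover have "(\<lambda>\<nu>. coeff_mat d (linear_mat (Q \<nu>)) $$ (p, q)) \<longlonglongrightarrow> 0" if "d > 0" "p < N" "q < N" for d p q
  proof -
    have "coeff_mat d (linear_mat (Q \<nu>)) $$ (p, q) = (if d = 1 then - Q \<nu> $$ (p, q) else 0)" for \<nu>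
      using that c[of \<nu>] by (auto simp: coeff_mat_linear_mat[OF c])
    then show ?thesis using tendsto_minus[OF lim[OF that(2,3)]] by (cases "d = 1") auto
  qed
  ultimately show ?thesis
    unfolding vanishing_family_def by (auto simp: coeff_mat_linear_mat[OF c] intro!: exI[of _ 1])
qed

end

section \<open>Small nilpotent matrices over a dense subring\<close>

text \<open>For nonzero x the value is \<open>x ^ N\<close> times \<open>det (I - Q / x)\<close>,
  and the latter is 1. Agreement at infinitely many points suffices.\<close>

lemma char_poly_nilpotent:
  fixes Q :: "real mat"
  assumes Q: "Q \<in> carrier_mat N N" and nil: "Q ^\<^sub>m k = 0\<^sub>m N N"
  shows "char_poly Q = monom 1 N"
proof -
  have hom: "comm_ring_hom (\<lambda>p :: real poly. poly p x)" for x by unfold_locales auto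
  have "poly (char_poly Q) x = poly (monom 1 N) x" if "x \<noteq> 0" for x
  proof -
    have "poly (char_poly Q) x = det (map_mat (\<lambda>p. poly p x) (char_poly_matrix Q))"
      unfolding char_poly_def by (simp only: comm_ring_hom.hom_det[OF hom])
    also have "map_mat (\<lambda>p. poly p x) (char_poly_matrix Q) = x \<cdot>\<^sub>m map_mat (\<lambda>p. poly p (1 / x)) (linear_mat Q)"
      using Q that by (intro eq_matI)
        (auto simp: char_poly_matrix_def linear_mat_def const_mat_def poly_monom field_simps)
    also have "det \<dots> = x ^ N * det (map_mat (\<lambda>p. poly p (1 / x)) (linear_mat Q))"
      using Q by (subst det_smult) (simp add: linear_mat_def)
    also have "det (map_mat (\<lambda>p. poly p (1 / x)) (linear_mat Q)) = poly (det (linear_mat Q)) (1 / x)"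
      by (simp only: comm_ring_hom.hom_det[OF hom])
    also have "x ^ N * poly (det (linear_mat Q)) (1 / x) = poly (monom 1 N) x"
      unfolding det_linear_mat_nilpotent[OF Q nil] by (simp add: poly_monom)
    finally show ?thesis .
  qed
  then have "UNIV - {0} \<subseteq> {x. poly (char_poly Q - monom 1 N) x = 0}" by auto
  moreover have "infinite (UNIV - {0 :: real})" by (simp add: infinite_UNIV_char_0)
  ultimately have "infinite {x. poly (char_poly Q - monom 1 N) x = 0}" by (rule infinite_super)
  then show ?thesis using poly_roots_finite[of "char_poly Q - monom 1 N"] by auto
qed

text \<open>The characteristic polynomial splits over the reals, so the Schur decomposition exists
  without passing to complex numbers; its diagonal consists of eigenvalues, all of them 0.\<close>

lemma nilpotent_triangularization:
  fixes Q :: "real mat"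
  assumes Q: "Q \<in> carrier_mat N N" and nil: "Q ^\<^sub>m k = 0\<^sub>m N N"
  shows "\<exists>B P P'. B \<in> carrier_mat N N \<and> P \<in> carrier_mat N N \<and> P' \<in> carrier_mat N N \<and>
    P * P' = 1\<^sub>m N \<and> P' * P = 1\<^sub>m N \<and> Q = P * B * P' \<and> (\<forall>i<N. \<forall>j\<le>i. B $$ (i, j) = 0)"
proof -
  have "char_poly Q = (\<Prod>a\<leftarrow>replicate N 0. [:- a, 1:])"
    unfolding char_poly_nilpotent[OF Q nil] by (induction N) (auto simp: monom_Suc)
  from schur_decomposition_exists[OF Q this] obtain B where B: "B \<in> carrier_mat N N"
    "upper_triangular B" "similar_mat Q B" by blast
  from B(3) obtain P P' where P: "similar_mat_wit Q B P P'" unfolding similar_mat_def by blast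
  note PD = similar_mat_witD2[OF Q P]
  have cB: "char_poly B = monom 1 N"
    using char_poly_similar[OF B(3)] char_poly_nilpotent[OF Q nil] by simp
  have "B $$ (i, i) = 0" if "i < N" for i
  proof -
    have "B $$ (i, i) \<in> set (diag_mat B)" using that B(1) by (auto simp: diag_mat_def)
    then have "poly (char_poly B) (B $$ (i, i)) = 0"
      unfolding char_poly_upper_triangular[OF B(1,2)] by (auto simp: poly_prod_list prod_list_zero_iff)
    then show ?thesis unfolding cB by (simp add: poly_monom)
  qed
  then have "B $$ (i, j) = 0" if "i < N" "j \<le> i" for i j
    using that B(1,2) by (cases "j = i") auto
  then show ?thesis using PD B by blast
qed

section \<open>Entrywise limits of matrices\<close>

definition mat_tendsto :: "nat \<Rightarrow> nat \<Rightarrow> (nat \<Rightarrow> real mat) \<Rightarrow> real mat \<Rightarrow> bool" where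
  "mat_tendsto n m F A \<longleftrightarrow> (\<forall>\<nu>. F \<nu> \<in> carrier_mat n m) \<and> A \<in> carrier_mat n m \<and>
     (\<forall>i<n. \<forall>j<m. (\<lambda>\<nu>. F \<nu> $$ (i, j)) \<longlonglongrightarrow> A $$ (i, j))"

lemma mat_tendsto_const: "A \<in> carrier_mat n m \<Longrightarrow> mat_tendsto n m (\<lambda>_. A) A"
  unfolding mat_tendsto_def by auto

lemma mat_tendsto_mult:
  assumes F: "mat_tendsto n m F A" and G: "mat_tendsto m k G B"
  shows "mat_tendsto n k (\<lambda>\<nu>. F \<nu> * G \<nu>) (A * B)"
proof -
  have c: "F \<nu> \<in> carrier_mat n m" "G \<nu> \<in> carrier_mat m k" "A \<in> carrier_mat n m" "B \<in> carrier_mat m k" for \<nu>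
    using F G unfolding mat_tendsto_def by auto
  have "(\<lambda>\<nu>. (F \<nu> * G \<nu>) $$ (i, j)) \<longlonglongrightarrow> (A * B) $$ (i, j)" if "i < n" "j < k" for i j
    unfolding mult_mat_index[OF c(1,2) that] mult_mat_index[OF c(3,4) that]
    using F G that unfolding mat_tendsto_def by (intro tendsto_sum tendsto_mult) auto
  then show ?thesis
    unfolding mat_tendsto_def using mult_carrier_mat[OF c(1,2)] mult_carrier_mat[OF c(3,4)] by auto
qed

lemma mat_tendsto_minus:
  assumes F: "mat_tendsto n m F A" and G: "mat_tendsto n m G B"
  shows "mat_tendsto n m (\<lambda>\<nu>. F \<nu> - G \<nu>) (A - B)"
proof -
  have c: "F \<nu> \<in> carrier_mat n m" "G \<nu> \<in> carrier_mat n m" "A \<in> carrier_mat n m" "B \<in> carrier_mat n m" for \<nu>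
    using F G unfolding mat_tendsto_def by auto
  have "(F \<nu> - G \<nu>) $$ (i, j) = F \<nu> $$ (i, j) - G \<nu> $$ (i, j)" if "i < n" "j < m" for \<nu> i j
    using that carrier_matD[OF c(2)] by simp
  moreover have "(A - B) $$ (i, j) = A $$ (i, j) - B $$ (i, j)" if "i < n" "j < m" for i j
    using that c by simp
  ultimately show ?thesis
    using F G minus_carrier_mat[OF c(2)] unfolding mat_tendsto_def by (auto intro: tendsto_diff)
qed

lemma mat_tendsto_imp_small:
  assumes F: "mat_tendsto n m F A" and A: "\<And>i j. i < n \<Longrightarrow> j < m \<Longrightarrow> \<bar>A $$ (i, j)\<bar> < e"
  shows "\<forall>\<^sub>F \<nu> in sequentially. \<forall>i<n. \<forall>j<m. \<bar>F \<nu> $$ (i, j)\<bar> < e"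
proof -
  have "\<forall>\<^sub>F \<nu> in sequentially. \<bar>F \<nu> $$ (i, j)\<bar> < e" if "i < n" "j < m" for i j
    using F that A[OF that] unfolding mat_tendsto_def by (intro order_tendstoD(2)[OF tendsto_rabs]) auto
  then have "\<forall>\<^sub>F \<nu> in sequentially. \<forall>ij\<in>{..<n} \<times> {..<m}. \<bar>F \<nu> $$ ij\<bar> < e"
    by (intro eventually_ball_finite) auto
  then show ?thesis by (rule eventually_mono) auto
qed

text \<open>Rescaling a triangularizing basis by powers of a small number makes a nilpotent matrix small;
  the extra factor in \<open>W\<close> makes \<open>Q * W\<close> small as well.\<close>

lemma nilpotent_similar_small:
  fixes Q :: "real mat"
  assumes Q: "Q \<in> carrier_mat N N" and nil: "Q ^\<^sub>m k = 0\<^sub>m N N" and e: "e > 0"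
  shows "\<exists>P W. P \<in> carrier_mat N N \<and> W \<in> carrier_mat N N \<and> W * P = 1\<^sub>m N \<and>
    (\<forall>i<N. \<forall>j<N. \<bar>(P * Q * W) $$ (i, j)\<bar> < e) \<and> (\<forall>i<N. \<forall>j<N. \<bar>(Q * W) $$ (i, j)\<bar> < e)"
proof -
  obtain B S S' where B: "B \<in> carrier_mat N N" "S \<in> carrier_mat N N" "S' \<in> carrier_mat N N"
    "S * S' = 1\<^sub>m N" "S' * S = 1\<^sub>m N" "Q = S * B * S'" "\<And>i j. i < N \<Longrightarrow> j \<le> i \<Longrightarrow> B $$ (i, j) = 0"
    using nilpotent_triangularization[OF Q nil] by blast
  define d where "d = (\<lambda>\<nu>. 1 / (real \<nu> + 1))"
  have d: "d \<nu> > 0" for \<nu> unfolding d_def by simp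
  have d0: "d \<longlonglongrightarrow> 0" unfolding d_def
    using LIMSEQ_inverse_real_of_nat by (simp add: field_simps inverse_eq_divide)
  define W where "W = (\<lambda>\<nu>. S * mat N N (\<lambda>(i, j). if i = j then d \<nu> ^ Suc i else 0))"
  define P where "P = (\<lambda>\<nu>. mat N N (\<lambda>(i, j). if i = j then 1 / d \<nu> ^ Suc i else 0) * S')"
  have c: "W \<nu> \<in> carrier_mat N N" "P \<nu> \<in> carrier_mat N N" for \<nu>
    unfolding W_def P_def using B by (auto intro!: mult_carrier_mat[of _ N N])
  let ?D = "\<lambda>\<nu>. mat N N (\<lambda>(i, j). if i = j then d \<nu> ^ Suc i else 0)"
  let ?E = "\<lambda>\<nu>. mat N N (\<lambda>(i, j). if i = j then 1 / d \<nu> ^ Suc i else 0)"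
  have D: "?D \<nu> \<in> carrier_mat N N" "?E \<nu> \<in> carrier_mat N N" for \<nu> by auto
  have MD: "(M * ?D \<nu>) $$ (i, j) = M $$ (i, j) * d \<nu> ^ Suc j" if "M \<in> carrier_mat N N" "i < N" "j < N" for M \<nu> i j
  proof -
    have "(M * ?D \<nu>) $$ (i, j) = (\<Sum>s = 0..<N. M $$ (i, s) * (if s = j then d \<nu> ^ Suc s else 0))"
      unfolding mult_mat_index[OF that(1) D(1) that(2,3)] using that by (intro sum.cong) auto
    also have "\<dots> = (\<Sum>s = 0..<N. if s = j then M $$ (i, s) * d \<nu> ^ Suc s else 0)" by (intro sum.cong) auto
    finally show ?thesis using that by simp
  qed
  have EM: "(?E \<nu> * M) $$ (i, j) = M $$ (i, j) / d \<nu> ^ Suc i" if "M \<in> carrier_mat N N" "i < N" "j < N" for M \<nu> i j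
  proof -
    have "(?E \<nu> * M) $$ (i, j) = (\<Sum>s = 0..<N. (if i = s then 1 / d \<nu> ^ Suc i else 0) * M $$ (s, j))"
      unfolding mult_mat_index[OF D(2) that] using that by (intro sum.cong) auto
    also have "\<dots> = (\<Sum>s = 0..<N. if i = s then M $$ (s, j) / d \<nu> ^ Suc i else 0)" by (intro sum.cong) auto
    finally show ?thesis using that by simp
  qed
  have DE: "?D \<nu> * ?E \<nu> = 1\<^sub>m N" for \<nu>
  proof (rule eq_matI)
    fix i j assume "i < dim_row (1\<^sub>m N)" "j < dim_col (1\<^sub>m N)"
    then have ij: "i < N" "j < N" by auto
    have "(?D \<nu> * ?E \<nu>) $$ (i, j) = (\<Sum>s = 0..<N. (if i = s then d \<nu> ^ Suc i else 0) * (if s = j then 1 / d \<nu> ^ Suc s else 0))"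
      unfolding mult_mat_index[OF D ij] using ij by (intro sum.cong) auto
    also have "\<dots> = (\<Sum>s = 0..<N. if s = i then if i = j then 1 else 0 else 0)"
      using d[of \<nu>] by (intro sum.cong) auto
    finally show "(?D \<nu> * ?E \<nu>) $$ (i, j) = 1\<^sub>m N $$ (i, j)" using ij by simp
  qed auto
  have WP: "W \<nu> * P \<nu> = 1\<^sub>m N" for \<nu>
  proof -
    have "W \<nu> * P \<nu> = S * (?D \<nu> * (?E \<nu> * S'))"
      unfolding W_def P_def using B D by (intro assoc_mult_mat[of _ N N _ N _ N] mult_carrier_mat[of _ N N]) auto
    also have "?D \<nu> * (?E \<nu> * S') = (?D \<nu> * ?E \<nu>) * S'"
      using B D by (intro assoc_mult_mat[symmetric, of _ N N _ N _ N]) auto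
    finally show ?thesis using DE B by simp
  qed
  have QW: "Q * W \<nu> = S * B * ?D \<nu>" for \<nu>
  proof -
    have SB: "S * B \<in> carrier_mat N N" using B by auto
    have "Q * W \<nu> = S * B * (S' * W \<nu>)" unfolding B(6) using SB B(3) c(1) by (rule assoc_mult_mat)
    also have "S' * W \<nu> = (S' * S) * ?D \<nu>" unfolding W_def using B(3,2) D(1) by (rule assoc_mult_mat[symmetric])
    also have "\<dots> = ?D \<nu>" unfolding B(5) using D(1) by (rule left_mult_one_mat)
    finally show ?thesis .
  qed
  have PQW: "P \<nu> * Q * W \<nu> = ?E \<nu> * (B * ?D \<nu>)" for \<nu>
  proof -
    have "P \<nu> * Q * W \<nu> = P \<nu> * (Q * W \<nu>)" using c(2) Q c(1) by (rule assoc_mult_mat)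
    also have "Q * W \<nu> = S * (B * ?D \<nu>)" unfolding QW using B(2,1) D(1) by (rule assoc_mult_mat)
    also have "P \<nu> * (S * (B * ?D \<nu>)) = ?E \<nu> * (S' * (S * (B * ?D \<nu>)))"
      unfolding P_def using B D by (intro assoc_mult_mat[of _ N N _ N _ N]) (auto intro!: mult_carrier_mat[of _ N N])
    also have "S' * (S * (B * ?D \<nu>)) = (S' * S) * (B * ?D \<nu>)"
      using B D by (intro assoc_mult_mat[symmetric, of _ N N _ N _ N]) (auto intro!: mult_carrier_mat[of _ N N])
    also have "\<dots> = B * ?D \<nu>" unfolding B(5) using B D by (intro left_mult_one_mat mult_carrier_mat[of _ N N]) auto
    finally show ?thesis .
  qed
  have dpow: "(\<lambda>\<nu>. d \<nu> ^ Suc i) \<longlonglongrightarrow> 0" for i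
    using tendsto_power[OF d0, of "Suc i"] by simp
  have "mat_tendsto N N (\<lambda>\<nu>. Q * W \<nu>) (0\<^sub>m N N)"
    unfolding mat_tendsto_def
  proof (intro conjI allI impI)
    fix i j assume ij: "i < N" "j < N"
    have "S * B \<in> carrier_mat N N" using B by auto
    then show "(\<lambda>\<nu>. (Q * W \<nu>) $$ (i, j)) \<longlonglongrightarrow> 0\<^sub>m N N $$ (i, j)"
      unfolding QW using MD[of "S * B" i j] ij tendsto_mult_right_zero[OF dpow] by (simp del: power_Suc index_mult_mat)
  qed (use mult_carrier_mat[OF Q c(1)] in auto)
  from mat_tendsto_imp_small[OF this, of e] e
  have 1: "\<forall>\<^sub>F \<nu> in sequentially. \<forall>i<N. \<forall>j<N. \<bar>(Q * W \<nu>) $$ (i, j)\<bar> < e" by simp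
  have "mat_tendsto N N (\<lambda>\<nu>. P \<nu> * Q * W \<nu>) (0\<^sub>m N N)"
    unfolding mat_tendsto_def
  proof (intro conjI allI impI)
    fix i j assume ij: "i < N" "j < N"
    \<comment> \<open>The scaling factor is \<open>d \<nu> ^ (j - i)\<close> for j > i; the entries
      with j at most i, where it would not be small, are zero in \<open>B\<close>.\<close>
    have "(?E \<nu> * (B * ?D \<nu>)) $$ (i, j) = B $$ (i, j) * (d \<nu> ^ Suc j / d \<nu> ^ Suc i)" for \<nu>
      unfolding EM[OF mult_carrier_mat[OF B(1) D(1)] ij] MD[OF B(1) ij] by simp
    moreover have "(\<lambda>\<nu>. B $$ (i, j) * (d \<nu> ^ Suc j / d \<nu> ^ Suc i)) \<longlonglongrightarrow> 0"
    proof (cases "j \<le> i")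
      case True
      then show ?thesis using B(7)[OF ij(1)] by simp
    next
      case False
      then obtain r where r: "j = i + Suc r" using less_imp_Suc_add not_le_imp_less by (metis add_Suc_right)
      have "d \<nu> ^ Suc j / d \<nu> ^ Suc i = d \<nu> ^ Suc r" for \<nu>
        using d[of \<nu>] unfolding r by (simp add: power_add)
      then show ?thesis using tendsto_mult_right_zero[OF dpow] by (simp del: power_Suc)
    qed
    ultimately show "(\<lambda>\<nu>. (P \<nu> * Q * W \<nu>) $$ (i, j)) \<longlonglongrightarrow> 0\<^sub>m N N $$ (i, j)"
      unfolding PQW using ij by (simp del: power_Suc index_mult_mat)
  qed (use mult_carrier_mat[OF mult_carrier_mat[OF c(2) Q] c(1)] in auto)
  from mat_tendsto_imp_small[OF this, of e] e
  have 2: "\<forall>\<^sub>F \<nu> in sequentially. \<forall>i<N. \<forall>j<N. \<bar>(P \<nu> * Q * W \<nu>) $$ (i, j)\<bar> < e" by simp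
  from eventually_conj[OF 1 2] obtain \<nu> where
    "\<forall>i<N. \<forall>j<N. \<bar>(Q * W \<nu>) $$ (i, j)\<bar> < e" "\<forall>i<N. \<forall>j<N. \<bar>(P \<nu> * Q * W \<nu>) $$ (i, j)\<bar> < e"
    by (auto simp: eventually_sequentially)
  then show ?thesis using c WP by blast
qed

section \<open>Small nilpotent representatives over the dense subring\<close>

context unital_subring
begin

text \<open>\<open>B ^ (k + 1) = V * A ^ k * U\<close>.\<close>

lemma esse_nilpotent:
  assumes "esse A B" and A: "A \<in> mats_over R n n" "A ^\<^sub>m k = 0\<^sub>m n n" and B: "B \<in> mats_over R m m"
  shows "B ^\<^sub>m Suc k = 0\<^sub>m m m"
proof -
  from assms(1) obtain n' m' U V where UV: "A \<in> mats_over R n' n'" "B \<in> mats_over R m' m'"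
    "U \<in> mats_over R n' m'" "V \<in> mats_over R m' n'" "A = U * V" "B = V * U"
    unfolding elementary_sse_def by blast
  have [simp]: "n' = n" "m' = m" using UV(1,2) A B by (auto dest!: mats_over_carrier)
  note c = UV(1-4)[THEN mats_over_carrier, simplified]
  have BV: "B * V = V * A" using c unfolding UV(5,6) by (intro assoc_mult_mat) auto
  have "B ^\<^sub>m Suc k = B ^\<^sub>m k * (V * U)" using UV(6) by simp
  also have "\<dots> = (B ^\<^sub>m k * V) * U" using c by (intro assoc_mult_mat[symmetric]) auto
  also have "B ^\<^sub>m k * V = V * A ^\<^sub>m k" by (rule intertwine_pow_mat[OF c(2,1,4) BV])
  finally show ?thesis using A(2) c by simp
qed

end

locale dense_subring = real_unital_subring +
  assumes dense: "closure R = UNIV"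
begin

lemma dense_between:
  assumes "a < b" shows "\<exists>r\<in>R. a < r \<and> r < b"
proof -
  have "(a + b) / 2 \<in> closure R" using dense by simp
  then obtain r where "r \<in> R" "dist r ((a + b) / 2) < (b - a) / 2"
    unfolding closure_approachable using assms by (metis diff_gt_0_iff_gt half_gt_zero)
  then show ?thesis by (intro bexI[of _ r]) (auto simp: dist_real_def abs_less_iff field_simps)
qed

lemma mat_approximation:
  assumes A: "A \<in> carrier_mat n m"
  shows "\<exists>F. (\<forall>\<nu>. F \<nu> \<in> mats_over R n m) \<and> mat_tendsto n m F A"
proof -
  have "\<exists>f. (\<forall>\<nu>. f \<nu> \<in> R) \<and> f \<longlonglongrightarrow> x" for x
    using dense closure_sequential[of x R] by auto
  then obtain f where f: "\<And>x \<nu>. f x \<nu> \<in> R" "\<And>x. f x \<longlonglongrightarrow> x" by metis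
  define F where "F = (\<lambda>\<nu>. mat n m (\<lambda>ij. f (A $$ ij) \<nu>))"
  have "F \<nu> \<in> mats_over R n m" for \<nu> unfolding F_def using f by (intro mats_overI) auto
  moreover have "mat_tendsto n m F A"
    unfolding mat_tendsto_def F_def using A f(2) by auto
  ultimately show ?thesis by blast
qed

lemma esse_small_nilpotent:
  assumes Q: "Q \<in> mats_over R N N" and nil: "Q ^\<^sub>m k = 0\<^sub>m N N" and e: "e > 0"
  shows "\<exists>Q'. Q' \<in> mats_over R (N + N) (N + N) \<and> esse Q Q' \<and> (\<forall>i<N + N. \<forall>j<N + N. \<bar>Q' $$ (i, j)\<bar> < e)"
proof -
  have Qc: "Q \<in> carrier_mat N N" using Q by (rule mats_over_carrier)
  obtain P W where PW: "P \<in> carrier_mat N N" "W \<in> carrier_mat N N" "W * P = 1\<^sub>m N"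
    "\<And>i j. i < N \<Longrightarrow> j < N \<Longrightarrow> \<bar>(P * Q * W) $$ (i, j)\<bar> < e" "\<And>i j. i < N \<Longrightarrow> j < N \<Longrightarrow> \<bar>(Q * W) $$ (i, j)\<bar> < e"
    using nilpotent_similar_small[OF Qc nil e] by blast
  obtain F where F: "\<And>\<nu>. F \<nu> \<in> mats_over R N N" "mat_tendsto N N F P" using mat_approximation[OF PW(1)] by blast
  obtain G where G: "\<And>\<nu>. G \<nu> \<in> mats_over R N N" "mat_tendsto N N G W" using mat_approximation[OF PW(2)] by blast
  have limH: "mat_tendsto N N (\<lambda>\<nu>. 1\<^sub>m N - G \<nu> * F \<nu>) (1\<^sub>m N - W * P)"
    by (intro mat_tendsto_minus mat_tendsto_mult[OF G(2) F(2)] mat_tendsto_const) auto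
  have z: "1\<^sub>m N - W * P = 0\<^sub>m N N" unfolding PW(3) by auto
  have PQ: "P * Q \<in> carrier_mat N N" using PW Qc by auto
  have limPQ: "mat_tendsto N N (\<lambda>\<nu>. F \<nu> * Q) (P * Q)"
    by (rule mat_tendsto_mult[OF F(2) mat_tendsto_const[OF Qc]])
  have l1: "mat_tendsto N N (\<lambda>\<nu>. F \<nu> * Q * G \<nu>) (P * Q * W)"
    by (rule mat_tendsto_mult[OF limPQ G(2)])
  have l2: "mat_tendsto N N (\<lambda>\<nu>. F \<nu> * Q * (1\<^sub>m N - G \<nu> * F \<nu>)) (P * Q * (1\<^sub>m N - W * P))"
    by (rule mat_tendsto_mult[OF limPQ limH])
  have l3: "mat_tendsto N N (\<lambda>\<nu>. Q * G \<nu>) (Q * W)"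
    by (rule mat_tendsto_mult[OF mat_tendsto_const[OF Qc] G(2)])
  have l4: "mat_tendsto N N (\<lambda>\<nu>. Q * (1\<^sub>m N - G \<nu> * F \<nu>)) (Q * (1\<^sub>m N - W * P))"
    by (intro mat_tendsto_mult[OF _ limH] mat_tendsto_const Qc)
  have z2: "P * Q * (1\<^sub>m N - W * P) = 0\<^sub>m N N" "Q * (1\<^sub>m N - W * P) = 0\<^sub>m N N"
    unfolding z using right_mult_zero_mat[OF PQ] right_mult_zero_mat[OF Qc] by auto
  have "\<forall>\<^sub>F \<nu> in sequentially.
      ((\<forall>i<N. \<forall>j<N. \<bar>(F \<nu> * Q * G \<nu>) $$ (i, j)\<bar> < e) \<and> (\<forall>i<N. \<forall>j<N. \<bar>(F \<nu> * Q * (1\<^sub>m N - G \<nu> * F \<nu>)) $$ (i, j)\<bar> < e)) \<and>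
      ((\<forall>i<N. \<forall>j<N. \<bar>(Q * G \<nu>) $$ (i, j)\<bar> < e) \<and> (\<forall>i<N. \<forall>j<N. \<bar>(Q * (1\<^sub>m N - G \<nu> * F \<nu>)) $$ (i, j)\<bar> < e))"
    using PW(4,5) e unfolding z2[symmetric]
    by (intro eventually_conj mat_tendsto_imp_small[OF l1] mat_tendsto_imp_small[OF l2]
        mat_tendsto_imp_small[OF l3] mat_tendsto_imp_small[OF l4]) (auto simp: z2 simp del: index_mult_mat)
  from eventually_happens'[OF sequentially_bot this] obtain \<nu> where
    small: "(\<forall>i<N. \<forall>j<N. \<bar>(F \<nu> * Q * G \<nu>) $$ (i, j)\<bar> < e) \<and> (\<forall>i<N. \<forall>j<N. \<bar>(F \<nu> * Q * (1\<^sub>m N - G \<nu> * F \<nu>)) $$ (i, j)\<bar> < e)"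
      "(\<forall>i<N. \<forall>j<N. \<bar>(Q * G \<nu>) $$ (i, j)\<bar> < e) \<and> (\<forall>i<N. \<forall>j<N. \<bar>(Q * (1\<^sub>m N - G \<nu> * F \<nu>)) $$ (i, j)\<bar> < e)"
    by (elim exE conjE) (rule that; intro conjI)
  define H where "H = 1\<^sub>m N - G \<nu> * F \<nu>"
  have H: "H \<in> mats_over R N N" unfolding H_def using F(1)[of \<nu>] G(1)[of \<nu>] by auto
  note c = F(1)[THEN mats_over_carrier, of \<nu>] G(1)[THEN mats_over_carrier, of \<nu>] Qc H[THEN mats_over_carrier]
  let ?Q = "four_block_mat (F \<nu> * Q * G \<nu>) (F \<nu> * Q * H) (Q * G \<nu>) (Q * H)"
  let ?U = "four_block_mat (Q * G \<nu>) (Q * H) (0\<^sub>m 0 N) (0\<^sub>m 0 N)" and ?V = "four_block_mat (F \<nu>) (0\<^sub>m N 0) (1\<^sub>m N) (0\<^sub>m N 0)"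
  have QR: "?Q \<in> mats_over R (N + N) (N + N)" using F(1)[of \<nu>] G(1)[of \<nu>] H Q by auto
  have U: "?U \<in> mats_over R N (N + N)"
    using four_block_mats_over[of "Q * G \<nu>" N N "Q * H" N "0\<^sub>m 0 N" 0 "0\<^sub>m 0 N"] Q G(1)[of \<nu>] H by auto
  have V: "?V \<in> mats_over R (N + N) N"
    using four_block_mats_over[of "F \<nu>" N N "0\<^sub>m N 0" 0 "1\<^sub>m N" N "0\<^sub>m N 0"] F(1)[of \<nu>] by auto
  have "?U * ?V = four_block_mat (Q * G \<nu> * F \<nu> + Q * H) (0\<^sub>m N 0) (0\<^sub>m 0 N) (0\<^sub>m 0 0)"
    using c by (subst mult_four_block_mat[of _ N N _ N _ 0 _ _ N _ 0]) auto
  also have "\<dots> = Q * G \<nu> * F \<nu> + Q * H" using c by (intro eq_matI) auto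
  also have "\<dots> = Q * (G \<nu> * F \<nu> + H)"
    using c by (subst mult_add_distrib_mat[of _ N N _ N]) auto
  also have "G \<nu> * F \<nu> + H = 1\<^sub>m N" unfolding H_def using c by (intro eq_matI) auto
  finally have UV: "Q = ?U * ?V" using c by simp
  have VU: "?Q = ?V * ?U"
    using c by (subst mult_four_block_mat[of _ N N _ 0 _ N _ _ N _ N]) auto
  have "\<bar>?Q $$ (i, j)\<bar> < e" if "i < N + N" "j < N + N" for i j
  proof -
    have dims: "dim_row (F \<nu> * Q * G \<nu>) = N" "dim_col (F \<nu> * Q * G \<nu>) = N" "dim_row (Q * H) = N" "dim_col (Q * H) = N"
      using c by auto
    have small': "i < N \<Longrightarrow> j < N \<Longrightarrow> \<bar>(F \<nu> * Q * G \<nu>) $$ (i, j)\<bar> < e" "i < N \<Longrightarrow> j < N \<Longrightarrow> \<bar>(F \<nu> * Q * H) $$ (i, j)\<bar> < e"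
      "i < N \<Longrightarrow> j < N \<Longrightarrow> \<bar>(Q * G \<nu>) $$ (i, j)\<bar> < e" "i < N \<Longrightarrow> j < N \<Longrightarrow> \<bar>(Q * H) $$ (i, j)\<bar> < e" for i j
      using small unfolding H_def by simp_all
    show ?thesis
      using that by (cases "i < N"; cases "j < N")
        (simp_all add: dims small' del: index_mult_mat assoc_mult_mat)
  qed
  then show ?thesis using QR esseI[OF U V UV VU] by blast
qed

lemma nilpotent_family:
  assumes Q: "Q \<in> mats_over R N N" and nil: "Q ^\<^sub>m k = 0\<^sub>m N N"
  shows "\<exists>f. (\<forall>\<nu>. f \<nu> \<in> mats_over R (N + N) (N + N) \<and> esse Q (f \<nu>)) \<and> vanishing_family (N + N) 1 (\<lambda>\<nu>. linear_mat (f \<nu>))"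
proof -
  have "\<exists>Q'. Q' \<in> mats_over R (N + N) (N + N) \<and> esse Q Q' \<and> (\<forall>i<N + N. \<forall>j<N + N. \<bar>Q' $$ (i, j)\<bar> < 1 / real (Suc \<nu>))" for \<nu>
    by (rule esse_small_nilpotent[OF Q nil]) simp
  then obtain f where f: "\<And>\<nu>. f \<nu> \<in> mats_over R (N + N) (N + N)" "\<And>\<nu>. esse Q (f \<nu>)"
    "\<And>\<nu> i j. i < N + N \<Longrightarrow> j < N + N \<Longrightarrow> \<bar>f \<nu> $$ (i, j)\<bar> < 1 / real (Suc \<nu>)"
    by metis
  have "vanishing_family (N + N) 1 (\<lambda>\<nu>. linear_mat (f \<nu>))"
  proof (rule vanishing_family_linear[OF f(1)])
    show "\<exists>k. f \<nu> ^\<^sub>m k = 0\<^sub>m (N + N) (N + N)" for \<nu> using esse_nilpotent[OF f(2) Q nil f(1)] by blast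
    show "(\<lambda>\<nu>. f \<nu> $$ (p, q)) \<longlonglongrightarrow> 0" if "p < N + N" "q < N + N" for p q
      by (rule LIMSEQ_norm_0) (use f(3)[OF that] in simp)
  qed
  then show ?thesis using f by blast
qed

end

section \<open>Positive coefficients in a range of degrees\<close>

lemma pow_mat_nonneg:
  fixes A :: "real mat"
  assumes A: "A \<in> carrier_mat n n" and nn: "\<And>i j. i < n \<Longrightarrow> j < n \<Longrightarrow> 0 \<le> A $$ (i, j)"
    and "i < n" "j < n"
  shows "0 \<le> (A ^\<^sub>m k) $$ (i, j)"
  using assms(3,4)
proof (induction k arbitrary: j)
  case (Suc k)
  have "(A ^\<^sub>m Suc k) $$ (i, j) = (\<Sum>s = 0..<n. (A ^\<^sub>m k) $$ (i, s) * A $$ (s, j))"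
    using mult_mat_index[OF pow_carrier_mat[OF A] A Suc.prems] by simp
  also have "\<dots> \<ge> 0" using Suc nn by (intro sum_nonneg mult_nonneg_nonneg) auto
  finally show ?case .
qed (use A in auto)

context dense_subring
begin

text \<open>Starting from two interlinked copies of \<open>A\<close>, a small multiple of the edges from one copy to the
  other is replaced by paths through the other copy that are one step longer. Alternating between
  the copies makes the coefficient of every \<open>t ^ j\<close> dominate a multiple of \<open>A ^ j\<close>; the copy
  treated last, \<open>r\<close>, is one degree ahead.\<close>

lemma reach_dominating_powers:
  assumes A: "A \<in> mats_over R n n" and nonneg: "\<forall>i<n. \<forall>j<n. 0 \<le> A $$ (i, j)"
    and B: "B \<in> mats_over R (n + n) (n + n)" and n: "n > 0" and \<kappa>: "\<kappa> > 0"
    and dominates: "\<forall>s<2. \<forall>u<2. \<forall>a<n. \<forall>b<n. \<kappa> * A $$ (a, b) \<le> B $$ (s * n + a, u * n + b)"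
  shows "\<exists>M r \<kappa>. reach (n + n) (linear_mat B) M \<and> r < 2 \<and> \<kappa> > 0 \<and>
    (\<forall>j>d + 1. coeff_mat j M = 0\<^sub>m (n + n) (n + n)) \<and>
    (\<forall>j>0. \<forall>s<2. \<forall>u<2. \<forall>a<n. \<forall>b<n. coeff_mat j M $$ (s * n + a, u * n + b) \<le> 0) \<and>
    (\<forall>j>0. \<forall>s<2. \<forall>u<2. \<forall>a<n. \<forall>b<n. j = 1 \<or> j \<le> d \<or> s = r \<and> j = d + 1 \<longrightarrow>
      coeff_mat j M $$ (s * n + a, u * n + b) \<le> - \<kappa> * (A ^\<^sub>m j) $$ (a, b))"
proof (induction d)
  note nn = nonneg[rule_format] and dom = dominates[rule_format]
  case 0
  note c = A[THEN mats_over_carrier] B[THEN mats_over_carrier]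
  have lt: "s * n + a < n + n" if "s < 2" "a < n" for s a :: nat
  proof -
    have "s = 0 \<or> s = 1" using that by auto
    then show ?thesis using that by auto
  qed
  have le0: "- B $$ (s * n + a, u * n + b) \<le> - \<kappa> * A $$ (a, b)" if "s < 2" "u < 2" "a < n" "b < n" for s u a b
    using dom[OF that] by simp
  have le1: "- B $$ (s * n + a, u * n + b) \<le> 0" if "s < 2" "u < 2" "a < n" "b < n" for s u a b
    using le0[OF that] mult_nonneg_nonneg[of \<kappa> "A $$ (a, b)"] \<kappa> nn[OF that(3,4)] by linarith
  have A1: "A ^\<^sub>m 1 = A" using c by simp
  have cm: "coeff_mat j (linear_mat B) = (if j = 1 then - B else 0\<^sub>m (n + n) (n + n))" if "j > 0" for j
    using that c by (simp add: coeff_mat_linear_mat)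
  have neg: "(- B) $$ (s * n + a, u * n + b) = - B $$ (s * n + a, u * n + b)" if "s < 2" "u < 2" "a < n" "b < n" for s u a b
    using carrier_matD[OF c(2)] lt[OF that(1,3)] lt[OF that(2,4)] by simp
  show ?case
  \<comment> \<open>At the start both copies are bounded in degree 1, so the choice of r is
    arbitrary. The clause \<open>j = 1\<close> in the statement records this case.\<close>
  proof (rule exI[of _ "linear_mat B"], rule exI[of _ 0], rule exI[of _ \<kappa>], intro conjI allI impI)
    fix j s u a b :: nat assume j: "0 < j" and sub: "s < 2" "u < 2" "a < n" "b < n"
    show "coeff_mat j (linear_mat B) $$ (s * n + a, u * n + b) \<le> 0"
      using le1[OF sub] lt[OF sub(1,3)] lt[OF sub(2,4)] by (simp add: cm[OF j] neg[OF sub])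
    assume "j = 1 \<or> j \<le> 0 \<or> s = 0 \<and> j = 0 + 1"
    then have "j = 1" using j by auto
    then show "coeff_mat j (linear_mat B) $$ (s * n + a, u * n + b) \<le> - \<kappa> * (A ^\<^sub>m j) $$ (a, b)"
      using le0[OF sub] unfolding cm[OF j] by (simp only: A1 neg[OF sub] if_True simp_thms)
  qed (auto simp: cm \<kappa> intro: reach.base)
next
  note nn = nonneg[rule_format] and dom = dominates[rule_format]
  case (Suc d)
  then obtain M r \<kappa> where M: "reach (n + n) (linear_mat B) M" "r < 2" "\<kappa> > 0"
    and deg': "\<forall>j>d + 1. coeff_mat j M = 0\<^sub>m (n + n) (n + n)"
    and nonpos': "\<forall>j>0. \<forall>s<2. \<forall>u<2. \<forall>a<n. \<forall>b<n. coeff_mat j M $$ (s * n + a, u * n + b) \<le> 0"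
    and bound': "\<forall>j>0. \<forall>s<2. \<forall>u<2. \<forall>a<n. \<forall>b<n. j = 1 \<or> j \<le> d \<or> s = r \<and> j = d + 1 \<longrightarrow>
      coeff_mat j M $$ (s * n + a, u * n + b) \<le> - \<kappa> * (A ^\<^sub>m j) $$ (a, b)"
    by (elim exE conjE)
  have deg: "coeff_mat j M = 0\<^sub>m (n + n) (n + n)" if "j > d + 1" for j by (rule deg'[rule_format, OF that])
  have nonpos: "coeff_mat j M $$ (s * n + a, u * n + b) \<le> 0" if "j > 0" "s < 2" "u < 2" "a < n" "b < n" for j s u a b
    by (rule nonpos'[rule_format, OF that])
  have bound: "coeff_mat j M $$ (s * n + a, u * n + b) \<le> - \<kappa> * (A ^\<^sub>m j) $$ (a, b)"
    if "j > 0" "s < 2" "u < 2" "a < n" "b < n" "j = 1 \<or> j \<le> d \<or> s = r \<and> j = d + 1" for j s u a b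
    by (rule bound'[rule_format, OF that])
  note c = A[THEN mats_over_carrier] B[THEN mats_over_carrier]
  have lt: "s * n + a < n + n" if "s < 2" "a < n" for s a :: nat
  proof -
    have "s = 0 \<or> s = 1" using that by auto
    then show ?thesis using that by auto
  qed
  have dm: "(s * n + a) div n = s" "(s * n + a) mod n = a" if "a < n" for s a using that by auto
  have Mc: "M \<in> carrier_mat (n + n) (n + n)" using reach_carrier[OF M(1)] c by simp
  have "linear_mat B \<in> poly_mats_over R (n + n)"
    unfolding poly_mats_over_def using B c by (auto simp: coeff_mat_linear_mat)
  then have M0: "coeff_mat 0 M = 1\<^sub>m (n + n)" using reach_poly_mats_over[OF M(1)] unfolding poly_mats_over_def by auto
  define r' where "r' = 1 - r"
  have r': "r' < 2" "r' \<noteq> r" using M(2) less_2_cases[OF M(2)] unfolding r'_def by auto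
  \<comment> \<open>Edges of weight \<open>\<theta> * A\<close> are going to be removed in degree 1;
    below \<open>\<kappa> / 2\<close> at least half of the margin is left there.\<close>
  obtain \<theta> where \<theta>: "\<theta> \<in> R" "0 < \<theta>" "\<theta> < \<kappa> / 2" using dense_between[of 0 "\<kappa> / 2"] M(3) by auto
  \<comment> \<open>\<open>F * W\<close> is \<open>\<theta> * A\<close> placed in block row r' and
    block column r. Its product with the constant term removes edges from r' to r; its products with
    the nonpositive higher coefficients of block row r add the longer paths.
    \<open>W * F = 0\<close> because r and r' differ.\<close>
  define F where "F = mat (n + n) n (\<lambda>(p, x). if p div n = r' then \<theta> * A $$ (p mod n, x) else 0)"
  define W where "W = mat n (n + n) (\<lambda>(x, q). if q = r * n + x then 1 else 0 :: real)"
  have F: "F \<in> mats_over R (n + n) n"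
    unfolding F_def using n by (intro mats_overI) (auto intro!: mult_closed[OF \<theta>(1)] mats_over_index[OF A])
  have W: "W \<in> mats_over R n (n + n)" unfolding W_def by (intro mats_overI) auto
  have Fc: "F \<in> carrier_mat (n + n) n" and Wc: "W \<in> carrier_mat n (n + n)"
    using F W by (auto dest: mats_over_carrier)
  have WC: "(W * C) $$ (x, q) = C $$ (r * n + x, q)" if "C \<in> carrier_mat (n + n) m" "x < n" "q < m" for C m x q
  proof -
    have "(W * C) $$ (x, q) = (\<Sum>s = 0..<n + n. if s = r * n + x then C $$ (s, q) else 0)"
      unfolding mult_mat_index[OF Wc that] using that by (intro sum.cong) (auto simp: W_def)
    then show ?thesis using lt[OF M(2) that(2)] by simp
  qed
  have WF: "W * F = 0\<^sub>m n n"
  proof (rule eq_matI)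
    fix x y assume "x < dim_row (0\<^sub>m n n)" "y < dim_col (0\<^sub>m n n)"
    then have "x < n" "y < n" by auto
    then show "(W * F) $$ (x, y) = 0\<^sub>m n n $$ (x, y)"
      unfolding WC[OF Fc \<open>x < n\<close> \<open>y < n\<close>] using lt[OF M(2)] r' by (simp add: F_def dm)
  qed (use Fc Wc in auto)
  define M' where "M' = (1\<^sub>m (n + n) + monom 1 1 \<cdot>\<^sub>m const_mat (F * W)) * M"
  have reach': "reach (n + n) (linear_mat B) M'"
    unfolding M'_def by (rule reach.unipotent[OF M(1) F W WF]) simp
  have FWc: "F * W \<in> carrier_mat (n + n) (n + n)" using Fc Wc by (rule mult_carrier_mat)
  have cM': "coeff_mat j M' = coeff_mat j M + F * W * coeff_mat (j - 1) M" if "j > 0" for j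
    unfolding M'_def using coeff_mat_unipotent_mult[OF Mc FWc, of j 1] that by simp
  have entry: "coeff_mat j M' $$ (s * n + a, q) = coeff_mat j M $$ (s * n + a, q) +
      (if s = r' then \<theta> * (\<Sum>x = 0..<n. A $$ (a, x) * coeff_mat (j - 1) M $$ (r * n + x, q)) else 0)"
    if "j > 0" "s < 2" "a < n" "q < n + n" for j s a q
  proof -
    let ?C = "coeff_mat (j - 1) M"
    have Cc: "?C \<in> carrier_mat (n + n) (n + n)" using Mc by simp
    have "(F * W * ?C) $$ (s * n + a, q) = (F * (W * ?C)) $$ (s * n + a, q)"
      using assoc_mult_mat[OF Fc Wc Cc] by simp
    also have "\<dots> = (\<Sum>x = 0..<n. F $$ (s * n + a, x) * (W * ?C) $$ (x, q))"
      by (rule mult_mat_index[OF Fc mult_carrier_mat[OF Wc Cc] lt[OF that(2,3)] that(4)])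
    also have "\<dots> = (\<Sum>x = 0..<n. if s = r' then \<theta> * (A $$ (a, x) * ?C $$ (r * n + x, q)) else 0)"
    proof (rule sum.cong[OF refl])
      fix x assume "x \<in> {0..<n}"
      then have x: "x < n" by simp
      show "F $$ (s * n + a, x) * (W * ?C) $$ (x, q) = (if s = r' then \<theta> * (A $$ (a, x) * ?C $$ (r * n + x, q)) else 0)"
        unfolding WC[OF Cc x that(4)] using lt[OF that(2,3)] x that(3) by (simp add: F_def dm)
    qed
    also have "\<dots> = (if s = r' then \<theta> * (\<Sum>x = 0..<n. A $$ (a, x) * ?C $$ (r * n + x, q)) else 0)"
      by (cases "s = r'") (simp_all add: sum_distrib_left)
    finally show ?thesis
      unfolding cM'[OF that(1)] using mult_carrier_mat[OF FWc Cc] lt[OF that(2,3)] that(4)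
      by (simp del: index_mult_mat assoc_mult_mat)
  qed
  have pow_nn: "0 \<le> (A ^\<^sub>m j) $$ (a, b)" if "a < n" "b < n" for j a b
    by (rule pow_mat_nonneg[OF c(1) nn that])
  have first: "(\<Sum>x = 0..<n. A $$ (a, x) * coeff_mat 0 M $$ (r * n + x, u * n + b)) = (if u = r then A $$ (a, b) else 0)"
    if "a < n" "b < n" "u < 2" for a b u
  proof -
    have "r * n + x = u * n + b \<longleftrightarrow> r = u \<and> x = b" if "x < n" for x
      using dm[OF that, of r] dm[OF \<open>b < n\<close>, of u] by metis
    then have "(\<Sum>x = 0..<n. A $$ (a, x) * coeff_mat 0 M $$ (r * n + x, u * n + b)) =
        (\<Sum>x = 0..<n. if x = b then if u = r then A $$ (a, b) else 0 else 0)"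
      using lt[OF M(2)] lt[OF that(3,2)] by (intro sum.cong) (auto simp: M0)
    then show ?thesis using that by simp
  qed
  have add_nonpos: "(\<Sum>x = 0..<n. A $$ (a, x) * coeff_mat (j - 1) M $$ (r * n + x, u * n + b)) \<le> 0"
    if "a < n" "b < n" "u < 2" "j > 1" for a b u j
    using that nonpos[of "j - 1" r u _ b] M(2) nn by (intro sum_nonpos mult_nonneg_nonpos) auto
  \<comment> \<open>Block row r is bounded up to degree d + 1, so multiplication by \<open>A\<close>
    bounds block row r' up to degree d + 2. Thus r' is the copy that is ahead in the next
    round.\<close>
  have add_bound: "(\<Sum>x = 0..<n. A $$ (a, x) * coeff_mat (j - 1) M $$ (r * n + x, u * n + b)) \<le> - \<kappa> * (A ^\<^sub>m j) $$ (a, b)"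
    if "a < n" "b < n" "u < 2" "j > 1" "j \<le> d + 2" for a b u j
  proof -
    have "(\<Sum>x = 0..<n. A $$ (a, x) * coeff_mat (j - 1) M $$ (r * n + x, u * n + b)) \<le>
        (\<Sum>x = 0..<n. A $$ (a, x) * (- \<kappa> * (A ^\<^sub>m (j - 1)) $$ (x, b)))"
      using that M(2) by (intro sum_mono mult_left_mono bound nn) auto
    also have "\<dots> = - \<kappa> * (\<Sum>x = 0..<n. A $$ (a, x) * (A ^\<^sub>m (j - 1)) $$ (x, b))"
      by (simp add: sum_distrib_left algebra_simps)
    also have "(\<Sum>x = 0..<n. A $$ (a, x) * (A ^\<^sub>m (j - 1)) $$ (x, b)) = (A * A ^\<^sub>m (j - 1)) $$ (a, b)"
      using mult_mat_index[OF c(1) pow_carrier_mat[OF c(1)] that(1,2)] by simp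
    also have "A * A ^\<^sub>m (j - 1) = A ^\<^sub>m j"
      using pow_mat_Suc_left[OF c(1), of "j - 1"] that by simp
    finally show ?thesis .
  qed
  \<comment> \<open>\<open>\<kappa> / 2\<close> is what degree 1 retains after the removal, and
    \<open>\<theta> * \<kappa>\<close> is what the new paths provide in higher degrees.\<close>
  define \<kappa>' where "\<kappa>' = min (\<kappa> / 2) (\<theta> * \<kappa>)"
  have \<kappa>': "\<kappa>' > 0" "\<kappa>' \<le> \<kappa> / 2" "\<kappa>' \<le> \<theta> * \<kappa>" "\<kappa>' \<le> \<kappa>" unfolding \<kappa>'_def using M(3) \<theta> by auto
  have one: "coeff_mat 1 M' $$ (s * n + a, u * n + b) \<le> - \<kappa>' * (A ^\<^sub>m 1) $$ (a, b)"
    if "s < 2" "u < 2" "a < n" "b < n" for s u a b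
  proof -
    have A1: "A ^\<^sub>m 1 = A" using c by simp
    have "coeff_mat 1 M' $$ (s * n + a, u * n + b) \<le> - \<kappa> * A $$ (a, b) + \<theta> * A $$ (a, b)"
    proof -
      have "coeff_mat 1 M $$ (s * n + a, u * n + b) \<le> - \<kappa> * A $$ (a, b)"
        using bound[of 1 s u a b] that by (simp only: A1) simp
      moreover have "coeff_mat 1 M' $$ (s * n + a, u * n + b) = coeff_mat 1 M $$ (s * n + a, u * n + b) +
          (if s = r' then \<theta> * (if u = r then A $$ (a, b) else 0) else 0)"
        using entry[of 1 s a "u * n + b"] first[OF that(3,4,2)] that lt[OF that(2,4)] by simp
      moreover have "0 \<le> \<theta> * A $$ (a, b)" using \<theta> nn[OF that(3,4)] by simp
      ultimately show ?thesis by (auto split: if_splits)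
    qed
    also have "\<dots> \<le> - \<kappa>' * A $$ (a, b)"
      using mult_right_mono[of "\<kappa>' + \<theta>" \<kappa> "A $$ (a, b)"] \<kappa>' \<theta> nn[OF that(3,4)] by (simp add: algebra_simps)
    finally show ?thesis unfolding A1 .
  qed
  have weaken: "- \<kappa> * (A ^\<^sub>m j) $$ (a, b) \<le> - \<kappa>' * (A ^\<^sub>m j) $$ (a, b)" if "a < n" "b < n" for j a b
    using mult_right_mono[OF \<kappa>'(4) pow_nn[OF that]] by simp
  show ?case
  proof (rule exI[of _ M'], rule exI[of _ r'], rule exI[of _ \<kappa>'], intro conjI allI impI)
    fix j assume "Suc d + 1 < j"
    then show "coeff_mat j M' = 0\<^sub>m (n + n) (n + n)"
      using deg[of j] deg[of "j - 1"] right_mult_zero_mat[OF FWc] by (simp add: cM')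
  next
    fix j s u a b :: nat assume j: "0 < j" and sub: "s < 2" "u < 2" "a < n" "b < n"
    show "coeff_mat j M' $$ (s * n + a, u * n + b) \<le> 0"
    proof (cases "j = 1")
      case True
      have "0 \<le> \<kappa>' * (A ^\<^sub>m 1) $$ (a, b)" using pow_nn[OF sub(3,4), of 1] \<kappa>'(1) by simp
      then show ?thesis unfolding True using one[OF sub] by linarith
    next
      case False
      then have j1: "j > 1" using j by simp
      show ?thesis
        unfolding entry[OF j sub(1,3) lt[OF sub(2,4)]]
        using nonpos[OF j sub] mult_nonneg_nonpos[OF less_imp_le[OF \<theta>(2)] add_nonpos[OF sub(3,4,2) j1]] by (cases "s = r'") simp_all
    qed
    assume h: "j = 1 \<or> j \<le> Suc d \<or> s = r' \<and> j = Suc d + 1"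
    show "coeff_mat j M' $$ (s * n + a, u * n + b) \<le> - \<kappa>' * (A ^\<^sub>m j) $$ (a, b)"
    proof (cases "j = 1")
      case True
      then show ?thesis using one[OF sub] by simp
    next
      case False
      then have j1: "j > 1" using j by simp
      show ?thesis
      proof (cases "s = r'")
        case True
        then have jd: "j \<le> d + 2" using h False by auto
        have "coeff_mat j M' $$ (s * n + a, u * n + b) \<le> \<theta> * (- \<kappa> * (A ^\<^sub>m j) $$ (a, b))"
          unfolding entry[OF j sub(1,3) lt[OF sub(2,4)]]
          using nonpos[OF j sub] mult_left_mono[OF add_bound[OF sub(3,4,2) j1 jd] less_imp_le[OF \<theta>(2)]] True by simp
        also have "\<dots> \<le> - \<kappa>' * (A ^\<^sub>m j) $$ (a, b)"
          using mult_right_mono[OF \<kappa>'(3) pow_nn[OF sub(3,4)], of j] by (simp add: mult.assoc)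
        finally show ?thesis .
      next
        case False
        then have "s = r" using sub(1) M(2) unfolding r'_def by auto
        then have "coeff_mat j M $$ (s * n + a, u * n + b) \<le> - \<kappa> * (A ^\<^sub>m j) $$ (a, b)"
          using h False j1 by (intro bound[OF j sub]) auto
        then show ?thesis
          unfolding entry[OF j sub(1,3) lt[OF sub(2,4)]] using False weaken[OF sub(3,4), of j] by simp
      qed
    qed
  qed (use reach' r' \<kappa>' in auto)
qed

end

section \<open>Primitive companion matrices\<close>

text \<open>Read \<open>companion\<close> as a weighted graph with roots 0, ..., N - 1: a negative
  coefficient of t^j at (a, b) is a path of length j from root a to root b, and state
  \<open>j * N + b\<close> lies j steps before root b. Paths of lengths e and e + 1 join all pairs
  of roots, hence so do paths of every large length. Each state descends to a root, and from root v
  an edge leads to each state of the highest level, from which all lower states are passed.\<close>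

lemma primitive_companion:
  fixes M :: "real poly mat"
  assumes M: "M \<in> carrier_mat N N" and N: "N > 0" and e: "e > 0" "e < D"
    and nonpos: "\<And>j p q. j > 0 \<Longrightarrow> p < N \<Longrightarrow> q < N \<Longrightarrow> coeff_mat j M $$ (p, q) \<le> 0"
    and neg: "\<And>j p q. j = e \<or> j = Suc e \<Longrightarrow> p < N \<Longrightarrow> q < N \<Longrightarrow> coeff_mat j M $$ (p, q) < 0"
    and last: "v < N" "\<And>q. q < N \<Longrightarrow> coeff_mat D M $$ (v, q) < 0"
  shows "primitive_mat (companion N D M)"
proof -
  let ?T = "companion N D M" and ?K = "N * D"
  have T: "?T \<in> carrier_mat ?K ?K" by simp
  have nn: "0 \<le> ?T $$ (p, q)" if "p < ?K" "q < ?K" for p q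
    using that nonpos[of "q div N + 1" p "q mod N"] N by (auto simp: companion_def)
  define pos where "pos = (\<lambda>k p q. 0 < (?T ^\<^sub>m k) $$ (p, q))"
  have pos_trans: "pos (k + l) p q" if "pos k p x" "pos l x q" "p < ?K" "x < ?K" "q < ?K" for k l p x q
  proof -
    have "?T ^\<^sub>m (k + l) = ?T ^\<^sub>m k * ?T ^\<^sub>m l" for k l
    proof (induction l)
      case (Suc l)
      have "?T ^\<^sub>m (k + Suc l) = (?T ^\<^sub>m k * ?T ^\<^sub>m l) * ?T" using Suc by simp
      also have "\<dots> = ?T ^\<^sub>m k * (?T ^\<^sub>m l * ?T)"
        by (rule assoc_mult_mat[OF pow_carrier_mat[OF T] pow_carrier_mat[OF T] T])
      finally show ?case by simp
    qed (use T in \<open>simp add: right_mult_one_mat[OF pow_carrier_mat[OF T]] carrier_matD(1)[OF T]\<close>)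
    then have "(?T ^\<^sub>m (k + l)) $$ (p, q) = (\<Sum>s = 0..<?K. (?T ^\<^sub>m k) $$ (p, s) * (?T ^\<^sub>m l) $$ (s, q))"
      using mult_mat_index[OF pow_carrier_mat[OF T] pow_carrier_mat[OF T] that(3,5)] by simp
    also have "\<dots> > 0"
      using that pow_mat_nonneg[OF T nn] unfolding pos_def
      by (intro sum_pos2[of _ x] mult_nonneg_nonneg mult_pos_pos) auto
    finally show ?thesis unfolding pos_def .
  qed
  have pos0: "pos 0 p p" if "p < ?K" for p using that unfolding pos_def by (simp add: companion_def)
  have T1: "?T ^\<^sub>m 1 = ?T" using left_mult_one_mat[OF T] carrier_matD(1)[OF T] by simp
  have lt: "j * N + b < ?K" if "b < N" "j < D" for j b
  proof -
    have "j * N + b < Suc j * N" using that by simp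
    also have "\<dots> \<le> D * N" using that by (intro mult_le_mono1) simp
    finally show ?thesis by (simp add: mult.commute)
  qed
  have ltN: "b < ?K" if "b < N" for b using lt[OF that, of 0] e by simp
  have edge: "pos 1 a (j * N + b)" if "coeff_mat (Suc j) M $$ (a, b) < 0" "a < N" "b < N" "j < D" for a b j
    using that lt[OF that(3,4)] ltN[OF that(2)] unfolding pos_def T1 by (simp add: companion_def)
  have down1: "pos 1 (Suc j * N + b) (j * N + b)" if "b < N" "Suc j < D" for j b
    using that lt[OF that] lt[OF that(1), of j] unfolding pos_def T1 by (simp add: companion_def)
  have down: "pos k ((k + j) * N + b) (j * N + b)" if "b < N" "k + j < D" for k j b
    using that(2)
  proof (induction k)
    case 0
    then show ?case using pos0 lt[OF that(1)] by simp
  next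
    case (Suc k)
    have "pos (1 + k) (Suc (k + j) * N + b) (j * N + b)"
      using Suc that by (intro pos_trans[of 1 _ "(k + j) * N + b"] down1 lt) auto
    then show ?case by simp
  qed
  have loop: "pos k a b" if k: "k = e \<or> k = Suc e" and "a < N" "b < N" for k a b
  proof -
    define i where "i = k - 1"
    have i: "k = Suc i" "i < D" using k e unfolding i_def by auto
    have 1: "pos 1 a (i * N + b)" using that i neg[of k a b] by (intro edge) auto
    have 2: "pos i (i * N + b) b" using down[of b i 0] that i by simp
    from pos_trans[OF 1 2 ltN[OF that(2)] lt[OF that(3) i(2)] ltN[OF that(3)]]
    show ?thesis using i by simp
  qed
  have loops: "pos (x * e + y * Suc e) a b" if "x + y > 0" "a < N" "b < N" for x y a b
    using that
  proof (induction "x + y" arbitrary: x y a)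
    case (Suc m)
    show ?case
    proof (cases "m = 0")
      case True
      then have "x = 1 \<and> y = 0 \<or> x = 0 \<and> y = 1" using Suc.hyps(2) by auto
      then show ?thesis using loop[of _ a b] Suc.prems by auto
    next
      case False
      show ?thesis
      proof (cases x)
        case 0
        then obtain y' where y: "y = Suc y'" using Suc.hyps(2) by (cases y) auto
        have "pos (Suc e + (x * e + y' * Suc e)) a b"
          using Suc.hyps(2) Suc.prems False y 0
          by (intro pos_trans[of _ a a] Suc.hyps(1) loop ltN) auto
        then show ?thesis using y by (simp add: algebra_simps)
      next
        case (Suc x')
        have "pos (e + (x' * e + y * Suc e)) a b"
          using Suc.hyps(2) Suc.prems False Suc
          by (intro pos_trans[of _ a a] Suc.hyps(1) loop ltN) auto
        then show ?thesis using Suc by (simp add: algebra_simps)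
      qed
    qed
  qed simp
  \<comment> \<open>For \<open>k \<ge> e * e\<close> write k as \<open>k div e - k mod e\<close>
    steps of length e and \<open>k mod e\<close> steps of length e + 1; the first number is
    nonnegative since \<open>k div e \<ge> e > k mod e\<close>.\<close>
  have loops': "pos k a b" if "k \<ge> e * e" "a < N" "b < N" for k a b
  proof -
    have r: "k mod e < e" using e by simp
    have q: "k div e \<ge> e" using that(1) e by (simp add: less_eq_div_iff_mult_less_eq)
    have "(k div e - k mod e) * e + (k mod e) * Suc e = k div e * e + k mod e"
      using r q by (simp add: algebra_simps diff_mult_distrib)
    then have "(k div e - k mod e) * e + (k mod e) * Suc e = k" by simp
    then show ?thesis using loops[of "k div e - k mod e" "k mod e" a b] that r q by simp
  qed
  have "pos (e * e + 2 * D) p q" if pq: "p < ?K" "q < ?K" for p q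
  proof -
    define j b i c where "j = p div N" "b = p mod N" "i = q div N" "c = q mod N"
    have p: "p = j * N + b" "b < N" and q: "q = i * N + c" "c < N" using N by (auto simp: j_b_i_c_def)
    have j: "j < D" "i < D" using pq N by (simp_all add: j_b_i_c_def div_less_iff_less_mult mult.commute)
    \<comment> \<open>The middle piece, from root b to root v, compensates the lengths of the two
      descents, so the total is the same for all p and q; it is at least \<open>e * e\<close>, as
      \<open>loops'\<close> demands.\<close>
    let ?l = "e * e + (D - j) + i"
    have 1: "pos j p b" using down[of b j 0] p j by simp
    have 2: "pos ?l b v" using last p by (intro loops') auto
    have 3: "pos 1 v ((D - 1) * N + c)" using last q j by (intro edge) auto
    have 4: "pos (D - 1 - i) ((D - 1) * N + c) q" using down[of c "D - 1 - i" i] q j by simp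
    have D1: "D - 1 < D" using e by simp
    have eq: "j + ?l + 1 + (D - 1 - i) = e * e + 2 * D" using j by simp
    have "pos (j + ?l) p v" by (rule pos_trans[OF 1 2 pq(1) ltN[OF p(2)] ltN[OF last(1)]])
    from pos_trans[OF this 3 pq(1) ltN[OF last(1)] lt[OF q(2) D1]]
    have "pos (j + ?l + 1) p ((D - 1) * N + c)" .
    from pos_trans[OF this 4 pq(1) lt[OF q(2) D1] pq(2)] show ?thesis unfolding eq .
  qed
  then have "\<forall>x\<in>elements_mat (?T ^\<^sub>m (e * e + 2 * D)). 0 < x"
    unfolding pos_def by (auto dest!: elements_matD simp only: carrier_matD[OF pow_carrier_mat[OF T]])
  moreover have "\<forall>x\<in>elements_mat ?T. 0 \<le> x"
    using nn by (auto dest!: elements_matD simp only: carrier_matD[OF T])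
  moreover have "square_mat ?T" "dim_row ?T > 0" using N e by (auto simp: companion_def)
  ultimately show ?thesis unfolding primitive_mat_def using e by (auto intro!: exI[of _ "e * e + 2 * D"])
qed

section \<open>Mixing the two blocks\<close>

context real_unital_subring
begin

text \<open>Conjugation by \<open>S\<close> adds row \<open>v\<close> of the first block to every row of the second block, and then
  \<open>\<zeta>\<close> times column \<open>v\<close> to every column of the second block. For small \<open>\<zeta>\<close> the inverse operations
  on the other side only rescale row \<open>v\<close> by a positive factor.\<close>

lemma mixing_matrices:
  assumes \<zeta>: "\<zeta> \<in> R" "0 < \<zeta>" "real k * \<zeta> < 1" and v: "v < N"
  shows "\<exists>S S' \<alpha> \<beta> \<phi>. S \<in> mats_over R (N + k) (N + k) \<and> S' \<in> mats_over R (N + k) (N + k) \<and>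
    S * S' = 1\<^sub>m (N + k) \<and> S' * S = 1\<^sub>m (N + k) \<and>
    (\<forall>p<N + k. \<alpha> p > 0 \<and> \<beta> p > 0 \<and> \<phi> p < N) \<and> \<phi> v = v \<and>
    (\<forall>C\<in>carrier_mat N N. \<forall>p<N + k. \<forall>q<N + k.
      (S * direct_sum C (0\<^sub>m k k) * S') $$ (p, q) = \<alpha> p * C $$ (\<phi> p, \<phi> q) * \<beta> q)"
proof -
  define E :: "real mat" where "E = mat k N (\<lambda>(r, b). if b = v then 1 else 0)"
  define Z where "Z = mat N k (\<lambda>(a, r). if a = v then \<zeta> else 0)"
  have ER: "E \<in> mats_over R k N" "Z \<in> mats_over R N k"
    unfolding E_def Z_def using \<zeta>(1) by (auto intro!: mats_overI)
  have c: "E \<in> carrier_mat k N" "Z \<in> carrier_mat N k" unfolding E_def Z_def by auto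
  have cp: "Z * E \<in> carrier_mat N N" "E * Z \<in> carrier_mat k k" using c by (auto intro: mult_carrier_mat)
  let ?S1 = "four_block_mat (1\<^sub>m N) (0\<^sub>m N k) E (1\<^sub>m k)" and ?T1 = "four_block_mat (1\<^sub>m N) (0\<^sub>m N k) (- E) (1\<^sub>m k)"
  let ?S2 = "four_block_mat (1\<^sub>m N) (- Z) (0\<^sub>m k N) (1\<^sub>m k)" and ?T2 = "four_block_mat (1\<^sub>m N) Z (0\<^sub>m k N) (1\<^sub>m k)"
  define S where "S = ?S2 * ?S1"
  define S' where "S' = ?T1 * ?T2"
  have R12: "?S1 \<in> mats_over R (N + k) (N + k)" "?T1 \<in> mats_over R (N + k) (N + k)"
    "?S2 \<in> mats_over R (N + k) (N + k)" "?T2 \<in> mats_over R (N + k) (N + k)"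
    using ER by auto
  note c12 = R12[THEN mats_over_carrier]
  have S: "S \<in> mats_over R (N + k) (N + k)" "S' \<in> mats_over R (N + k) (N + k)"
    unfolding S_def S'_def using R12 by auto
  have E0: "E + - E = 0\<^sub>m k N" "- E + E = 0\<^sub>m k N" "Z + - Z = 0\<^sub>m N k" "- Z + Z = 0\<^sub>m N k"
    using c by auto
  have neg0: "- 0\<^sub>m i j = (0\<^sub>m i j :: real mat)" for i j by (intro eq_matI) auto
  have inv: "?S1 * ?T1 = 1\<^sub>m (N + k)" "?T1 * ?S1 = 1\<^sub>m (N + k)" "?S2 * ?T2 = 1\<^sub>m (N + k)" "?T2 * ?S2 = 1\<^sub>m (N + k)"
    using c E0 neg0 by (subst mult_four_block_mat[of _ N N _ k _ k _ _ N _ k]; simp)+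
  have prod: "(F * G) * (G' * F') = 1\<^sub>m (N + k)"
    if "F \<in> carrier_mat (N + k) (N + k)" "G \<in> carrier_mat (N + k) (N + k)" "G' \<in> carrier_mat (N + k) (N + k)"
      "F' \<in> carrier_mat (N + k) (N + k)" "G * G' = 1\<^sub>m (N + k)" "F * F' = 1\<^sub>m (N + k)" for F G G' F' :: "real mat"
  proof -
    have "(F * G) * (G' * F') = F * (G * (G' * F'))"
      using that by (intro assoc_mult_mat mult_carrier_mat[of _ "N + k" "N + k"]) auto
    also have "G * (G' * F') = (G * G') * F'"
      using that by (intro assoc_mult_mat[symmetric]) auto
    finally show ?thesis using that by simp
  qed
  have inv1: "S * S' = 1\<^sub>m (N + k)" unfolding S_def S'_def by (rule prod[OF c12(3,1,2,4) inv(1,3)])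
  have inv2: "S' * S = 1\<^sub>m (N + k)" unfolding S_def S'_def by (rule prod[OF c12(2,4,3,1) inv(4,2)])
  have S_eq: "S = four_block_mat (1\<^sub>m N + - (Z * E)) (- Z) E (1\<^sub>m k)"
    unfolding S_def using c by (subst mult_four_block_mat[of _ N N _ k _ k _ _ N _ k]) auto
  have S'_eq: "S' = four_block_mat (1\<^sub>m N) Z (- E) (- (E * Z) + 1\<^sub>m k)"
    unfolding S'_def using c by (subst mult_four_block_mat[of _ N N _ k _ k _ _ N _ k]) auto
  \<comment> \<open>Every index of the second block imitates v. The factor
    \<open>1 - k * \<zeta>\<close> in row v comes from \<open>Z * E\<close>, where the k added
    columns of weight \<zeta> meet the k copies of row v; it is positive by the hypothesis on
    \<zeta>.\<close>
  define \<phi> where "\<phi> = (\<lambda>p. if p < N then p else v)"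
  define \<alpha> where "\<alpha> = (\<lambda>p. if p = v then 1 - real k * \<zeta> else 1)"
  define \<beta> where "\<beta> = (\<lambda>p. if p < N then 1 else \<zeta>)"
  have ZE: "(Z * E) $$ (a, b) = (if a = v \<and> b = v then real k * \<zeta> else 0)" if "a < N" "b < N" for a b
    unfolding mult_mat_index[OF c(2,1) that] using that by (auto simp: Z_def E_def)
  have E_index: "E $$ (r, b) = (if b = v then 1 else 0)" if "r < k" "b < N" for r b
    using that by (simp add: E_def)
  have Sl: "S $$ (p, x) = (if x = \<phi> p then \<alpha> p else 0)" if "p < N + k" "x < N" for p x
    using that c cp v by (auto simp: S_eq \<phi>_def \<alpha>_def ZE E_index simp del: index_mult_mat(1))
  have Sr: "S' $$ (y, q) = (if y = \<phi> q then \<beta> q else 0)" if "y < N" "q < N + k" for y q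
    using that c cp v by (auto simp: S'_eq \<phi>_def \<beta>_def Z_def)
  have \<phi>: "\<phi> p < N" for p using v by (simp add: \<phi>_def)
  have main: "(S * direct_sum C (0\<^sub>m k k) * S') $$ (p, q) = \<alpha> p * C $$ (\<phi> p, \<phi> q) * \<beta> q"
    if C: "C \<in> carrier_mat N N" and pq: "p < N + k" "q < N + k" for C p q
  proof -
    let ?C = "direct_sum C (0\<^sub>m k k)"
    have Cc: "?C \<in> carrier_mat (N + k) (N + k)" using C by auto
    note Sc = S[THEN mats_over_carrier]
    have SC: "(S * ?C) $$ (p, y) = (if y < N then \<alpha> p * C $$ (\<phi> p, y) else 0)" if "y < N + k" for y
    proof -
      have "(S * ?C) $$ (p, y) = (\<Sum>x = 0..<N + k. S $$ (p, x) * ?C $$ (x, y))"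
        by (rule mult_mat_index[OF Sc(1) Cc pq(1) that])
      also have "\<dots> = (\<Sum>x = 0..<N + k. if x = \<phi> p then if y < N then \<alpha> p * C $$ (\<phi> p, y) else 0 else 0)"
        using C that pq Sl \<phi> by (intro sum.cong) auto
      also have "\<dots> = (if y < N then \<alpha> p * C $$ (\<phi> p, y) else 0)" using \<phi>[of p] by (simp add: trans_less_add1)
      finally show ?thesis .
    qed
    have "(S * ?C * S') $$ (p, q) = (\<Sum>y = 0..<N + k. (S * ?C) $$ (p, y) * S' $$ (y, q))"
      by (rule mult_mat_index[OF mult_carrier_mat[OF Sc(1) Cc] Sc(2) pq])
    also have "\<dots> = (\<Sum>y = 0..<N + k. if y = \<phi> q then \<alpha> p * C $$ (\<phi> p, \<phi> q) * \<beta> q else 0)"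
      using SC Sr pq \<phi> by (intro sum.cong) auto
    also have "\<dots> = \<alpha> p * C $$ (\<phi> p, \<phi> q) * \<beta> q" using \<phi>[of q] by (simp add: trans_less_add1)
    finally show ?thesis .
  qed
  have pos: "\<alpha> p > 0" "\<beta> p > 0" for p using \<zeta> by (auto simp: \<alpha>_def \<beta>_def)
  show ?thesis
    by (rule exI[of _ S], rule exI[of _ S'], rule exI[of _ \<alpha>], rule exI[of _ \<beta>], rule exI[of _ \<phi>])
      (use S inv1 inv2 pos \<phi> main v in \<open>auto simp: \<phi>_def\<close>)
qed

end

text \<open>A positive power excludes zero columns of \<open>A\<close>, and with nonzero columns
  positivity of \<open>A ^ j\<close> passes to \<open>A ^ (j + 1)\<close>.\<close>

lemma primitive_mat_eventually_positive:
  assumes A: "A \<in> carrier_mat n n" and prim: "primitive_mat A"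
  shows "\<exists>L>0. \<forall>j\<ge>L. \<forall>a<n. \<forall>b<n. 0 < (A ^\<^sub>m j) $$ (a, b)"
proof -
  from prim obtain L where L: "L > 0" "\<And>x. x \<in> elements_mat (A ^\<^sub>m L) \<Longrightarrow> 0 < x" and n: "n > 0"
    and nn: "\<And>x. x \<in> elements_mat A \<Longrightarrow> 0 \<le> x"
    using A unfolding primitive_mat_def by auto
  have A0: "0 \<le> A $$ (a, b)" if "a < n" "b < n" for a b
    using nn[OF elements_matI[OF A that]] by simp
  have AL: "0 < (A ^\<^sub>m L) $$ (a, b)" if "a < n" "b < n" for a b
    using L(2)[OF elements_matI[OF pow_carrier_mat[OF A] that]] by simp
  have col: "\<exists>s<n. 0 < A $$ (s, b)" if "b < n" for b
  proof (rule ccontr)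
    assume "\<not> (\<exists>s<n. 0 < A $$ (s, b))"
    then have z: "A $$ (s, b) = 0" if "s < n" for s using A0[OF that \<open>b < n\<close>] that by force
    have "(A ^\<^sub>m Suc (L - 1)) $$ (0, b) = (\<Sum>s = 0..<n. (A ^\<^sub>m (L - 1)) $$ (0, s) * A $$ (s, b))"
      using mult_mat_index[OF pow_carrier_mat[OF A] A n that] by simp
    also have "\<dots> = 0" using z by simp
    finally show False using AL[OF n that] L(1) by simp
  qed
  have "0 < (A ^\<^sub>m j) $$ (a, b)" if "j \<ge> L" "a < n" "b < n" for j a b
    using that
  proof (induction j arbitrary: b rule: dec_induct)
    case base
    then show ?case using AL by simp
  next
    case (step j)
    obtain s where s: "s < n" "0 < A $$ (s, b)" using col[OF step.prems(2)] by blast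
    have "(A ^\<^sub>m Suc j) $$ (a, b) = (\<Sum>s = 0..<n. (A ^\<^sub>m j) $$ (a, s) * A $$ (s, b))"
      using mult_mat_index[OF pow_carrier_mat[OF A] A step.prems] by simp
    also have "\<dots> > 0"
      using s step A0 pow_mat_nonneg[OF A A0] by (intro sum_pos2[of _ s] mult_pos_pos mult_nonneg_nonneg) auto
    finally show ?case .
  qed
  then show ?thesis using L(1) by blast
qed

context unital_subring
begin

text \<open>Each edge is split between two copies of its target with weights h and 1 - h. With
  \<open>0 < h < 1\<close>, which density allows, all four blocks dominate a positive multiple of
  \<open>A\<close>.\<close>

lemma esse_doubling:
  assumes A: "A \<in> mats_over R n n" and h: "h \<in> R"
  shows "esse A (four_block_mat (h \<cdot>\<^sub>m A) ((1 - h) \<cdot>\<^sub>m A) (h \<cdot>\<^sub>m A) ((1 - h) \<cdot>\<^sub>m A))"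
proof (rule esseI)
  note c = A[THEN mats_over_carrier]
  let ?U = "four_block_mat (h \<cdot>\<^sub>m A) ((1 - h) \<cdot>\<^sub>m A) (0\<^sub>m 0 n) (0\<^sub>m 0 n)"
  let ?V = "four_block_mat (1\<^sub>m n) (0\<^sub>m n 0) (1\<^sub>m n) (0\<^sub>m n 0)"
  have h': "1 - h \<in> R" using h by (intro diff_closed) auto
  show "?U \<in> mats_over R n (n + n)"
    using four_block_mats_over[of "h \<cdot>\<^sub>m A" n n "(1 - h) \<cdot>\<^sub>m A" n "0\<^sub>m 0 n" 0 "0\<^sub>m 0 n"] A h h' by simp
  show "?V \<in> mats_over R (n + n) n"
    using four_block_mats_over[of "1\<^sub>m n" n n "0\<^sub>m n 0" 0 "1\<^sub>m n" n "0\<^sub>m n 0"] by simp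
  have "?U * ?V = four_block_mat (h \<cdot>\<^sub>m A + (1 - h) \<cdot>\<^sub>m A) (0\<^sub>m n 0) (0\<^sub>m 0 n) (0\<^sub>m 0 0)"
    using c by (subst mult_four_block_mat[of _ n n _ n _ 0 _ _ n _ 0]) auto
  also have "\<dots> = A" using c by (intro eq_matI) (auto simp: algebra_simps)
  finally show "A = ?U * ?V" by simp
  show "four_block_mat (h \<cdot>\<^sub>m A) ((1 - h) \<cdot>\<^sub>m A) (h \<cdot>\<^sub>m A) ((1 - h) \<cdot>\<^sub>m A) = ?V * ?U"
    using c by (subst mult_four_block_mat[of _ n n _ 0 _ n _ _ n _ n]) auto
qed

end

lemma linear_mat_direct_sum:
  assumes "A \<in> carrier_mat n n" "B \<in> carrier_mat m m"
  shows "linear_mat (direct_sum A B) = direct_sum (linear_mat A) (linear_mat B)"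
proof (rule coeff_mat_eqI)
  have S: "direct_sum A B \<in> carrier_mat (n + m) (n + m)" using assms by auto
  have c: "linear_mat A \<in> carrier_mat n n" "linear_mat B \<in> carrier_mat m m" using assms by auto
  show "linear_mat (direct_sum A B) \<in> carrier_mat (n + m) (n + m)" by (rule linear_mat_carrier[OF S])
  show "direct_sum (linear_mat A) (linear_mat B) \<in> carrier_mat (n + m) (n + m)" using c by auto
  have z: "coeff_mat d (0\<^sub>m i j :: 'a poly mat) = 0\<^sub>m i j" for d i j by (intro eq_matI) (auto simp: coeff_mat_index)
  have u: "- direct_sum A B = four_block_mat (- A) (0\<^sub>m n m) (0\<^sub>m m n) (- B)"
    using assms by (intro eq_matI) auto
  show "coeff_mat d (linear_mat (direct_sum A B)) = coeff_mat d (direct_sum (linear_mat A) (linear_mat B))" for d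
    using c assms carrier_matD[OF c(1)] carrier_matD[OF c(2)] unfolding coeff_mat_linear_mat[OF S]
    by (subst coeff_mat_four_block[of _ n n _ m _ m]) (auto simp: z u coeff_mat_linear_mat[OF assms(1)] coeff_mat_linear_mat[OF assms(2)])
qed

section \<open>Assembling the primitive matrix\<close>

context dense_subring
begin

text \<open>All data that determine the limit coefficients (the family with its degree bound, then
  d, \<open>M\<close> and \<zeta>) are fixed first; only then is a single member \<nu> selected
  whose perturbation is below the resulting margin.\<close>

lemma sse_primitive_direct_sum_nilpotent:
  assumes A: "A \<in> mats_over R n n" and prim: "primitive_mat A"
    and Q: "Q \<in> mats_over R k0 k0" and nil: "Q ^\<^sub>m l = 0\<^sub>m k0 k0"
  shows "\<exists>m C. C \<in> mats_over R m m \<and> primitive_mat C \<and> sse (direct_sum A Q) C"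
proof -
  note Ac = A[THEN mats_over_carrier] and Qc = Q[THEN mats_over_carrier]
  have nn: "\<forall>a<n. \<forall>b<n. 0 \<le> A $$ (a, b)"
    using prim elements_matI[OF Ac] unfolding primitive_mat_def by blast
  have n: "n > 0" using prim Ac unfolding primitive_mat_def by auto
  obtain L where L: "L > 0" "\<And>j a b. j \<ge> L \<Longrightarrow> a < n \<Longrightarrow> b < n \<Longrightarrow> 0 < (A ^\<^sub>m j) $$ (a, b)"
    using primitive_mat_eventually_positive[OF Ac prim] by blast
  obtain h where h: "h \<in> R" "0 < h" "h < 1" using dense_between[of 0 1] by auto
  define B where "B = four_block_mat (h \<cdot>\<^sub>m A) ((1 - h) \<cdot>\<^sub>m A) (h \<cdot>\<^sub>m A) ((1 - h) \<cdot>\<^sub>m A)"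
  have "1 - h \<in> R" using h by (intro diff_closed) auto
  then have B: "B \<in> mats_over R (n + n) (n + n)" unfolding B_def using A h by auto
  note Bc = B[THEN mats_over_carrier]
  have AB: "esse A B" unfolding B_def by (rule esse_doubling[OF A h(1)])
  have dom: "\<forall>s<2. \<forall>u<2. \<forall>a<n. \<forall>b<n. min h (1 - h) * A $$ (a, b) \<le> B $$ (s * n + a, u * n + b)"
  proof (intro allI impI)
    fix s u a b :: nat assume that: "s < 2" "u < 2" "a < n" "b < n"
    have "s = 0 \<or> s = 1" "u = 0 \<or> u = 1" using that by auto
    moreover have "min h (1 - h) * A $$ (a, b) \<le> h * A $$ (a, b)" "min h (1 - h) * A $$ (a, b) \<le> (1 - h) * A $$ (a, b)"
      using nn that(3,4) by (intro mult_right_mono; simp)+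
    ultimately show "min h (1 - h) * A $$ (a, b) \<le> B $$ (s * n + a, u * n + b)" using that Ac by (auto simp: B_def)
  qed
  define k where "k = k0 + k0"
  obtain f where f: "\<And>\<nu>. f \<nu> \<in> mats_over R k k" "\<And>\<nu>. esse Q (f \<nu>)"
    "vanishing_family k 1 (\<lambda>\<nu>. linear_mat (f \<nu>))"
    using nilpotent_family[OF Q nil] unfolding k_def by blast
  note fc = f(1)[THEN mats_over_carrier]
  \<comment> \<open>Raising the order uses the corner entry (0, 0), so an empty nilpotent block is
    handled separately; there all coefficients are trivially zero.\<close>
  obtain g where g: "vanishing_family k L g" "\<And>\<nu>. reach k (linear_mat (f \<nu>)) (g \<nu>)"
  proof (cases "k = 0")
    case True
    have "M = 0\<^sub>m 0 0" if "M \<in> carrier_mat 0 0" for M :: "real mat" using that by auto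
    then have "vanishing_family k L (\<lambda>\<nu>. linear_mat (f \<nu>))"
      using f(3) True unfolding vanishing_family_def poly_mats_over_def by auto
    then show ?thesis using that reach.base by blast
  next
    case False
    then show ?thesis using that vanishing_family_raise[OF f(3) _ L(1)] by auto
  qed
  have gP: "g \<nu> \<in> carrier_mat k k" for \<nu> using g(1) unfolding vanishing_family_def poly_mats_over_def by auto
  obtain D1 where D1: "\<And>\<nu> d. d > D1 \<Longrightarrow> coeff_mat d (g \<nu>) = 0\<^sub>m k k"
    using g(1) unfolding vanishing_family_def by blast
  have gL: "coeff_mat d (g \<nu>) = 0\<^sub>m k k" if "0 < d" "d < L" for \<nu> d
    using g(1) that unfolding vanishing_family_def by blast
  have glim: "(\<lambda>\<nu>. coeff_mat d (g \<nu>) $$ (p, q)) \<longlonglongrightarrow> 0" if "d > 0" "p < k" "q < k" for d p q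
    using g(1) that unfolding vanishing_family_def by blast
  \<comment> \<open>\<open>D1 \<le> d\<close> keeps the perturbation out of degrees above d;
    \<open>L + 1 \<le> d\<close> provides the two consecutive degrees L and L + 1 with strict
    signs.\<close>
  define d where "d = max D1 (L + 1)"
  have d: "D1 \<le> d" "L + 1 \<le> d" unfolding d_def by auto
  have "min h (1 - h) > 0" using h by simp
  from reach_dominating_powers[OF A nn B n this dom, of d]
  obtain M r \<kappa> where M: "reach (n + n) (linear_mat B) M" "r < 2" "\<kappa> > 0"
    and Mdeg: "\<forall>j>d + 1. coeff_mat j M = 0\<^sub>m (n + n) (n + n)"
    and Mle: "\<forall>j>0. \<forall>s<2. \<forall>u<2. \<forall>a<n. \<forall>b<n. coeff_mat j M $$ (s * n + a, u * n + b) \<le> 0"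
    and Mbound: "\<forall>j>0. \<forall>s<2. \<forall>u<2. \<forall>a<n. \<forall>b<n. j = 1 \<or> j \<le> d \<or> s = r \<and> j = d + 1 \<longrightarrow>
      coeff_mat j M $$ (s * n + a, u * n + b) \<le> - \<kappa> * (A ^\<^sub>m j) $$ (a, b)"
    by (elim exE conjE)
  have Mc: "M \<in> carrier_mat (n + n) (n + n)" using reach_carrier[OF M(1)] Bc by simp
  \<comment> \<open>The first row of copy r, the copy whose bound extends to degree d + 1. The same
    v is the row imitated by the second block.\<close>
  define v where "v = r * n"
  have "r = 0 \<or> r = 1" using M(2) by auto
  then have v: "v < n + n" "v div n = r" using n unfolding v_def by auto
  have split: "p div n < 2" "p mod n < n" "p div n * n + p mod n = p" if "p < n + n" for p
    using that n by (auto simp: div_less_iff_less_mult)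
  have M_le: "coeff_mat j M $$ (p, q) \<le> 0" if "j > 0" "p < n + n" "q < n + n" for j p q
    using Mle[rule_format, OF that(1) split(1)[OF that(2)] split(1)[OF that(3)] split(2)[OF that(2)] split(2)[OF that(3)]]
    unfolding split(3)[OF that(2)] split(3)[OF that(3)] by simp
  have M_less: "coeff_mat j M $$ (p, q) < 0"
    if "L \<le> j" "j \<le> d \<or> p = v \<and> j = d + 1" "p < n + n" "q < n + n" for j p q
  proof -
    have j: "j > 0" using that(1) L(1) by simp
    have "j = 1 \<or> j \<le> d \<or> p div n = r \<and> j = d + 1" using that(2) v by auto
    from Mbound[rule_format, OF j split(1)[OF that(3)] split(1)[OF that(4)] split(2)[OF that(3)] split(2)[OF that(4)] this]
    have "coeff_mat j M $$ (p, q) \<le> - \<kappa> * (A ^\<^sub>m j) $$ (p mod n, q mod n)"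
      unfolding split(3)[OF that(3)] split(3)[OF that(4)] .
    moreover have "0 < \<kappa> * (A ^\<^sub>m j) $$ (p mod n, q mod n)"
      using M(3) L(2)[OF that(1) split(2)[OF that(3)] split(2)[OF that(4)]] by simp
    ultimately show ?thesis by linarith
  qed
  obtain \<zeta> where \<zeta>: "\<zeta> \<in> R" "0 < \<zeta>" "\<zeta> < 1 / real (Suc k)" using dense_between[of 0 "1 / real (Suc k)"] by auto
  have "real k * \<zeta> \<le> real (Suc k) * \<zeta>" using \<zeta>(2) by simp
  also have "\<dots> < 1" using \<zeta>(3) by (simp add: field_simps)
  finally have "real k * \<zeta> < 1" .
  from mixing_matrices[OF \<zeta>(1,2) this v(1)]
  obtain S S' \<alpha> \<beta> \<phi> where S: "S \<in> mats_over R (n + n + k) (n + n + k)" "S' \<in> mats_over R (n + n + k) (n + n + k)"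
    "S * S' = 1\<^sub>m (n + n + k)" "S' * S = 1\<^sub>m (n + n + k)"
    and pos: "\<forall>p<n + n + k. \<alpha> p > 0 \<and> \<beta> p > 0 \<and> \<phi> p < n + n" and \<phi>v: "\<phi> v = v"
    and mix: "\<forall>C\<in>carrier_mat (n + n) (n + n). \<forall>p<n + n + k. \<forall>q<n + n + k.
      (S * direct_sum C (0\<^sub>m k k) * S') $$ (p, q) = \<alpha> p * C $$ (\<phi> p, \<phi> q) * \<beta> q"
    by (elim exE conjE)
  note Sc = S(1,2)[THEN mats_over_carrier]
  let ?N = "n + n + k"
  define H where "H = (\<lambda>\<nu>. const_mat S * direct_sum M (g \<nu>) * const_mat S')"
  have Gc: "direct_sum M (g \<nu>) \<in> carrier_mat ?N ?N" for \<nu> using Mc gP[of \<nu>] by auto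
  have cH: "coeff_mat j (H \<nu>) = S * four_block_mat (coeff_mat j M) (0\<^sub>m (n + n) k) (0\<^sub>m k (n + n)) (coeff_mat j (g \<nu>)) * S'" for j \<nu>
  proof -
    have "coeff_mat j (0\<^sub>m a b :: real poly mat) = 0\<^sub>m a b" for a b by (intro eq_matI) (auto simp: coeff_mat_index)
    then have "coeff_mat j (direct_sum M (g \<nu>)) = four_block_mat (coeff_mat j M) (0\<^sub>m (n + n) k) (0\<^sub>m k (n + n)) (coeff_mat j (g \<nu>))"
      using Mc gP[of \<nu>] by (subst coeff_mat_four_block[of _ "n + n" "n + n" _ k _ k]) auto
    then show ?thesis unfolding H_def coeff_mat_conj[OF Gc Sc] by simp
  qed
  \<comment> \<open>The coefficient that results if the nilpotent block contributes nothing,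
    computed by \<open>mixing_matrices\<close>.\<close>
  define lim where "lim = (\<lambda>j p q. \<alpha> p * coeff_mat j M $$ (\<phi> p, \<phi> q) * \<beta> q)"
  have limit_entry: "(S * four_block_mat (coeff_mat j M) (0\<^sub>m (n + n) k) (0\<^sub>m k (n + n)) (0\<^sub>m k k) * S') $$ (p, q) = lim j p q"
    if "p < ?N" "q < ?N" for j p q
    using mix[rule_format, of "coeff_mat j M" p q] that Mc carrier_matD[OF Mc] by (simp add: lim_def)
  have exact: "coeff_mat j (H \<nu>) $$ (p, q) = lim j p q" if "coeff_mat j (g \<nu>) = 0\<^sub>m k k" "p < ?N" "q < ?N" for j \<nu> p q
    unfolding cH that(1) by (rule limit_entry[OF that(2,3)])
  have tends: "(\<lambda>\<nu>. coeff_mat j (H \<nu>) $$ (p, q)) \<longlonglongrightarrow> lim j p q" if "j > 0" "p < ?N" "q < ?N" for j p q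
  proof -
    have "mat_tendsto ?N ?N (\<lambda>\<nu>. four_block_mat (coeff_mat j M) (0\<^sub>m (n + n) k) (0\<^sub>m k (n + n)) (coeff_mat j (g \<nu>)))
        (four_block_mat (coeff_mat j M) (0\<^sub>m (n + n) k) (0\<^sub>m k (n + n)) (0\<^sub>m k k))"
      (is "mat_tendsto _ _ ?F ?G")
      unfolding mat_tendsto_def
    proof (intro conjI allI impI)
      fix p q assume pq: "p < ?N" "q < ?N"
      show "(\<lambda>\<nu>. ?F \<nu> $$ (p, q)) \<longlonglongrightarrow> ?G $$ (p, q)"
      proof (cases "p < n + n \<or> q < n + n")
        case True
        then have "?F \<nu> $$ (p, q) = ?G $$ (p, q)" for \<nu> using pq Mc gP[of \<nu>] by auto
        then show ?thesis by simp
      next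
        case False
        then have "?F \<nu> $$ (p, q) = coeff_mat j (g \<nu>) $$ (p - (n + n), q - (n + n))" for \<nu> using pq Mc gP[of \<nu>] by auto
        moreover have "?G $$ (p, q) = 0" using False pq Mc by auto
        ultimately show ?thesis using glim[OF \<open>j > 0\<close>, of "p - (n + n)" "q - (n + n)"] False pq by auto
      qed
    next
      show "?F \<nu> \<in> carrier_mat ?N ?N" for \<nu> using Mc gP[of \<nu>] by auto
      show "?G \<in> carrier_mat ?N ?N" using Mc by auto
    qed
    from mat_tendsto_mult[OF mat_tendsto_mult[OF mat_tendsto_const[OF Sc(1)] this] mat_tendsto_const[OF Sc(2)]]
    show ?thesis unfolding cH limit_entry[OF that(2,3), symmetric] mat_tendsto_def using that by blast
  qed
  have lim_le: "lim j p q \<le> 0" if "j > 0" "p < ?N" "q < ?N" for j p q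
    using M_le[OF that(1), of "\<phi> p" "\<phi> q"] pos that unfolding lim_def
    by (intro mult_nonpos_nonneg mult_nonneg_nonpos) (auto intro: less_imp_le)
  have lim_less: "lim j p q < 0" if "L \<le> j" "j \<le> d \<or> p = v \<and> j = d + 1" "p < ?N" "q < ?N" for j p q
    using M_less[OF that(1), of "\<phi> p" "\<phi> q"] pos that \<phi>v unfolding lim_def
    by (intro mult_neg_pos mult_pos_neg) auto
  have "\<forall>\<^sub>F \<nu> in sequentially. \<forall>(j, p, q)\<in>{L..d} \<times> {..<?N} \<times> {..<?N}. coeff_mat j (H \<nu>) $$ (p, q) < 0"
  proof (rule eventually_ball_finite)
    show "\<forall>x\<in>{L..d} \<times> {..<?N} \<times> {..<?N}. \<forall>\<^sub>F \<nu> in sequentially. case x of (j, p, q) \<Rightarrow> coeff_mat j (H \<nu>) $$ (p, q) < 0"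
      using order_tendstoD(2)[OF tends lim_less] L(1) by auto
  qed auto
  then obtain \<nu> where \<nu>: "\<And>j p q. L \<le> j \<Longrightarrow> j \<le> d \<Longrightarrow> p < ?N \<Longrightarrow> q < ?N \<Longrightarrow> coeff_mat j (H \<nu>) $$ (p, q) < 0"
    using eventually_happens'[OF sequentially_bot] by fastforce
  \<comment> \<open>In these degrees the coefficient of \<open>g \<nu>\<close> is zero and the limit
    is attained exactly, so the sign of \<open>lim\<close> carries over even where it is only weak.
    A large \<nu> was needed just for the finitely many entries in degrees L to d.\<close>
  have outside: "coeff_mat j (H \<nu>) $$ (p, q) = lim j p q" if "0 < j" "j < L \<or> d < j" "p < ?N" "q < ?N" for j p q
    using that gL[of j \<nu>] D1[of j \<nu>] d by (intro exact) auto
  have Hc: "H \<nu> \<in> carrier_mat ?N ?N"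
    unfolding H_def using Sc Gc[of \<nu>] by (intro mult_carrier_mat[of _ ?N ?N]) auto
  have le: "coeff_mat j (H \<nu>) $$ (p, q) \<le> 0" if "j > 0" "p < ?N" "q < ?N" for j p q
    using \<nu>[of j p q] outside[of j p q] lim_le[of j p q] that by (cases "j < L \<or> d < j") auto
  have primC: "primitive_mat (companion ?N (d + 1) (H \<nu>))"
  \<comment> \<open>The cycle lengths are L and L + 1, and the highest level belongs to degree d +
    1.\<close>
  proof (rule primitive_companion[OF Hc _ L(1) _ le])
    show "coeff_mat j (H \<nu>) $$ (p, q) < 0" if "j = L \<or> j = Suc L" "p < ?N" "q < ?N" for j p q
      using that d by (intro \<nu>) auto
    show "coeff_mat (d + 1) (H \<nu>) $$ (v, q) < 0" if "q < ?N" for q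
      using that v d outside[of "d + 1" v q] lim_less[of "d + 1" v q] by auto
  qed (use n d v in auto)
  have fam: "linear_mat (f \<nu>) \<in> carrier_mat k k" "linear_mat B \<in> carrier_mat (n + n) (n + n)" using fc Bc by auto
  have BfR: "direct_sum B (f \<nu>) \<in> mats_over R ?N ?N"
    using four_block_mats_over[OF B zero_mats_over zero_mats_over f(1)[of \<nu>]] Bc fc[of \<nu>] by auto
  note Bf = BfR[THEN mats_over_carrier]
  have linR: "linear_mat (direct_sum B (f \<nu>)) \<in> poly_mats_over R ?N"
    unfolding poly_mats_over_def using BfR Bf by (auto simp: coeff_mat_linear_mat[OF Bf])
  have "reach ?N (linear_mat (direct_sum B (f \<nu>))) (direct_sum M (g \<nu>))"
    unfolding linear_mat_direct_sum[OF Bc fc]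
    by (rule reach_trans[OF reach_direct_sum_right[OF g(2) fam(1) Mc] reach_direct_sum_left[OF M(1) fam(2,1)]])
  then have rH: "reach ?N (linear_mat (direct_sum B (f \<nu>))) (H \<nu>)"
    unfolding H_def by (rule reach.similarity[OF _ S])
  have HR: "H \<nu> \<in> poly_mats_over R ?N" by (rule reach_poly_mats_over[OF rH linR])
  have degH: "coeff_mat j (H \<nu>) = 0\<^sub>m ?N ?N" if "j > d + 1" for j
    using that Hc outside[of j] Mdeg pos by (intro eq_matI) (auto simp: lim_def)
  have "sse (companion ?N 1 (linear_mat (direct_sum B (f \<nu>)))) (companion ?N (d + 1) (H \<nu>))"
    by (rule reach_sse[OF rH linR]) (auto simp: coeff_mat_linear_mat[OF Bf] degH)
  then have "sse (direct_sum B (f \<nu>)) (companion ?N (d + 1) (H \<nu>))"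
    unfolding companion_linear_mat[OF Bf] .
  moreover have "esse (direct_sum A Q) (direct_sum B Q)"
    using esse_direct_sum_right[OF Q A B AB] Ac Bc Qc by simp
  moreover have "esse (direct_sum B Q) (direct_sum B (f \<nu>))"
    using esse_direct_sum_left[OF B Q f(1) f(2), of \<nu>] fc[of \<nu>] Bc Qc by simp
  ultimately have "sse (direct_sum A Q) (companion ?N (d + 1) (H \<nu>))"
    by (meson esse_imp_sse sse_trans)
  then show ?thesis using primC companion_mats_over[OF HR] by blast
qed

lemma sse_primitive_of_shift_equivalent:
  assumes A: "A \<in> mats_over R n n" and prim: "primitive_mat A" and "shift_equivalent R B A"
  shows "\<exists>m C. C \<in> mats_over R m m \<and> primitive_mat C \<and> sse B C"
proof -
  from assms(3) obtain m n' l U V where SE: "B \<in> mats_over R m m" "A \<in> mats_over R n' n'" "l > 0"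
    "U \<in> mats_over R m n'" "V \<in> mats_over R n' m" "B ^\<^sub>m l = U * V" "A ^\<^sub>m l = V * U" "B * U = U * A" "A * V = V * B"
    unfolding shift_equivalent_def by blast
  have [simp]: "n' = n" using SE(2) A by (auto dest!: mats_over_carrier)
  note SE = SE[simplified]
  \<comment> \<open>The matrix \<open>V\<close> of the shift equivalence is used both as the left
    inverse of \<open>U\<close> up to \<open>A ^ l\<close> and as the intertwiner \<open>P\<close>;
    these roles separate in the induction on l.\<close>
  from sse_direct_sum_nilpotent[OF A SE(1,4,5,5) SE(8) SE(9)[symmetric] SE(7)[symmetric] SE(6)]
  obtain k Q N where Q: "Q \<in> mats_over R k k" "Q ^\<^sub>m N = 0\<^sub>m k k"
    "sse B (four_block_mat A (0\<^sub>m n k) (0\<^sub>m k n) Q)" by blast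
  have "four_block_mat A (0\<^sub>m n k) (0\<^sub>m k n) Q = direct_sum A Q"
    using carrier_matD[OF mats_over_carrier[OF A]] carrier_matD[OF mats_over_carrier[OF Q(1)]] by simp
  then show ?thesis
    using sse_primitive_direct_sum_nilpotent[OF A prim Q(1,2)] Q(3) sse_trans by metis
qed

end

theorem theorem1p1:
  fixes R :: "real set" and A B :: "real mat" and n m :: nat
  assumes "subring R real_ring"
    and "closure R = UNIV"
    and "A \<in> mats_over R n n"
    and "primitive_mat A"
    and "B \<in> mats_over R m m"
    and "shift_equivalent R B A"
  shows "\<exists>k. \<exists>C \<in> mats_over R k k. primitive_mat C \<and> strong_shift_equivalent R B C"
proof -
  interpret dense_subring R
    using assms(1,2) by unfold_locales (auto simp: subring_real_ring_iff)
  show ?thesis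
    using sse_primitive_of_shift_equivalent[OF assms(3,4,6)] sse_iff_strong_shift_equivalent by blast
qed

end
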